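(* Let $V$ be a finite-dimensional real vector space equipped with a non-degenerate inner product $(\cdot,\cdot)$ of signature $(p,q)$ with $p<q$. Let $R$ be a spacelike Jordan Osserman algebraic curvature tensor on $V$. Then for every $x\in S^+(V)$ the Jacobi operator $\mathcal{J}_R(x)$ is diagonalizable (as a real linear map of $V$; in particular all of its eigenvalues are real).
   Context: Signature $(p,q)$ means that a maximal timelike subspace (on which $(\cdot,\cdot)$ is negative definite) has dimension $p$ and a maximal spacelike subspace (on which it is positive definite) has dimension $q$. An algebraic curvature tensor is $R\in\otimes^4V^*$ satisfying $R(x,y,z,w)=R(z,w,x,y)=-R(y,x,z,w)$ and $R(x,y,z,w)+R(y,z,x,w)+R(z,x,y,w)=0$. The Jacobi operator $\mathcal{J}_R(x)$ is the self-adjoint linear map of $V$ defined by $(\mathcal{J}_R(x)y,z)=R(y,x,x,z)$ for all $y,z\in V$. $S^+(V)=\{x\in V:(x,x)=1\}$ is the pseudo-sphere of unit spacelike vectors. $R$ is called spacelike Jordan Osserman if the Jordan normal form of $\mathcal{J}_R(x)$ is the same for all $x\in S^+(V)$. *)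

theory Defs
  imports "HOL-Analysis.Analysis"
begin

text \<open>A finite-dimensional real vector space is modelled by a type of class euclidean_space;
  the (indefinite) inner product is a separate bilinear form B, unrelated to the built-in one.\<close>

definition symmetric_form :: "('v::euclidean_space \<Rightarrow> 'v \<Rightarrow> real) \<Rightarrow> bool" where
  "symmetric_form B \<longleftrightarrow> bilinear B \<and> (\<forall>x y. B x y = B y x)"

definition nondegenerate_form :: "('v::euclidean_space \<Rightarrow> 'v \<Rightarrow> real) \<Rightarrow> bool" where
  "nondegenerate_form B \<longleftrightarrow> (\<forall>x. (\<forall>y. B x y = 0) \<longrightarrow> x = 0)"

definition timelike_subspace :: "('v::euclidean_space \<Rightarrow> 'v \<Rightarrow> real) \<Rightarrow> 'v set \<Rightarrow> bool" where
  "timelike_subspace B W \<longleftrightarrow> subspace W \<and> (\<forall>w\<in>W. w \<noteq> 0 \<longrightarrow> B w w < 0)"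

definition spacelike_subspace :: "('v::euclidean_space \<Rightarrow> 'v \<Rightarrow> real) \<Rightarrow> 'v set \<Rightarrow> bool" where
  "spacelike_subspace B W \<longleftrightarrow> subspace W \<and> (\<forall>w\<in>W. w \<noteq> 0 \<longrightarrow> B w w > 0)"

definition has_signature :: "('v::euclidean_space \<Rightarrow> 'v \<Rightarrow> real) \<Rightarrow> nat \<Rightarrow> nat \<Rightarrow> bool" where
  "has_signature B p q \<longleftrightarrow>
     (\<exists>W. timelike_subspace B W \<and> dim W = p) \<and> (\<forall>W. timelike_subspace B W \<longrightarrow> dim W \<le> p) \<and>
     (\<exists>W. spacelike_subspace B W \<and> dim W = q) \<and> (\<forall>W. spacelike_subspace B W \<longrightarrow> dim W \<le> q)"

definition multilinear4 :: "('v::euclidean_space \<Rightarrow> 'v \<Rightarrow> 'v \<Rightarrow> 'v \<Rightarrow> real) \<Rightarrow> bool" where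
  "multilinear4 R \<longleftrightarrow>
     (\<forall>y z w. linear (\<lambda>x. R x y z w)) \<and> (\<forall>x z w. linear (\<lambda>y. R x y z w)) \<and>
     (\<forall>x y w. linear (\<lambda>z. R x y z w)) \<and> (\<forall>x y z. linear (\<lambda>w. R x y z w))"

definition algebraic_curvature_tensor :: "('v::euclidean_space \<Rightarrow> 'v \<Rightarrow> 'v \<Rightarrow> 'v \<Rightarrow> real) \<Rightarrow> bool" where
  "algebraic_curvature_tensor R \<longleftrightarrow> multilinear4 R \<and>
     (\<forall>x y z w. R x y z w = R z w x y) \<and>
     (\<forall>x y z w. R x y z w = - R y x z w) \<and>
     (\<forall>x y z w. R x y z w + R y z x w + R z x y w = 0)"

definition jacobi_op :: "('v::euclidean_space \<Rightarrow> 'v \<Rightarrow> real) \<Rightarrow> ('v \<Rightarrow> 'v \<Rightarrow> 'v \<Rightarrow> 'v \<Rightarrow> real) \<Rightarrow> 'v \<Rightarrow> ('v \<Rightarrow> 'v)" where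
  "jacobi_op B R x = (THE f. linear f \<and> (\<forall>y z. B (f y) z = R y x x z))"

definition unit_spacelike :: "('v::euclidean_space \<Rightarrow> 'v \<Rightarrow> real) \<Rightarrow> 'v set" where
  "unit_spacelike B = {x. B x x = 1}"

text \<open>Two linear maps have the same Jordan normal form iff they are similar (conjugate by a
  linear automorphism); for real maps, similarity over the reals and over the complexes agree.\<close>
definition same_jordan_form :: "('v::euclidean_space \<Rightarrow> 'v) \<Rightarrow> ('v \<Rightarrow> 'v) \<Rightarrow> bool" where
  "same_jordan_form f g \<longleftrightarrow> (\<exists>P. linear P \<and> bij P \<and> g = P \<circ> f \<circ> inv P)"

definition spacelike_jordan_osserman ::
  "('v::euclidean_space \<Rightarrow> 'v \<Rightarrow> real) \<Rightarrow> ('v \<Rightarrow> 'v \<Rightarrow> 'v \<Rightarrow> 'v \<Rightarrow> real) \<Rightarrow> bool" where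
  "spacelike_jordan_osserman B R \<longleftrightarrow>
     (\<forall>x\<in>unit_spacelike B. \<forall>y\<in>unit_spacelike B. same_jordan_form (jacobi_op B R x) (jacobi_op B R y))"

definition diagonalizable :: "('v::euclidean_space \<Rightarrow> 'v) \<Rightarrow> bool" where
  "diagonalizable f \<longleftrightarrow> (\<exists>E. independent E \<and> span E = UNIV \<and> (\<forall>e\<in>E. \<exists>c::real. f e = c *\<^sub>R e))"

end

theory Submission
  imports Defs "HOL-Library.Z2" "HOL-Library.Poly_Mapping" "HOL-Library.Multiset"
    "HOL-Computational_Algebra.Fundamental_Theorem_Algebra"
begin

text \<open>
  Suppose that \<open>J x\<close> is not diagonalizable for one, hence for every, unit spacelike \<open>x\<close>. The minimal
  polynomial then provides a polynomial \<open>a\<close> such that \<open>A x = a (J x)\<close> is nonzero and either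
  \<open>A x\<close> squares to zero, so that its range is totally isotropic, or \<open>A x\<close> projects, up to an
  invertible factor, to a nondegenerate subspace on which \<open>(J x - \<alpha>) / \<beta>\<close> is a self-adjoint complex
  structure \<open>K x\<close>. In the first case put \<open>K x = id\<close>. In both cases \<open>K x\<close> turns nonnegative vectors of
  the range into nonpositive ones, the range has constant dimension, and it is orthogonal to \<open>x\<close>
  because \<open>J x x = 0\<close>.

  Let \<open>x\<close> run through the unit sphere of a maximal spacelike subspace and let \<open>u\<close> be a nonnegative
  vector of norm one in the range of \<open>A x\<close>. The pairs \<open>(x, u)\<close> form a compact space \<open>X\<close> that fibres
  over a sphere of dimension \<open>q - 1\<close>, each fibre being homotopy equivalent to a sphere of dimension
  \<open>r - 1\<close>, and \<open>X\<close> carries the involutions \<open>(- x, u)\<close> and \<open>(x, - u)\<close>. The spacelike part of \<open>u\<close> is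
  nonzero and orthogonal to \<open>x\<close>, and the timelike part of \<open>K x u\<close> is nonzero.

  Build a resolution of a point over the hemispheres of the base, equivariant under both
  involutions. If the fibre sphere is killed along the way, one obtains a mod 2 cycle of dimension
  \<open>q - 1\<close> that is invariant under the first involution and on which \<open>x\<close> has odd degree in the sense of
  Ky Fan; but \<open>x\<close> is homotopic through nonzero vectors to the spacelike part of \<open>u\<close>, which is
  invariant under that involution, a contradiction. Otherwise the second involution has index at
  least \<open>q\<close>, while the timelike part of \<open>K x u\<close> is an odd map to a punctured space of dimension
  \<open>p < q\<close>, which contradicts the Borsuk--Ulam theorem.
\<close>

subsection \<open>Chains modulo two\<close>

text \<open>The obstacle is that \<open>u\<close> cannot be chosen continuously over the sphere. If
  it were a continuous even function of \<open>x\<close>, then, since \<open>u\<close> is orthogonal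
  to \<open>x\<close>, the segments from \<open>x\<close> to the spacelike part of \<open>u\<close>
  would deform the identity of a sphere into an even map, whose degree is even. The resolution
  replaces the choice of \<open>u\<close>: either it yields a cycle that serves as the graph of such
  a function, or the class of the fibre survives and forces the sign of \<open>u\<close> to use up
  \<open>q\<close> dimensions, while only \<open>p\<close> timelike coordinates are there to detect
  it. The involution \<open>(- x, u)\<close> exists because \<open>J x\<close> is quadratic in
  \<open>x\<close>, so that the ranges over \<open>x\<close> and \<open>- x\<close> coincide. The
  fibres are controlled by compactness and by approximate transport, not by local trivializations.
  Homology is therefore expressed by tuples of nearby points, and every filling loses precision. At
  most \<open>q\<close> fillings follow one another, so a finite list of scales, chosen backwards
  from the coarsest, is enough. Degrees are read off by counting alternating simplices.\<close>

class char_two = comm_monoid_add +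
  assumes add_self [simp]: "x + x = 0"
begin

lemma add_self_left [simp]: "x + (x + y) = y"
  using add.assoc[of x x y] by simp

lemma eq_of_add_eq_zero: "x + y = 0 \<Longrightarrow> x = y"
  by (metis add.right_neutral add_self_left)

end

instance bit :: char_two
proof
  fix x :: bit
  show "x + x = 0" by (cases x) simp_all
qed

instance poly_mapping :: (type, char_two) char_two
  by standard (rule poly_mapping_eqI, simp add: lookup_add)

type_synonym 'a chain2 = "'a list \<Rightarrow>\<^sub>0 bit"

abbreviation sg :: "'b \<Rightarrow> 'b \<Rightarrow>\<^sub>0 bit" where
  "sg x \<equiv> Poly_Mapping.single x 1"

text \<open>The linear extension of \<open>f\<close>: the only nonzero coefficient is 1, and a
  generator that cancels contributes \<open>f x + f x = 0\<close>.\<close>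

definition ext :: "('b \<Rightarrow> 'm::char_two) \<Rightarrow> ('b \<Rightarrow>\<^sub>0 bit) \<Rightarrow> 'm" where
  "ext f c = (\<Sum>x\<in>Poly_Mapping.keys c. f x)"

lemma ext_superset:
  assumes "finite U" "Poly_Mapping.keys c \<subseteq> U"
  shows "ext f c = (\<Sum>x\<in>U. if Poly_Mapping.lookup c x = 1 then f x else 0)"
proof -
  have *: "{x \<in> U. Poly_Mapping.lookup c x = 1} = Poly_Mapping.keys c"
    using assms(2) by (auto simp: in_keys_iff)
  show ?thesis
    unfolding ext_def using assms(1) by (simp add: sum.inter_filter [symmetric] *)
qed

lemma ext_zero [simp]: "ext f 0 = 0"
  by (simp add: ext_def)

lemma ext_sg [simp]: "ext f (sg x) = f x"
  by (simp add: ext_def)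

lemma ext_add [simp]: "ext f (c + d) = ext f c + ext f d"
proof -
  let ?U = "Poly_Mapping.keys c \<union> Poly_Mapping.keys d"
  have U: "finite ?U" "Poly_Mapping.keys (c + d) \<subseteq> ?U"
    using keys_add [of c d] by auto
  have "(if a + b = 1 then m else 0) = (if a = 1 then m else 0) + (if b = 1 then m else 0)"
    for a b :: bit and m :: "'a"
    by (cases a; cases b) simp_all
  then show ?thesis
    using U by (simp add: ext_superset[of ?U] lookup_add sum.distrib)
qed

lemma sum_sg_keys: "(\<Sum>x\<in>Poly_Mapping.keys c. sg x) = (c :: 'b \<Rightarrow>\<^sub>0 bit)"
proof (rule poly_mapping_eqI)
  fix y
  have "Poly_Mapping.lookup (\<Sum>x\<in>Poly_Mapping.keys c. sg x) y
      = (\<Sum>x\<in>Poly_Mapping.keys c. if x = y then 1 else 0 :: bit)"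
    by (simp add: lookup_sum lookup_single when_def)
  also have "\<dots> = Poly_Mapping.lookup c y"
    by (simp add: in_keys_iff)
  finally show "Poly_Mapping.lookup (\<Sum>x\<in>Poly_Mapping.keys c. sg x) y = Poly_Mapping.lookup c y" .
qed

text \<open>Over \<open>bit\<close> every chain is the sum of its support, so additivity is already
  linearity.\<close>

lemma additive_eq_on:
  fixes F G :: "('b \<Rightarrow>\<^sub>0 bit) \<Rightarrow> 'm::char_two"
  assumes "\<And>c d. F (c + d) = F c + F d" "\<And>c d. G (c + d) = G c + G d"
    and "\<And>x. x \<in> Poly_Mapping.keys c \<Longrightarrow> F (sg x) = G (sg x)"
  shows "F c = G c"
proof -
  have F0: "F 0 = 0"
    using assms(1)[of 0 0] by simp
  have G0: "G 0 = 0"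
    using assms(2)[of 0 0] by simp
  have "F (\<Sum>x\<in>S. sg x) = G (\<Sum>x\<in>S. sg x)"
    if "finite S" "S \<subseteq> Poly_Mapping.keys c" for S
    using that by (induction S rule: finite_induct) (auto simp: F0 G0 assms)
  from this[of "Poly_Mapping.keys c"] show ?thesis
    by (simp add: sum_sg_keys)
qed

lemma additive_eq:
  fixes F G :: "('b \<Rightarrow>\<^sub>0 bit) \<Rightarrow> 'm::char_two"
  assumes "\<And>c d. F (c + d) = F c + F d" "\<And>c d. G (c + d) = G c + G d" "\<And>x. F (sg x) = G (sg x)"
  shows "F c = G c"
  by (rule additive_eq_on[OF assms])

lemma keys_ext: "Poly_Mapping.keys (ext f c) \<subseteq> (\<Union>x\<in>Poly_Mapping.keys c. Poly_Mapping.keys (f x))"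
  for f :: "'b \<Rightarrow> 'c \<Rightarrow>\<^sub>0 bit"
  unfolding ext_def by (rule keys_sum)

lemma ext_fun_add: "ext (\<lambda>x. f x + g x) c = ext f c + ext g c"
  by (simp add: ext_def sum.distrib)

lemma ext_cong: "(\<And>x. x \<in> Poly_Mapping.keys c \<Longrightarrow> f x = g x) \<Longrightarrow> ext f c = ext g c"
  by (simp add: ext_def)

section \<open>Boundary, cones and prisms on ordered tuples\<close>

definition cn :: "'a \<Rightarrow> 'a chain2 \<Rightarrow> 'a chain2" where
  "cn x = ext (\<lambda>ys. sg (x # ys))"

lemma cn_sg [simp]: "cn x (sg ys) = sg (x # ys)"
  and cn_add [simp]: "cn x (c + d) = cn x c + cn x d"
  and cn_zero [simp]: "cn x 0 = 0"
  by (simp_all add: cn_def)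

fun bdl :: "'a list \<Rightarrow> 'a chain2" where
  "bdl [] = 0"
| "bdl (x # xs) = sg xs + cn x (bdl xs)"

definition bd :: "'a chain2 \<Rightarrow> 'a chain2" where
  "bd = ext bdl"

lemma bd_sg [simp]: "bd (sg xs) = bdl xs"
  and bd_add [simp]: "bd (c + d) = bd c + bd d"
  and bd_zero [simp]: "bd 0 = 0"
  by (simp_all add: bd_def)

lemma bd_cn: "bd (cn x c) = c + cn x (bd c)"
  by (rule additive_eq) (simp_all add: ac_simps)

lemma bd_bdl: "bd (bdl xs) = 0"
  by (induction xs) (simp_all add: bd_cn)

lemma bd_bd [simp]: "bd (bd c) = 0"
  by (rule additive_eq[where G = "\<lambda>_. 0"]) (simp_all add: bd_bdl)

definition push :: "('a \<Rightarrow> 'b) \<Rightarrow> 'a chain2 \<Rightarrow> 'b chain2" where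
  "push f = ext (\<lambda>xs. sg (map f xs))"

lemma push_sg [simp]: "push f (sg xs) = sg (map f xs)"
  and push_add [simp]: "push f (c + d) = push f c + push f d"
  and push_zero [simp]: "push f 0 = 0"
  by (simp_all add: push_def)

lemma push_cn: "push f (cn x c) = cn (f x) (push f c)"
  by (rule additive_eq) simp_all

lemma bd_push: "bd (push f c) = push f (bd c)"
proof (rule additive_eq[where F = "\<lambda>c. bd (push f c)" and G = "\<lambda>c. push f (bd c)"])
  show "bd (push f (sg xs)) = push f (bd (sg xs))" for xs
    by (induction xs) (simp_all add: push_cn)
qed simp_all

lemma push_push: "push f (push g c) = push (\<lambda>x. f (g x)) c"
  by (rule additive_eq) (simp_all add: comp_def)

text \<open>The usual triangulation of a prism: the simplices that follow \<open>f\<close> up to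
  some vertex, repeat this vertex and continue with \<open>g\<close>.\<close>

fun prl :: "('a \<Rightarrow> 'b) \<Rightarrow> ('a \<Rightarrow> 'b) \<Rightarrow> 'a list \<Rightarrow> 'b chain2" where
  "prl f g [] = 0"
| "prl f g (x # xs) = sg (f x # g x # map g xs) + cn (f x) (prl f g xs)"

definition prism :: "('a \<Rightarrow> 'b) \<Rightarrow> ('a \<Rightarrow> 'b) \<Rightarrow> 'a chain2 \<Rightarrow> 'b chain2" where
  "prism f g = ext (prl f g)"

lemma prism_sg [simp]: "prism f g (sg xs) = prl f g xs"
  and prism_add [simp]: "prism f g (c + d) = prism f g c + prism f g d"
  and prism_zero [simp]: "prism f g 0 = 0"
  by (simp_all add: prism_def)

lemma prism_cn: "prism f g (cn x c) = cn (f x) (cn (g x) (push g c)) + cn (f x) (prism f g c)"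
  by (rule additive_eq) (simp_all add: ac_simps)

lemma bdl_map: "bdl (map f xs) = push f (bdl xs)"
  using bd_push[of f "sg xs"] by simp

lemma bd_prism: "bd (prism f g c) = push f c + push g c + prism f g (bd c)"
proof (rule additive_eq[where F = "\<lambda>c. bd (prism f g c)"
      and G = "\<lambda>c. push f c + push g c + prism f g (bd c)"])
  show "bd (prism f g (sg xs)) = push f (sg xs) + push g (sg xs) + prism f g (bd (sg xs))" for xs
    by (induction xs) (simp_all add: bd_cn prism_cn bdl_map ac_simps)
qed (simp_all add: ac_simps)

text \<open>Vietoris-style chains: formal sums of \<open>L\<close>-tuples of nearby points; the empty tuple
  makes the complex augmented.\<close>

definition sm :: "'a::metric_space set \<Rightarrow> real \<Rightarrow> nat \<Rightarrow> 'a chain2 \<Rightarrow> bool" where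
  "sm K e L c \<longleftrightarrow> (\<forall>xs\<in>Poly_Mapping.keys c. length xs = L \<and> set xs \<subseteq> K \<and>
      (\<forall>u\<in>set xs. \<forall>v\<in>set xs. dist u v \<le> e))"

lemma sm_zero [simp]: "sm K e L 0"
  by (simp add: sm_def)

lemma sm_sg: "sm K e L (sg xs) \<longleftrightarrow> length xs = L \<and> set xs \<subseteq> K \<and> (\<forall>u\<in>set xs. \<forall>v\<in>set xs. dist u v \<le> e)"
  by (simp add: sm_def)

lemma sm_add: "sm K e L c \<Longrightarrow> sm K e L d \<Longrightarrow> sm K e L (c + d)"
  using keys_add[of c d] unfolding sm_def by blast

lemma sm_mono: "sm K e L c \<Longrightarrow> K \<subseteq> K' \<Longrightarrow> e \<le> e' \<Longrightarrow> sm K' e' L c"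
  unfolding sm_def by (meson order_trans subset_trans)

lemma keys_cn: "Poly_Mapping.keys (cn x c) \<subseteq> (\<lambda>ys. x # ys) ` Poly_Mapping.keys c"
  unfolding cn_def using keys_ext[of "\<lambda>ys. sg (x # ys)" c] by auto

lemma keys_bdl:
  "ys \<in> Poly_Mapping.keys (bdl xs) \<Longrightarrow> Suc (length ys) = length xs \<and> set ys \<subseteq> set xs"
proof (induction xs arbitrary: ys)
  case (Cons x xs)
  from Cons.prems consider "ys = xs" | zs where "zs \<in> Poly_Mapping.keys (bdl xs)" "ys = x # zs"
    using keys_add[of "sg xs" "cn x (bdl xs)"] keys_cn[of x "bdl xs"] by auto
  then show ?case
    using Cons.IH by cases fastforce+
qed simp

lemma keys_bd: "ys \<in> Poly_Mapping.keys (bd c) \<Longrightarrow>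
    \<exists>xs\<in>Poly_Mapping.keys c. Suc (length ys) = length xs \<and> set ys \<subseteq> set xs"
  unfolding bd_def using keys_ext[of bdl c] keys_bdl by fastforce

lemma sm_bd: "sm K e (Suc L) c \<Longrightarrow> sm K e L (bd c)"
  unfolding sm_def
proof
  assume c: "\<forall>xs\<in>Poly_Mapping.keys c. length xs = Suc L \<and> set xs \<subseteq> K \<and> (\<forall>u\<in>set xs. \<forall>v\<in>set xs. dist u v \<le> e)"
  fix ys assume "ys \<in> Poly_Mapping.keys (bd c)"
  then obtain xs where "xs \<in> Poly_Mapping.keys c" and "Suc (length ys) = length xs" "set ys \<subseteq> set xs"
    using keys_bd by blast
  with c show "length ys = L \<and> set ys \<subseteq> K \<and> (\<forall>u\<in>set ys. \<forall>v\<in>set ys. dist u v \<le> e)"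
    by (metis Suc_inject subset_eq)
qed

lemma keys_push: "Poly_Mapping.keys (push f c) \<subseteq> map f ` Poly_Mapping.keys c"
  unfolding push_def using keys_ext[of "\<lambda>xs. sg (map f xs)" c] by auto

lemma sm_push:
  assumes "sm K e L c" "\<And>u. u \<in> K \<Longrightarrow> f u \<in> M"
    and "\<And>u v. u \<in> K \<Longrightarrow> v \<in> K \<Longrightarrow> dist u v \<le> e \<Longrightarrow> dist (f u) (f v) \<le> d"
  shows "sm M d L (push f c)"
  unfolding sm_def
proof
  fix ys assume "ys \<in> Poly_Mapping.keys (push f c)"
  then obtain xs where xs: "xs \<in> Poly_Mapping.keys c" "ys = map f xs"
    using keys_push[of f c] by auto
  with assms(1) have "length xs = L" "set xs \<subseteq> K" "\<forall>u\<in>set xs. \<forall>v\<in>set xs. dist u v \<le> e"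
    unfolding sm_def by auto
  with xs assms(2,3) show "length ys = L \<and> set ys \<subseteq> M \<and> (\<forall>u\<in>set ys. \<forall>v\<in>set ys. dist u v \<le> d)"
    by (auto simp: subset_iff)
qed

lemma keys_prl: "ys \<in> Poly_Mapping.keys (prl f g xs) \<Longrightarrow>
    length ys = Suc (length xs) \<and> set ys \<subseteq> f ` set xs \<union> g ` set xs"
proof (induction xs arbitrary: ys)
  case (Cons x xs)
  from Cons.prems consider "ys = f x # g x # map g xs"
    | zs where "zs \<in> Poly_Mapping.keys (prl f g xs)" "ys = f x # zs"
    using keys_add[of "sg (f x # g x # map g xs)" "cn (f x) (prl f g xs)"]
      keys_cn[of "f x" "prl f g xs"] by auto
  then show ?case
    using Cons.IH by cases fastforce+
qed simp

lemma sm_prism: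
  assumes "sm K e L c" "\<And>u. u \<in> K \<Longrightarrow> f u \<in> M" "\<And>u. u \<in> K \<Longrightarrow> g u \<in> M"
    and "\<And>u v. u \<in> K \<Longrightarrow> v \<in> K \<Longrightarrow> dist u v \<le> e \<Longrightarrow>
      dist (f u) (f v) \<le> d \<and> dist (g u) (g v) \<le> d \<and> dist (f u) (g v) \<le> d"
  shows "sm M d (Suc L) (prism f g c)"
  unfolding sm_def
proof
  fix ys assume "ys \<in> Poly_Mapping.keys (prism f g c)"
  then obtain xs where xs: "xs \<in> Poly_Mapping.keys c" "ys \<in> Poly_Mapping.keys (prl f g xs)"
    unfolding prism_def using keys_ext[of "prl f g" c] by auto
  from xs(1) assms(1) have K: "length xs = L" "set xs \<subseteq> K"
    and e: "\<And>u v. u \<in> set xs \<Longrightarrow> v \<in> set xs \<Longrightarrow> dist u v \<le> e"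
    unfolding sm_def by auto
  have d: "dist (f u) (f v) \<le> d" "dist (g u) (g v) \<le> d" "dist (f u) (g v) \<le> d" "dist (g v) (f u) \<le> d"
    if "u \<in> set xs" "v \<in> set xs" for u v
    using that assms(4)[of u v] e K(2) by (auto simp: dist_commute)
  from keys_prl[OF xs(2)] have ys: "length ys = Suc L" "set ys \<subseteq> f ` set xs \<union> g ` set xs"
    using K(1) by auto
  moreover have "set ys \<subseteq> M"
    using ys(2) K(2) assms(2,3) by blast
  moreover have "dist u v \<le> d" if "u \<in> set ys" "v \<in> set ys" for u v
    using that ys(2) d by blast
  ultimately show "length ys = Suc L \<and> set ys \<subseteq> M \<and> (\<forall>u\<in>set ys. \<forall>v\<in>set ys. dist u v \<le> d)"
    by blast
qed

lemma push_id_on: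
  assumes "sm K e L c" "\<And>u. u \<in> K \<Longrightarrow> f u = u"
  shows "push f c = c"
proof (rule additive_eq_on[where G = "\<lambda>c. c"])
  fix xs assume "xs \<in> Poly_Mapping.keys c"
  then have "set xs \<subseteq> K" using assms(1) by (auto simp: sm_def)
  then have "map f xs = xs" using assms(2) by (simp add: map_idI subset_iff)
  then show "push f (sg xs) = sg xs" by simp
qed simp_all

definition filt :: "('b \<Rightarrow> bool) \<Rightarrow> ('b \<Rightarrow>\<^sub>0 bit) \<Rightarrow> ('b \<Rightarrow>\<^sub>0 bit)" where
  "filt P = ext (\<lambda>x. if P x then sg x else 0)"

lemma filt_add: "filt P (c + d) = filt P c + filt P d"
  by (simp add: filt_def)

lemma filt_split: "filt P c + filt (\<lambda>x. \<not> P x) c = c"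
  unfolding filt_def by (rule additive_eq) (simp_all add: ac_simps)

lemma keys_filt: "Poly_Mapping.keys (filt P c) \<subseteq> {x \<in> Poly_Mapping.keys c. P x}"
  unfolding filt_def using keys_ext[of "\<lambda>x. if P x then sg x else 0" c]
  by (force split: if_splits)

subsection \<open>Sets with the homology of a sphere\<close>

text \<open>\<open>L\<close> counts vertices, so this is the vanishing of reduced homology in degree
  \<open>L - 1\<close> on the way from \<open>K\<close> to \<open>M\<close>. The fineness
  \<open>e\<close> of the cycles depends on the fineness \<open>d\<close> wanted for the
  filling.\<close>

definition bounds_in :: "'a::metric_space set \<Rightarrow> 'a set \<Rightarrow> nat \<Rightarrow> bool" where
  "bounds_in K M L \<longleftrightarrow> (\<forall>d>0. \<exists>e>0. \<forall>c. sm K e L c \<longrightarrow> bd c = 0 \<longrightarrow> (\<exists>u. sm M d (Suc L) u \<and> bd u = c))"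

text \<open>The chains \<open>b\<close>, \<open>c\<close> and \<open>b + c\<close> are the nonzero
  combinations over the field with two elements, so this bounds the rank of the homology by
  one.\<close>

definition two_in :: "'a::metric_space set \<Rightarrow> 'a set \<Rightarrow> nat \<Rightarrow> bool" where
  "two_in K M L \<longleftrightarrow> (\<forall>d>0. \<exists>e>0. \<forall>b c. sm K e L b \<longrightarrow> sm K e L c \<longrightarrow> bd b = 0 \<longrightarrow> bd c = 0 \<longrightarrow>
     (\<exists>u. sm M d (Suc L) u \<and> (bd u = b \<or> bd u = c \<or> bd u = b + c)))"

text \<open>Up to passing to finer chains, \<open>K\<close> has at most the reduced mod 2 homology of the
  sphere of dimension \<open>r - 1\<close> inside \<open>M\<close>.\<close>

definition sphere_like :: "'a::metric_space set \<Rightarrow> 'a set \<Rightarrow> nat \<Rightarrow> bool" where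
  "sphere_like K M r \<longleftrightarrow> (\<forall>L. L \<noteq> r \<longrightarrow> bounds_in K M L) \<and> two_in K M r"

section \<open>Invariance under deformations in small steps\<close>

lemma step_chain:
  fixes f :: "nat \<Rightarrow> 'a::metric_space \<Rightarrow> 'a"
  assumes "bd c = 0"
  shows "bd (\<Sum>i<n. prism (f i) (f (Suc i)) c) = push (f 0) c + push (f n) c"
proof (induction n)
  case (Suc n)
  then show ?case
    using assms by (simp add: bd_prism ac_simps)
qed simp

lemma sm_sum: "finite I \<Longrightarrow> (\<And>i. i \<in> I \<Longrightarrow> sm K e L (c i)) \<Longrightarrow> sm K e L (\<Sum>i\<in>I. c i)"
  by (induction I rule: finite_induct) (auto intro: sm_add)

lemma uniform_modulus:
  fixes f :: "nat \<Rightarrow> 'a::metric_space \<Rightarrow> 'b::metric_space"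
  assumes "\<And>i. i \<le> n \<Longrightarrow> uniformly_continuous_on K (f i)" "d > 0"
  obtains e where "e > 0" "\<And>i u v. i \<le> n \<Longrightarrow> u \<in> K \<Longrightarrow> v \<in> K \<Longrightarrow> dist u v \<le> e \<Longrightarrow> dist (f i u) (f i v) \<le> d"
proof -
  have "\<exists>e>0. \<forall>u\<in>K. \<forall>v\<in>K. dist u v \<le> e \<longrightarrow> dist (f i u) (f i v) \<le> d" if i: "i \<le> n" for i
  proof -
    obtain e where e: "e > 0" "\<And>u v. u \<in> K \<Longrightarrow> v \<in> K \<Longrightarrow> dist v u < e \<Longrightarrow> dist (f i v) (f i u) < d"
      using assms(1)[OF i] assms(2) unfolding uniformly_continuous_on_def by meson
    have "\<forall>u\<in>K. \<forall>v\<in>K. dist u v \<le> e / 2 \<longrightarrow> dist (f i u) (f i v) \<le> d"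
    proof (intro ballI impI)
      fix u v assume uv: "u \<in> K" "v \<in> K" "dist u v \<le> e / 2"
      have "dist u v < e" using uv(3) e(1) by simp
      then show "dist (f i u) (f i v) \<le> d" using e(2)[OF uv(2,1)] by simp
    qed
    then show ?thesis using e(1) half_gt_zero by blast
  qed
  then obtain E where E: "\<And>i. i \<le> n \<Longrightarrow> E i > 0"
      "\<And>i u v. i \<le> n \<Longrightarrow> u \<in> K \<Longrightarrow> v \<in> K \<Longrightarrow> dist u v \<le> E i \<Longrightarrow> dist (f i u) (f i v) \<le> d"
    by metis
  let ?e = "Min (E ` {..n})"
  have "?e > 0" using E(1) by (subst Min_gr_iff) auto
  moreover have "?e \<le> E i" if "i \<le> n" for i using that by (intro Min_le) auto
  ultimately show ?thesis using that E(2) by (meson order_trans)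
qed

lemma deform_core:
  fixes f :: "nat \<Rightarrow> 'a::metric_space \<Rightarrow> 'a"
  assumes f0: "\<And>z. z \<in> K \<Longrightarrow> f 0 z = z" and fn: "\<And>z. z \<in> K \<Longrightarrow> f n z \<in> N"
    and fM: "\<And>i z. i \<le> n \<Longrightarrow> z \<in> K \<Longrightarrow> f i z \<in> M"
    and uc: "\<And>i. i \<le> n \<Longrightarrow> uniformly_continuous_on K (f i)"
    and near: "\<And>i z. i < n \<Longrightarrow> z \<in> K \<Longrightarrow> dist (f i z) (f (Suc i) z) \<le> d / 2"
    and "d > 0" "e' > 0"
  obtains e where "e > 0" "\<And>L c. sm K e L c \<Longrightarrow> bd c = 0 \<Longrightarrow>
    sm N e' L (push (f n) c) \<and> (\<exists>u. sm M d (Suc L) u \<and> bd u = c + push (f n) c)"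
proof -
  have pos: "min e' (d / 2) > 0" using assms(6,7) by simp
  obtain e where e: "e > 0" "\<And>i u v. i \<le> n \<Longrightarrow> u \<in> K \<Longrightarrow> v \<in> K \<Longrightarrow> dist u v \<le> e \<Longrightarrow>
      dist (f i u) (f i v) \<le> min e' (d / 2)"
    using uniform_modulus[of n K f, OF uc pos] by blast
  have "sm N e' L (push (f n) c) \<and> (\<exists>u. sm M d (Suc L) u \<and> bd u = c + push (f n) c)"
    if c: "sm K e L c" "bd c = 0" for L c
  proof
    show "sm N e' L (push (f n) c)"
      by (rule sm_push[OF c(1)]) (use fn e(2)[of n] in auto)
    have "sm M d (Suc L) (prism (f i) (f (Suc i)) c)" if i: "i < n" for i
    proof (rule sm_prism[OF c(1)])
      fix u v assume uv: "u \<in> K" "v \<in> K" "dist u v \<le> e"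
      have "dist (f i u) (f i v) \<le> d / 2" "dist (f (Suc i) u) (f (Suc i) v) \<le> d / 2"
        using e(2)[of i u v] e(2)[of "Suc i" u v] i uv by auto
      moreover have "dist (f i u) (f (Suc i) v) \<le> dist (f i u) (f i v) + dist (f i v) (f (Suc i) v)"
        by (rule dist_triangle)
      ultimately show "dist (f i u) (f i v) \<le> d \<and> dist (f (Suc i) u) (f (Suc i) v) \<le> d
          \<and> dist (f i u) (f (Suc i) v) \<le> d"
        using near[OF i uv(2)] \<open>d > 0\<close> by linarith
    qed (use i fM in auto)
    then have "sm M d (Suc L) (\<Sum>i<n. prism (f i) (f (Suc i)) c)"
      by (intro sm_sum) auto
    moreover have "bd (\<Sum>i<n. prism (f i) (f (Suc i)) c) = c + push (f n) c"
      using step_chain[OF c(2), of f n] push_id_on[OF c(1), of "f 0"] f0 by simp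
    ultimately show "\<exists>u. sm M d (Suc L) u \<and> bd u = c + push (f n) c"
      by blast
  qed
  then show ?thesis using e(1) that by blast
qed

text \<open>The maps may depend on the step size \<open>d\<close>. Transport between fibres is
  available only in this weak form: for each tolerance it gives continuous small steps, which need
  not fit into one homotopy.\<close>

definition deforms_into :: "'a::metric_space set \<Rightarrow> 'a set \<Rightarrow> 'a set \<Rightarrow> bool" where
  "deforms_into K M N \<longleftrightarrow> (\<forall>d>0. \<exists>(n::nat) f. (\<forall>z\<in>K. f 0 z = z \<and> f n z \<in> N) \<and>
     (\<forall>i\<le>n. (\<forall>z\<in>K. f i z \<in> M) \<and> uniformly_continuous_on K (f i)) \<and>
     (\<forall>i<n. \<forall>z\<in>K. dist (f i z) (f (Suc i) z) \<le> d))"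

lemma deforms_intoD:
  fixes K M N :: "'a::metric_space set"
  assumes "deforms_into K M N" "d > 0" "e' > 0"
  obtains e g where "e > 0" "\<And>L c. sm K e L c \<Longrightarrow> bd c = 0 \<Longrightarrow>
    sm N e' L (push g c) \<and> (\<exists>u. sm M d (Suc L) u \<and> bd u = c + push g c)"
proof -
  have "d / 2 > 0" using assms(2) by simp
  from assms(1)[unfolded deforms_into_def, rule_format, OF this] obtain n :: nat and f where f:
    "\<forall>z\<in>K. f 0 z = z \<and> f n z \<in> N" "\<forall>i\<le>n. (\<forall>z\<in>K. f i z \<in> M) \<and> uniformly_continuous_on K (f i)"
    "\<forall>i<n. \<forall>z\<in>K. dist (f i z) (f (Suc i) z) \<le> d / 2"
    by blast
  obtain e where e: "e > 0" "\<And>L c. sm K e L c \<Longrightarrow> bd c = 0 \<Longrightarrow>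
    sm N e' L (push (f n) c) \<and> (\<exists>u. sm M d (Suc L) u \<and> bd u = c + push (f n) c)"
    by (rule deform_core[of K f n N M d e']) (use f assms(2,3) in auto)
  show ?thesis
    by (rule that[OF e])
qed

lemma bounds_in_deform:
  assumes "deforms_into K M N" "bounds_in N M L"
  shows "bounds_in K M L"
  unfolding bounds_in_def
proof (intro allI impI)
  fix d :: real assume "d > 0"
  then obtain e' where e': "e' > 0" "\<And>c. sm N e' L c \<Longrightarrow> bd c = 0 \<Longrightarrow> \<exists>u. sm M d (Suc L) u \<and> bd u = c"
    using assms(2) unfolding bounds_in_def by meson
  obtain e g where e: "e > 0" "\<And>L c. sm K e L c \<Longrightarrow> bd c = 0 \<Longrightarrow>
    sm N e' L (push g c) \<and> (\<exists>u. sm M d (Suc L) u \<and> bd u = c + push g c)"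
    using deforms_intoD[OF assms(1) \<open>d > 0\<close> e'(1)] by metis
  have "\<exists>u. sm M d (Suc L) u \<and> bd u = c" if c: "sm K e L c" "bd c = 0" for c
  proof -
    obtain u v where "sm M d (Suc L) u" "bd u = c + push g c" "sm M d (Suc L) v" "bd v = push g c"
      using e(2)[OF c] e'(2)[of "push g c"] c(2) by (auto simp: bd_push)
    then show ?thesis
      by (intro exI[of _ "u + v"]) (simp add: sm_add ac_simps)
  qed
  then show "\<exists>e>0. \<forall>c. sm K e L c \<longrightarrow> bd c = 0 \<longrightarrow> (\<exists>u. sm M d (Suc L) u \<and> bd u = c)"
    using e(1) by blast
qed

lemma two_in_deform:
  assumes "deforms_into K M N" "two_in N M L"
  shows "two_in K M L"
  unfolding two_in_def
proof (intro allI impI)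
  fix d :: real assume "d > 0"
  then obtain e' where e': "e' > 0" "\<And>b c. sm N e' L b \<Longrightarrow> sm N e' L c \<Longrightarrow> bd b = 0 \<Longrightarrow> bd c = 0 \<Longrightarrow>
       \<exists>u. sm M d (Suc L) u \<and> (bd u = b \<or> bd u = c \<or> bd u = b + c)"
    using assms(2) unfolding two_in_def by meson
  obtain e g where e: "e > 0" "\<And>L c. sm K e L c \<Longrightarrow> bd c = 0 \<Longrightarrow>
    sm N e' L (push g c) \<and> (\<exists>u. sm M d (Suc L) u \<and> bd u = c + push g c)"
    using deforms_intoD[OF assms(1) \<open>d > 0\<close> e'(1)] by metis
  have "\<exists>u. sm M d (Suc L) u \<and> (bd u = b \<or> bd u = c \<or> bd u = b + c)"
    if b: "sm K e L b" "bd b = 0" and c: "sm K e L c" "bd c = 0" for b c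
  proof -
    obtain u v where uv: "sm M d (Suc L) u" "bd u = b + push g b" "sm M d (Suc L) v" "bd v = c + push g c"
      using e(2)[OF c] e(2)[OF b] by auto
    obtain w where w: "sm M d (Suc L) w" "bd w = push g b \<or> bd w = push g c \<or> bd w = push g b + push g c"
      using e'(2)[of "push g b" "push g c"] e(2)[OF c] e(2)[OF b] b(2) c(2) by (auto simp: bd_push)
    from w(2) consider "bd (w + u) = b" | "bd (w + v) = c" | "bd (w + u + v) = b + c"
      using uv by (auto simp: ac_simps)
    then show ?thesis
      using uv w by cases (blast intro: sm_add)+
  qed
  then show "\<exists>e>0. \<forall>b c. sm K e L b \<longrightarrow> sm K e L c \<longrightarrow> bd b = 0 \<longrightarrow> bd c = 0 \<longrightarrow>
     (\<exists>u. sm M d (Suc L) u \<and> (bd u = b \<or> bd u = c \<or> bd u = b + c))"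
    using e(1) by blast
qed

lemma sphere_like_deform: "deforms_into K M N \<Longrightarrow> sphere_like N M r \<Longrightarrow> sphere_like K M r"
  unfolding sphere_like_def using bounds_in_deform two_in_deform by blast

lemma sm_smaller: "sm K e' L c \<Longrightarrow> e' \<le> e \<Longrightarrow> sm K e L c"
  by (auto intro: sm_mono)

lemma sphere_like_mono:
  assumes "sphere_like K M r" "M \<subseteq> M'"
  shows "sphere_like K M' r"
  unfolding sphere_like_def
proof (intro conjI allI impI)
  fix L assume "L \<noteq> r"
  then have *: "bounds_in K M L" using assms(1) by (simp add: sphere_like_def)
  show "bounds_in K M' L"
    unfolding bounds_in_def
  proof (intro allI impI)
    fix d :: real assume "d > 0"
    from *[unfolded bounds_in_def, rule_format, OF this] obtain e where "e > 0"
      "\<forall>c. sm K e L c \<longrightarrow> bd c = 0 \<longrightarrow> (\<exists>u. sm M d (Suc L) u \<and> bd u = c)" by blast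
    then show "\<exists>e>0. \<forall>c. sm K e L c \<longrightarrow> bd c = 0 \<longrightarrow> (\<exists>u. sm M' d (Suc L) u \<and> bd u = c)"
      using sm_mono[OF _ assms(2) order_refl] by blast
  qed
next
  have *: "two_in K M r" using assms(1) by (simp add: sphere_like_def)
  show "two_in K M' r"
    unfolding two_in_def
  proof (intro allI impI)
    fix d :: real assume "d > 0"
    from *[unfolded two_in_def, rule_format, OF this] obtain e where "e > 0"
      "\<forall>b c. sm K e r b \<longrightarrow> sm K e r c \<longrightarrow> bd b = 0 \<longrightarrow> bd c = 0 \<longrightarrow>
         (\<exists>u. sm M d (Suc r) u \<and> (bd u = b \<or> bd u = c \<or> bd u = b + c))" by blast
    then show "\<exists>e>0. \<forall>b c. sm K e r b \<longrightarrow> sm K e r c \<longrightarrow> bd b = 0 \<longrightarrow> bd c = 0 \<longrightarrow>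
         (\<exists>u. sm M' d (Suc r) u \<and> (bd u = b \<or> bd u = c \<or> bd u = b + c))"
      using sm_mono[OF _ assms(2) order_refl] by blast
  qed
qed

lemma bit_chain_on_single:
  fixes c :: "'b \<Rightarrow>\<^sub>0 bit"
  assumes "Poly_Mapping.keys c \<subseteq> {x}"
  shows "c = 0 \<or> c = sg x"
  using assms sum_sg_keys[of c] by (auto simp: subset_singleton_iff)

lemma bdl_replicate: "bdl (replicate n p) = (if odd n then sg (replicate (n - 1) p) else 0)"
proof (induction n)
  case (Suc n)
  then show ?case by (cases n) auto
qed simp

text \<open>There is one constant tuple of each length, and its boundary vanishes for even length
  only. A cycle of even length is the boundary of the constant tuple that is longer by one.\<close>

lemma bounds_in_point:
  assumes "p \<in> M"
  shows "bounds_in {p} M L"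
  unfolding bounds_in_def
proof (intro allI impI)
  fix d :: real assume "d > 0"
  have "\<exists>u. sm M d (Suc L) u \<and> bd u = c" if c: "sm {p} 1 L c" "bd c = 0" for c
  proof -
    have "Poly_Mapping.keys c \<subseteq> {replicate L p}"
    proof
      fix xs assume "xs \<in> Poly_Mapping.keys c"
      then have "length xs = L" "\<And>y. y \<in> set xs \<Longrightarrow> y = p"
        using c(1) by (auto simp: sm_def)
      then show "xs \<in> {replicate L p}" by (simp add: replicate_eqI)
    qed
    from bit_chain_on_single[OF this] consider "c = 0" | "c = sg (replicate L p)"
      by argo
    then show ?thesis
    proof cases
      case 2
      have "even L"
      proof (rule ccontr)
        assume "odd L"
        then have "sg (replicate (L - 1) p) = (0 :: 'a chain2)"
          using c(2) 2 by (simp add: bdl_replicate)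
        then have "Poly_Mapping.lookup (sg (replicate (L - 1) p)) (replicate (L - 1) p) = (0 :: bit)"
          by (simp only: lookup_zero)
        then show False by simp
      qed
      then have "bd (sg (replicate (Suc L) p)) = c"
        using 2 bdl_replicate[of "Suc L" p] by simp
      moreover have "sm M d (Suc L) (sg (replicate (Suc L) p))"
        using assms \<open>d > 0\<close> by (auto simp: sm_sg)
      ultimately show ?thesis by blast
    qed (auto intro: exI[of _ 0])
  qed
  then show "\<exists>e>0. \<forall>c. sm {p} e L c \<longrightarrow> bd c = 0 \<longrightarrow> (\<exists>u. sm M d (Suc L) u \<and> bd u = c)"
    using zero_less_one by blast
qed

lemma deforms_into_homotopy:
  fixes h :: "real \<Rightarrow> 'a::metric_space \<Rightarrow> 'a"
  assumes "compact K" and cont: "continuous_on ({0..1} \<times> K) (\<lambda>(t, z). h t z)"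
    and h0: "\<And>z. z \<in> K \<Longrightarrow> h 0 z = z" and h1: "\<And>z. z \<in> K \<Longrightarrow> h 1 z \<in> N"
    and hM: "\<And>t z. t \<in> {0..1} \<Longrightarrow> z \<in> K \<Longrightarrow> h t z \<in> M"
  shows "deforms_into K M N"
  unfolding deforms_into_def
proof (intro allI impI)
  fix d :: real assume "d > 0"
  have uc: "uniformly_continuous_on ({0..1} \<times> K) (\<lambda>(t, z). h t z)"
    by (intro compact_uniformly_continuous cont compact_Times assms compact_Icc)
  then obtain e where e: "e > 0" "\<And>s t z. s \<in> {0..1} \<Longrightarrow> t \<in> {0..1} \<Longrightarrow> z \<in> K \<Longrightarrow> dist s t < e \<Longrightarrow>
      dist (h s z) (h t z) < d"
    unfolding uniformly_continuous_on_def using \<open>d > 0\<close> by (fastforce simp: dist_Pair_Pair)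
  obtain n :: nat where n: "n > 0" "1 / real n < e"
    using e(1) by (metis nat_approx_posE zero_less_Suc of_nat_Suc add.commute)
  define f where "f = (\<lambda>i z. h (real i / real n) z)"
  have I: "real i / real n \<in> {0..1}" if "i \<le> n" for i
    using that n(1) by (auto simp: divide_simps)
  have "uniformly_continuous_on K (f i)" if "i \<le> n" for i
  proof -
    have "continuous_on K (\<lambda>z. (\<lambda>(t, z). h t z) (real i / real n, z))"
      by (rule continuous_on_compose2[OF cont]) (use I[OF that] in \<open>auto intro!: continuous_intros\<close>)
    then show ?thesis
      unfolding f_def using compact_uniformly_continuous assms(1) by auto
  qed
  moreover have "dist (f i z) (f (Suc i) z) \<le> d" if "i < n" "z \<in> K" for i z
  proof -
    have "dist (real i / real n) (real (Suc i) / real n) = 1 / real n"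
      using n(1) by (simp add: dist_real_def diff_divide_distrib[symmetric])
    then show ?thesis
      unfolding f_def using e(2)[of "real i / real n" "real (Suc i) / real n" z] I[of i] I[of "Suc i"] n that
      by (intro less_imp_le) auto
  qed
  moreover have "f 0 z = z \<and> f n z \<in> N" if "z \<in> K" for z
    using that h0 h1 n(1) by (simp add: f_def)
  moreover have "f i z \<in> M" if "i \<le> n" "z \<in> K" for i z
    using that I hM by (simp add: f_def)
  ultimately show "\<exists>n f. (\<forall>z\<in>K. f 0 z = z \<and> f n z \<in> N) \<and>
     (\<forall>i\<le>n. (\<forall>z\<in>K. f i z \<in> M) \<and> uniformly_continuous_on K (f i)) \<and>
     (\<forall>i<n. \<forall>z\<in>K. dist (f i z) (f (Suc i) z) \<le> d)"
    by blast
qed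

text \<open>\<open>M\<close> is a retract of \<open>K\<close> by way of \<open>g\<close> and
  \<open>f\<close>: cycles are moved to \<open>K\<close>, filled there, and the fillings are moved
  back.\<close>

lemma sphere_like_homeo:
  fixes f :: "'a::metric_space \<Rightarrow> 'b::metric_space"
  assumes "sphere_like K K r"
    and f: "uniformly_continuous_on K f" "\<And>x. x \<in> K \<Longrightarrow> f x \<in> M"
    and g: "uniformly_continuous_on M g" "\<And>y. y \<in> M \<Longrightarrow> g y \<in> K \<and> f (g y) = y"
  shows "sphere_like M M r"
proof -
  have fm: "\<exists>d'>0. \<forall>L u. sm K d' L u \<longrightarrow> sm M d L (push f u)" if d: "d > 0" for d
  proof -
    obtain d' where "d' > 0" "\<And>i u v. i \<le> (0::nat) \<Longrightarrow> u \<in> K \<Longrightarrow> v \<in> K \<Longrightarrow> dist u v \<le> d' \<Longrightarrow> dist (f u) (f v) \<le> d"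
      using uniform_modulus[of 0 K "\<lambda>_. f" d] f(1) d by blast
    then have "\<forall>L u. sm K d' L u \<longrightarrow> sm M d L (push f u)"
      using f(2) by (auto intro!: sm_push)
    then show ?thesis using \<open>d' > 0\<close> by blast
  qed
  have gm: "\<exists>d'>0. \<forall>L u. sm M d' L u \<longrightarrow> sm K d L (push g u)" if d: "d > 0" for d
  proof -
    obtain d' where "d' > 0" "\<And>i u v. i \<le> (0::nat) \<Longrightarrow> u \<in> M \<Longrightarrow> v \<in> M \<Longrightarrow> dist u v \<le> d' \<Longrightarrow> dist (g u) (g v) \<le> d"
      using uniform_modulus[of 0 M "\<lambda>_. g" d] g(1) d by blast
    then have "\<forall>L u. sm M d' L u \<longrightarrow> sm K d L (push g u)"
      using g(2) by (auto intro!: sm_push)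
    then show ?thesis using \<open>d' > 0\<close> by blast
  qed
  have fg: "push f (push g u) = u" if "sm M d L u" for d L u
    unfolding push_push using that g(2) by (auto intro!: push_id_on)
  have "bounds_in M M L" if L: "L \<noteq> r" for L
    unfolding bounds_in_def
  proof (intro allI impI)
    fix d :: real assume "d > 0"
    obtain d' where d': "d' > 0" "\<And>L u. sm K d' L u \<Longrightarrow> sm M d L (push f u)"
      using fm[OF \<open>d > 0\<close>] by blast
    obtain e where e: "e > 0" "\<And>c. sm K e L c \<Longrightarrow> bd c = 0 \<Longrightarrow> \<exists>u. sm K d' (Suc L) u \<and> bd u = c"
      using assms(1) d'(1) L unfolding sphere_like_def bounds_in_def by metis
    obtain e' where e': "e' > 0" "\<And>L u. sm M e' L u \<Longrightarrow> sm K e L (push g u)"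
      using gm[OF e(1)] by blast
    have "\<exists>u. sm M d (Suc L) u \<and> bd u = c" if c: "sm M e' L c" "bd c = 0" for c
    proof -
      obtain u where u: "sm K d' (Suc L) u" "bd u = push g c"
        using e(2)[OF e'(2)[OF c(1)]] c(2) by (auto simp: bd_push)
      then show ?thesis
        using d'(2)[OF u(1)] fg[OF c(1)] by (metis bd_push)
    qed
    then show "\<exists>e>0. \<forall>c. sm M e L c \<longrightarrow> bd c = 0 \<longrightarrow> (\<exists>u. sm M d (Suc L) u \<and> bd u = c)"
      using e'(1) by blast
  qed
  moreover have "two_in M M r"
    unfolding two_in_def
  proof (intro allI impI)
    fix d :: real assume "d > 0"
    obtain d' where d': "d' > 0" "\<And>L u. sm K d' L u \<Longrightarrow> sm M d L (push f u)"
      using fm[OF \<open>d > 0\<close>] by blast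
    obtain e where e: "e > 0" "\<And>b c. sm K e r b \<Longrightarrow> sm K e r c \<Longrightarrow> bd b = 0 \<Longrightarrow> bd c = 0 \<Longrightarrow>
        \<exists>u. sm K d' (Suc r) u \<and> (bd u = b \<or> bd u = c \<or> bd u = b + c)"
      using assms(1) d'(1) unfolding sphere_like_def two_in_def by metis
    obtain e' where e': "e' > 0" "\<And>L u. sm M e' L u \<Longrightarrow> sm K e L (push g u)"
      using gm[OF e(1)] by blast
    have "\<exists>u. sm M d (Suc r) u \<and> (bd u = b \<or> bd u = c \<or> bd u = b + c)"
      if b: "sm M e' r b" "bd b = 0" and c: "sm M e' r c" "bd c = 0" for b c
    proof -
      obtain u where u: "sm K d' (Suc r) u"
        "bd u = push g b \<or> bd u = push g c \<or> bd u = push g (b + c)"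
        using e(2)[OF e'(2)[OF b(1)] e'(2)[OF c(1)]] b(2) c(2) by (auto simp: bd_push)
      then have "bd (push f u) = b \<or> bd (push f u) = c \<or> bd (push f u) = b + c"
        using fg[OF b(1)] fg[OF c(1)] fg[OF sm_add[OF b(1) c(1)]] by (metis bd_push)
      then show ?thesis
        using d'(2)[OF u(1)] by blast
    qed
    then show "\<exists>e>0. \<forall>b c. sm M e r b \<longrightarrow> sm M e r c \<longrightarrow> bd b = 0 \<longrightarrow> bd c = 0 \<longrightarrow>
       (\<exists>u. sm M d (Suc r) u \<and> (bd u = b \<or> bd u = c \<or> bd u = b + c))"
      using e'(1) by blast
  qed
  ultimately show ?thesis
    unfolding sphere_like_def by blast
qed

subsection \<open>Unit spheres of subspaces\<close>

definition usph :: "'v::euclidean_space set \<Rightarrow> 'v set" where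
  "usph U = {u \<in> U. norm u = 1}"

lemma compact_usph: "subspace U \<Longrightarrow> compact (usph U)"
proof -
  assume "subspace U"
  then have "compact (U \<inter> sphere 0 1)"
    by (intro closed_Int_compact closed_subspace compact_sphere)
  moreover have "usph U = U \<inter> sphere 0 1"
    by (auto simp: usph_def)
  ultimately show ?thesis by simp
qed

text \<open>The cap stays away from \<open>- e\<close>, so the normalized segments towards
  \<open>e\<close> contract it.\<close>

lemma bounds_in_cap:
  fixes U :: "'v::euclidean_space set"
  assumes "subspace U" "e \<in> usph U"
  shows "bounds_in {u \<in> usph U. u \<bullet> e \<ge> -1/2} (usph U) L"
proof (rule bounds_in_deform)
  let ?K = "{u \<in> usph U. u \<bullet> e \<ge> -1/2}"
  have e: "e \<in> U" "norm e = 1" using assms(2) by (auto simp: usph_def)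
  have nz: "(1 - t) *\<^sub>R u + t *\<^sub>R e \<noteq> 0" if "u \<in> ?K" for t u
  proof
    assume "(1 - t) *\<^sub>R u + t *\<^sub>R e = 0"
    then have "((1 - t) *\<^sub>R u + t *\<^sub>R e) \<bullet> ((1 - t) *\<^sub>R u + t *\<^sub>R e) = 0" by simp
    moreover have "u \<bullet> u = 1" "e \<bullet> e = 1"
      using that e by (auto simp: usph_def dot_square_norm)
    ultimately have eq: "(1 - t)\<^sup>2 + t\<^sup>2 + 2 * (t * (1 - t)) * (u \<bullet> e) = 0"
      by (simp add: inner_simps inner_commute power2_eq_square algebra_simps)
    have "\<bar>u \<bullet> e\<bar> \<le> 1"
      using Cauchy_Schwarz_ineq2[of u e] that e by (auto simp: usph_def)
    moreover have "u \<bullet> e \<ge> -1/2" using that by simp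
    moreover have "(1 - t)\<^sup>2 + t\<^sup>2 + 2 * (t * (1 - t)) * (-1/2) > 0"
    proof -
      have "(1 - t)\<^sup>2 + t\<^sup>2 + 2 * (t * (1 - t)) * (-1/2) = 3 * (t - 1/2)\<^sup>2 + 1/4"
        by (simp add: power2_eq_square algebra_simps)
      then show ?thesis by (simp add: add_nonneg_pos)
    qed
    moreover have "(1 - t)\<^sup>2 + t\<^sup>2 + 2 * (t * (1 - t)) * 1 > 0"
      by (simp add: power2_eq_square algebra_simps)
    ultimately show False
    proof -
      \<comment> \<open>Here \<open>t\<close> ranges over all reals, so \<open>t * (1 - t)\<close>
        may have either sign; this decides whether the lower or the upper bound of
        \<open>u \<bullet> e\<close> is the relevant one.\<close>
      have "2 * (t * (1 - t)) * (u \<bullet> e) \<ge> min (2 * (t * (1 - t)) * (-1/2)) (2 * (t * (1 - t)) * 1)"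
      proof (cases "t * (1 - t) \<ge> 0")
        case True
        then have "2 * (t * (1 - t)) * (-1/2) \<le> 2 * (t * (1 - t)) * (u \<bullet> e)"
          using \<open>u \<bullet> e \<ge> -1/2\<close> by (intro mult_left_mono) auto
        then show ?thesis by linarith
      next
        case False
        then have "2 * (t * (1 - t)) * 1 \<le> 2 * (t * (1 - t)) * (u \<bullet> e)"
          using \<open>\<bar>u \<bullet> e\<bar> \<le> 1\<close> by (intro mult_left_mono_neg) auto
        then show ?thesis by linarith
      qed
      then show False
        using eq \<open>(1 - t)\<^sup>2 + t\<^sup>2 + 2 * (t * (1 - t)) * (-1/2) > 0\<close>
          \<open>(1 - t)\<^sup>2 + t\<^sup>2 + 2 * (t * (1 - t)) * 1 > 0\<close> by linarith
    qed
  qed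
  show "deforms_into ?K (usph U) {e}"
  proof (rule deforms_into_homotopy[where h = "\<lambda>t u. sgn ((1 - t) *\<^sub>R u + t *\<^sub>R e)"])
    have "?K = usph U \<inter> {u. u \<bullet> e \<ge> -1/2}" by auto
    moreover have "closed {u. u \<bullet> e \<ge> -1/2}"
      by (intro closed_Collect_le continuous_intros)
    ultimately show "compact ?K"
      using compact_usph[OF assms(1)] by (simp add: compact_Int_closed)
    show "continuous_on ({0..1} \<times> ?K) (\<lambda>(t, z). sgn ((1 - t) *\<^sub>R z + t *\<^sub>R e))"
      unfolding case_prod_unfold using nz
      by (intro continuous_intros) (auto simp: mem_Times_iff)
    show "sgn ((1 - t) *\<^sub>R z + t *\<^sub>R e) \<in> usph U" if "z \<in> ?K" for t z
      using nz[OF that] that e assms(1)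
      by (auto simp: usph_def norm_sgn sgn_div_norm intro!: subspace_add subspace_scale)
  qed (auto simp: usph_def sgn_div_norm e)
  show "bounds_in {e} (usph U) L"
    by (rule bounds_in_point[OF assms(2)])
qed

lemma bounds_in_zero_length:
  assumes "p \<in> M"
  shows "bounds_in K M 0"
  unfolding bounds_in_def
proof (intro allI impI)
  fix d :: real assume "d > 0"
  have "\<exists>u. sm M d (Suc 0) u \<and> bd u = c" if c: "sm K 1 0 c" for c
  proof -
    have "Poly_Mapping.keys c \<subseteq> {[]}"
      using c by (auto simp: sm_def)
    from bit_chain_on_single[OF this] consider "c = 0" | "c = sg []" by argo
    then show ?thesis
    proof cases
      case 2
      then show ?thesis
        using assms \<open>d > 0\<close> by (intro exI[of _ "sg [p]"]) (auto simp: sm_sg)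
    qed (auto intro: exI[of _ 0])
  qed
  then show "\<exists>e>0. \<forall>c. sm K e 0 c \<longrightarrow> bd c = 0 \<longrightarrow> (\<exists>u. sm M d (Suc 0) u \<and> bd u = c)"
    using zero_less_one by blast
qed

lemma sphere_like_empty: "sphere_like {} M 0"
  unfolding sphere_like_def
proof (intro conjI allI impI)
  fix L :: nat assume "L \<noteq> 0"
  then have "c = 0" if "sm {} e L c" for e and c :: "'a chain2"
    using that by (auto simp: sm_def simp flip: keys_eq_empty)
  then show "bounds_in {} M L"
    unfolding bounds_in_def by (metis bd_zero sm_zero zero_less_one)
next
  have *: "c = 0 \<or> c = sg []" if "sm {} e 0 c" for e and c :: "'a chain2"
    using that by (intro bit_chain_on_single) (auto simp: sm_def)
  have "\<exists>u. sm M d (Suc 0) u \<and> (bd u = b \<or> bd u = c \<or> bd u = b + c)"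
    if "sm {} 1 0 b" "sm {} 1 0 c" for b c :: "'a chain2" and d
    using *[OF that(1)] *[OF that(2)] by (intro exI[of _ 0]) auto
  then show "two_in {} M 0"
    unfolding two_in_def using zero_less_one by blast
qed

text \<open>Mayer--Vietoris for the two caps: a cycle of the sphere is cut along the equator, and the
  resulting cycle near the equator is projected onto it.\<close>

lemma sphere_cut:
  fixes U :: "'v::euclidean_space set"
  assumes U: "subspace U" and e: "e \<in> usph U" and U': "U' = {u \<in> U. u \<bullet> e = 0}" and "d > 0"
  obtains d1 where "d1 > 0" "\<And>d2. d2 > 0 \<Longrightarrow> \<exists>e0>0. \<exists>G. (\<forall>b c. G (b + c) = G b + G c) \<and>
    (\<forall>c. sm (usph U) e0 (Suc l) c \<longrightarrow> bd c = 0 \<longrightarrow> sm (usph U') d2 l (G c) \<and> bd (G c) = 0 \<and>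
      (\<forall>u. sm (usph U') d1 (Suc l) u \<longrightarrow> bd u = G c \<longrightarrow> (\<exists>a. sm (usph U) d (Suc (Suc l)) a \<and> bd a = c)))"
proof -
  let ?S = "usph U"
  have e': "e \<in> U" "norm e = 1" "e \<bullet> e = 1" using e by (auto simp: usph_def dot_square_norm)
  let ?P = "{u \<in> ?S. u \<bullet> e \<ge> -1/2}" and ?M = "{u \<in> ?S. u \<bullet> e \<le> 1/2}"
  have "-e \<in> ?S" using e' U by (auto simp: usph_def subspace_neg)
  then have "bounds_in {u \<in> ?S. u \<bullet> (-e) \<ge> -1/2} ?S (Suc l)" by (rule bounds_in_cap[OF U])
  then have bm: "bounds_in ?M ?S (Suc l)" by simp
  obtain ep where ep: "ep > 0" "\<And>c. sm ?P ep (Suc l) c \<Longrightarrow> bd c = 0 \<Longrightarrow> \<exists>u. sm ?S d (Suc (Suc l)) u \<and> bd u = c"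
    using bounds_in_cap[OF U e, of "Suc l"] \<open>d > 0\<close> unfolding bounds_in_def by metis
  obtain em where em: "em > 0" "\<And>c. sm ?M em (Suc l) c \<Longrightarrow> bd c = 0 \<Longrightarrow> \<exists>u. sm ?S d (Suc (Suc l)) u \<and> bd u = c"
    using bm \<open>d > 0\<close> unfolding bounds_in_def by metis
  \<comment> \<open>\<open>d1\<close> depends on \<open>d\<close> alone. The scale \<open>d2\<close>
    at the equator can then be chosen from \<open>d1\<close>, and \<open>e0\<close> from
    \<open>d2\<close>, which is the order that induction on the dimension requires.\<close>
  define d1 where "d1 = min ep em"
  have d1: "d1 > 0" "d1 \<le> ep" "d1 \<le> em" using ep em by (auto simp: d1_def)
  define \<pi> where "\<pi> = (\<lambda>u. sgn (u - (u \<bullet> e) *\<^sub>R e))"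
  define E where "E = {u \<in> ?S. \<bar>u \<bullet> e\<bar> \<le> 1/2}"
  have nsq: "(norm (u - (u \<bullet> e) *\<^sub>R e))\<^sup>2 = 1 - (u \<bullet> e)\<^sup>2" if "u \<in> ?S" for u
  proof -
    have "u \<bullet> u = 1" using that by (auto simp: usph_def dot_square_norm)
    then show ?thesis
      unfolding power2_norm_eq_inner using e'(3)
      by (simp add: inner_simps inner_commute power2_eq_square algebra_simps)
  qed
  have n1: "norm (u - (u \<bullet> e) *\<^sub>R e) > 0" if "u \<in> E" for u
  proof -
    have "(u \<bullet> e)\<^sup>2 \<le> (1/2)\<^sup>2"
      using that by (intro abs_le_square_iff[THEN iffD1]) (auto simp: E_def)
    then have "(norm (u - (u \<bullet> e) *\<^sub>R e))\<^sup>2 > 0"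
      using nsq[of u] that by (simp add: E_def power2_eq_square)
    then show ?thesis by simp
  qed
  have piU: "\<pi> u \<in> usph U'" if "u \<in> E" for u
    using that n1[OF that] e' U unfolding U' \<pi>_def
    by (auto simp: E_def usph_def norm_sgn sgn_div_norm inner_simps subspace_diff subspace_scale)
  have US: "usph U' \<subseteq> ?S" by (auto simp: usph_def U')
  \<comment> \<open>Removing the component along \<open>e\<close> and normalizing each move the
    point by at most \<open>\<bar>u \<bullet> e\<bar>\<close>.\<close>
  have pinear: "dist u (\<pi> u) \<le> 2 * \<bar>u \<bullet> e\<bar>" if "u \<in> E" for u
  proof -
    let ?y = "u - (u \<bullet> e) *\<^sub>R e"
    have "norm ?y \<le> 1" and ge: "norm ?y \<ge> 1 - \<bar>u \<bullet> e\<bar>"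
    proof -
      have "(norm ?y)\<^sup>2 \<le> 1\<^sup>2" using nsq[of u] that by (simp add: E_def)
      then show "norm ?y \<le> 1" by (rule power2_le_imp_le) simp
      have "norm u \<le> norm ?y + norm ((u \<bullet> e) *\<^sub>R e)"
        by (metis diff_add_cancel norm_triangle_ineq)
      then show "norm ?y \<ge> 1 - \<bar>u \<bullet> e\<bar>" using that e' by (simp add: E_def usph_def)
    qed
    have "?y - \<pi> u = (1 - 1 / norm ?y) *\<^sub>R ?y"
      by (simp add: \<pi>_def sgn_div_norm scaleR_diff_left divide_inverse)
    then have "norm (?y - \<pi> u) = \<bar>norm ?y - 1\<bar>"
      using n1[OF that] by (simp add: left_diff_distrib flip: abs_mult_pos) (simp add: abs_mult_pos left_diff_distrib)
    then have "norm (?y - \<pi> u) \<le> \<bar>u \<bullet> e\<bar>" using \<open>norm ?y \<le> 1\<close> ge by linarith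
    moreover have "u - \<pi> u = (?y - \<pi> u) + (u \<bullet> e) *\<^sub>R e" by simp
    ultimately show ?thesis
      unfolding dist_norm using norm_triangle_ineq[of "?y - \<pi> u" "(u \<bullet> e) *\<^sub>R e"] e' by simp
  qed
  have ucpi: "uniformly_continuous_on E \<pi>"
  proof (rule compact_uniformly_continuous)
    have "E = ?S \<inter> {u. \<bar>u \<bullet> e\<bar> \<le> 1/2}" by (auto simp: E_def)
    moreover have "closed {u. \<bar>u \<bullet> e\<bar> \<le> 1/2}" by (intro closed_Collect_le continuous_intros)
    ultimately show "compact E" using compact_usph[OF U] by (simp add: compact_Int_closed)
    show "continuous_on E \<pi>"
      unfolding \<pi>_def using n1 by (intro continuous_intros) force
  qed
  have "\<exists>e0>0. \<exists>G. (\<forall>b c. G (b + c) = G b + G c) \<and>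
    (\<forall>c. sm ?S e0 (Suc l) c \<longrightarrow> bd c = 0 \<longrightarrow> sm (usph U') d2 l (G c) \<and> bd (G c) = 0 \<and>
      (\<forall>u. sm (usph U') d1 (Suc l) u \<longrightarrow> bd u = G c \<longrightarrow> (\<exists>a. sm ?S d (Suc (Suc l)) a \<and> bd a = c)))"
    if "d2 > 0" for d2
  proof -
    have pos: "min d2 d1 > 0" using \<open>d2 > 0\<close> d1 by simp
    obtain m where m: "m > 0" "\<And>i u v. i \<le> (0::nat) \<Longrightarrow> u \<in> E \<Longrightarrow> v \<in> E \<Longrightarrow> dist u v \<le> m \<Longrightarrow> dist (\<pi> u) (\<pi> v) \<le> min d2 d1"
      using uniform_modulus[of 0 E "\<lambda>_. \<pi>", OF ucpi pos] by blast
    \<comment> \<open>\<open>m\<close> controls \<open>\<pi>\<close>; the third of \<open>d1\<close>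
      pays for \<open>dist u v + dist v (\<pi> v) \<le> e0 + 2 * e0\<close> in the prism;
      \<open>1/2\<close> keeps the cut inside the band \<open>E\<close>.\<close>
    define e0 where "e0 = Min {m, d1 / 3, 1/2}"
    have e0: "e0 > 0" "e0 \<le> m" "3 * e0 \<le> d1" "e0 \<le> 1/2"
      using m d1 by (auto simp: e0_def)
    \<comment> \<open>\<open>Q\<close> selects the simplices that reach above the equator.
      \<open>G\<close> is the connecting map of Mayer--Vietoris followed by the projection to the
      equator, and it is additive because the selection is linear.\<close>
    define Q where "Q = (\<lambda>xs. \<exists>v\<in>set xs. v \<bullet> e > 0)"
    define G where "G = (\<lambda>c. push \<pi> (bd (filt Q c)))"
    have "sm (usph U') d2 l (G c) \<and> bd (G c) = 0 \<and>
      (\<forall>u. sm (usph U') d1 (Suc l) u \<longrightarrow> bd u = G c \<longrightarrow> (\<exists>a. sm ?S d (Suc (Suc l)) a \<and> bd a = c))"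
      if c: "sm ?S e0 (Suc l) c" "bd c = 0" for c
    proof -
      define cp where "cp = filt Q c"
      define cm where "cm = filt (\<lambda>x. \<not> Q x) c"
      have split: "cp + cm = c" unfolding cp_def cm_def by (rule filt_split)
      have "bd cp + bd cm = 0" using split c(2) by (metis bd_add)
      then have bdeq: "bd cm = bd cp" by (metis eq_of_add_eq_zero)
      have hd: "v \<bullet> e - dist u v \<le> u \<bullet> e" for u v
        using norm_cauchy_schwarz[of "v - u" e] e' by (simp add: dist_norm inner_diff_left norm_minus_commute)
      have kp: "length xs = Suc l \<and> set xs \<subseteq> {u \<in> ?S. u \<bullet> e \<ge> -e0} \<and> (\<forall>u\<in>set xs. \<forall>v\<in>set xs. dist u v \<le> e0)"
        if "xs \<in> Poly_Mapping.keys cp" for xs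
      proof -
        have "xs \<in> Poly_Mapping.keys c" "Q xs" using that keys_filt[of Q c] by (auto simp: cp_def)
        then show ?thesis
          using c(1) hd unfolding sm_def Q_def by (smt (verit, best) mem_Collect_eq subset_eq)
      qed
      have km: "length xs = Suc l \<and> set xs \<subseteq> {u \<in> ?S. u \<bullet> e \<le> 0} \<and> (\<forall>u\<in>set xs. \<forall>v\<in>set xs. dist u v \<le> e0)"
        if "xs \<in> Poly_Mapping.keys cm" for xs
      proof -
        have "xs \<in> Poly_Mapping.keys c" "\<not> Q xs" using that keys_filt[of "\<lambda>x. \<not> Q x" c] by (auto simp: cm_def)
        then show ?thesis
          using c(1) unfolding sm_def Q_def by (auto simp: subset_iff not_less)
      qed
      have smp: "sm {u \<in> ?S. u \<bullet> e \<ge> -e0} e0 (Suc l) cp" and smm: "sm {u \<in> ?S. u \<bullet> e \<le> 0} e0 (Suc l) cm"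
        unfolding sm_def using kp km by blast+
      define w where "w = bd cp"
      let ?W = "{u \<in> ?S. - e0 \<le> u \<bullet> e \<and> u \<bullet> e \<le> 0}"
      have WE: "?W \<subseteq> E" using e0 by (auto simp: E_def)
      \<comment> \<open>As the boundary of \<open>cp\<close> the chain \<open>w\<close> lies above
        height \<open>- e0\<close>, and as the boundary of \<open>cm\<close> it lies below height
        \<open>0\<close>.\<close>
      have smw: "sm ?W e0 l w"
        using sm_bd[OF smp] sm_bd[OF smm] unfolding bdeq w_def[symmetric] sm_def by blast
      have smG: "sm (usph U') (min d2 d1) l (push \<pi> w)"
      proof (rule sm_push[OF smw])
        fix u v assume "u \<in> ?W" "v \<in> ?W" "dist u v \<le> e0"
        then show "dist (\<pi> u) (\<pi> v) \<le> min d2 d1"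
          using m(2)[of 0 u v] WE e0(2) by (meson order_trans subsetD zero_le)
      qed (use WE piU in blast)
      define pw where "pw = prism (\<lambda>u. u) \<pi> w"
      have smpw: "sm {u \<in> ?S. \<bar>u \<bullet> e\<bar> \<le> 1/2} d1 (Suc l) pw"
        unfolding pw_def
      proof (rule sm_prism[OF smw])
        fix u v assume uv: "u \<in> ?W" "v \<in> ?W" "dist u v \<le> e0"
        have "dist (\<pi> u) (\<pi> v) \<le> min d2 d1"
          using m(2)[of 0 u v] uv WE e0(2) by (meson order_trans subsetD zero_le)
        then have "dist (\<pi> u) (\<pi> v) \<le> d1" by simp
        moreover have "dist u (\<pi> v) \<le> d1"
        proof -
          have "dist u (\<pi> v) \<le> dist u v + dist v (\<pi> v)" by (rule dist_triangle)
          moreover have "dist v (\<pi> v) \<le> 2 * \<bar>v \<bullet> e\<bar>" using pinear uv(2) WE by blast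
          ultimately show ?thesis using uv e0 by auto
        qed
        ultimately show "dist u v \<le> d1 \<and> dist (\<pi> u) (\<pi> v) \<le> d1 \<and> dist u (\<pi> v) \<le> d1"
          using uv e0 by auto
      next
        fix u assume "u \<in> ?W"
        then show "u \<in> {u \<in> ?S. \<bar>u \<bullet> e\<bar> \<le> 1/2}" using e0 by auto
        have "\<pi> u \<in> usph U'" using \<open>u \<in> ?W\<close> WE piU by blast
        then show "\<pi> u \<in> {u \<in> ?S. \<bar>u \<bullet> e\<bar> \<le> 1/2}" by (auto simp: usph_def U')
      qed
      have bdpw: "bd pw = w + push \<pi> w"
        unfolding pw_def bd_prism using push_id_on[OF smw, of "\<lambda>u. u"] by (simp add: w_def)
      have "\<exists>a. sm ?S d (Suc (Suc l)) a \<and> bd a = c"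
        if u: "sm (usph U') d1 (Suc l) u" "bd u = push \<pi> w" for u
      proof -
        have uE: "sm {u \<in> ?S. \<bar>u \<bullet> e\<bar> \<le> 1/2} d1 (Suc l) u"
          using u(1) by (rule sm_mono) (auto simp: usph_def U')
        \<comment> \<open>The same chain \<open>pw + u\<close> closes \<open>cp\<close> to a cycle
          in one cap and \<open>cm\<close> to a cycle in the other; it cancels when the two fillings
          are added.\<close>
        have "sm ?P d1 (Suc l) (cp + pw + u)"
        proof (intro sm_add)
          show "sm ?P d1 (Suc l) cp" using smp by (rule sm_mono) (use e0 in auto)
          show "sm ?P d1 (Suc l) pw" using smpw by (rule sm_mono) auto
          show "sm ?P d1 (Suc l) u" using uE by (rule sm_mono) auto
        qed
        then have "sm ?P ep (Suc l) (cp + pw + u)" using d1(2) by (rule sm_smaller)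
        moreover have "bd (cp + pw + u) = 0" by (simp add: bdpw u(2) ac_simps flip: w_def)
        ultimately obtain a where a: "sm ?S d (Suc (Suc l)) a" "bd a = cp + pw + u"
          using ep(2) by blast
        have "sm ?M d1 (Suc l) (cm + pw + u)"
        proof (intro sm_add)
          show "sm ?M d1 (Suc l) cm" using smm by (rule sm_mono) (use e0 in auto)
          show "sm ?M d1 (Suc l) pw" using smpw by (rule sm_mono) auto
          show "sm ?M d1 (Suc l) u" using uE by (rule sm_mono) auto
        qed
        then have "sm ?M em (Suc l) (cm + pw + u)" using d1(3) by (rule sm_smaller)
        moreover have "bd (cm + pw + u) = 0" by (simp add: bdeq bdpw u(2) ac_simps flip: w_def)
        ultimately obtain b where b: "sm ?S d (Suc (Suc l)) b" "bd b = cm + pw + u"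
          using em(2) by blast
        have "bd (a + b) = c"
          using split by (simp add: a(2) b(2) ac_simps)
        then show ?thesis using sm_add[OF a(1) b(1)] by blast
      qed
      moreover have "G c = push \<pi> w" by (simp add: G_def w_def cp_def)
      moreover have "bd (push \<pi> w) = 0" by (simp add: bd_push w_def)
      ultimately show ?thesis
        using sm_smaller[OF smG] by auto
    qed
    moreover have "\<forall>b c. G (b + c) = G b + G c" by (simp add: G_def filt_add)
    ultimately show ?thesis using e0(1) by blast
  qed
  then show ?thesis by (rule that[OF d1(1)])
qed

text \<open>Induction on the dimension: cutting along the equator lowers both the dimension of
  \<open>U\<close> and the number of vertices by one. The start is the empty sphere, whose reduced
  homology is generated by the empty tuple.\<close>

lemma sphere_like_usph:
  fixes U :: "'v::euclidean_space set"
  assumes "subspace U"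
  shows "sphere_like (usph U) (usph U) (dim U)"
  using assms
proof (induction "dim U" arbitrary: U)
  case 0
  then have "usph U = {}" by (auto simp: usph_def subspace_0)
  then show ?case using sphere_like_empty 0 by metis
next
  case (Suc m)
  have "U \<noteq> {0}" using Suc.hyps(2) by auto
  then obtain y where y: "y \<in> U" "y \<noteq> 0" using subspace_0[OF Suc.prems] by blast
  define e where "e = sgn y"
  have e: "e \<in> usph U" using y Suc.prems by (auto simp: e_def usph_def norm_sgn sgn_div_norm subspace_scale)
  define U' where "U' = {u \<in> U. u \<bullet> e = 0}"
  have U': "subspace U'"
    using Suc.prems by (auto simp: U'_def subspace_def inner_simps)
  have "dim {y \<in> U. \<forall>x \<in> span {e}. orthogonal x y} + dim (span {e}) = dim U"
    using e Suc.prems by (intro dim_subspace_orthogonal_to_vectors) (auto simp: usph_def span_minimal)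
  moreover have "{y \<in> U. \<forall>x \<in> span {e}. orthogonal x y} = U'"
    by (auto simp: U'_def orthogonal_def span_singleton inner_commute)
  moreover have "dim (span {e}) = 1" using e by (auto simp: usph_def dim_singleton)
  ultimately have dimU': "m = dim U'" using Suc.hyps(2) by simp
  from Suc.hyps(1)[OF this U'] have IH: "sphere_like (usph U') (usph U') m" using dimU' by simp
  have "bounds_in (usph U) (usph U) L" if L: "L \<noteq> Suc m" for L
  proof (cases L)
    case 0
    then show ?thesis using bounds_in_zero_length[OF e] by simp
  next
    case (Suc l)
    then have lm: "l \<noteq> m" using L by simp
    show ?thesis
      unfolding bounds_in_def Suc
    proof (intro allI impI)
      fix d :: real assume "d > 0"
      obtain d1 where d1: "d1 > 0" "\<And>d2. d2 > 0 \<Longrightarrow> \<exists>e0>0. \<exists>G. (\<forall>b c. G (b + c) = G b + G c) \<and>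
         (\<forall>c. sm (usph U) e0 (Suc l) c \<longrightarrow> bd c = 0 \<longrightarrow> sm (usph U') d2 l (G c) \<and> bd (G c) = 0 \<and>
         (\<forall>u. sm (usph U') d1 (Suc l) u \<longrightarrow> bd u = G c \<longrightarrow> (\<exists>a. sm (usph U) d (Suc (Suc l)) a \<and> bd a = c)))"
        using sphere_cut[OF Suc.prems e U'_def \<open>d > 0\<close>, where l = l] by blast
      obtain d2 where d2: "d2 > 0" "\<And>c. sm (usph U') d2 l c \<Longrightarrow> bd c = 0 \<Longrightarrow>
          \<exists>u. sm (usph U') d1 (Suc l) u \<and> bd u = c"
        using IH lm d1(1) unfolding sphere_like_def bounds_in_def by metis
      from d1(2)[OF d2(1)] d2(2)
      show "\<exists>e>0. \<forall>c. sm (usph U) e (Suc l) c \<longrightarrow> bd c = 0 \<longrightarrow> (\<exists>u. sm (usph U) d (Suc (Suc l)) u \<and> bd u = c)"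
        by meson
    qed
  qed
  moreover have "two_in (usph U) (usph U) (Suc m)"
    unfolding two_in_def
  proof (intro allI impI)
    fix d :: real assume "d > 0"
    obtain d1 where d1: "d1 > 0" "\<And>d2. d2 > 0 \<Longrightarrow> \<exists>e0>0. \<exists>G. (\<forall>b c. G (b + c) = G b + G c) \<and>
       (\<forall>c. sm (usph U) e0 (Suc m) c \<longrightarrow> bd c = 0 \<longrightarrow> sm (usph U') d2 m (G c) \<and> bd (G c) = 0 \<and>
       (\<forall>u. sm (usph U') d1 (Suc m) u \<longrightarrow> bd u = G c \<longrightarrow> (\<exists>a. sm (usph U) d (Suc (Suc m)) a \<and> bd a = c)))"
      using sphere_cut[OF Suc.prems e U'_def \<open>d > 0\<close>, where l = m] by blast
    obtain d2 where d2: "d2 > 0" "\<And>b c. sm (usph U') d2 m b \<Longrightarrow> sm (usph U') d2 m c \<Longrightarrow> bd b = 0 \<Longrightarrow> bd c = 0 \<Longrightarrow>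
        \<exists>u. sm (usph U') d1 (Suc m) u \<and> (bd u = b \<or> bd u = c \<or> bd u = b + c)"
      using IH d1(1) unfolding sphere_like_def two_in_def by metis
    obtain e0 G where e0: "e0 > 0" and G: "\<And>b c. G (b + c) = G b + G c"
      "\<And>c. sm (usph U) e0 (Suc m) c \<Longrightarrow> bd c = 0 \<Longrightarrow> sm (usph U') d2 m (G c) \<and> bd (G c) = 0 \<and>
       (\<forall>u. sm (usph U') d1 (Suc m) u \<longrightarrow> bd u = G c \<longrightarrow> (\<exists>a. sm (usph U) d (Suc (Suc m)) a \<and> bd a = c))"
      using d1(2)[OF d2(1)] by metis
    have "\<exists>u. sm (usph U) d (Suc (Suc m)) u \<and> (bd u = b \<or> bd u = c \<or> bd u = b + c)"
      if b: "sm (usph U) e0 (Suc m) b" "bd b = 0" and c: "sm (usph U) e0 (Suc m) c" "bd c = 0" for b c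
    proof -
      have bc: "sm (usph U) e0 (Suc m) (b + c)" "bd (b + c) = 0" using b c by (auto intro: sm_add)
      \<comment> \<open>Since \<open>G b + G c = G (b + c)\<close>, each of the three alternatives
        at the equator lifts to the same alternative for \<open>b\<close>, \<open>c\<close> and
        \<open>b + c\<close>.\<close>
      obtain u where u: "sm (usph U') d1 (Suc m) u" "bd u = G b \<or> bd u = G c \<or> bd u = G (b + c)"
        using d2(2)[of "G b" "G c"] G(2)[OF b] G(2)[OF c] by (auto simp: G(1))
      from u(2) show ?thesis
        using G(2)[OF b] G(2)[OF c] G(2)[OF bc] u(1) by blast
    qed
    then show "\<exists>e>0. \<forall>b c. sm (usph U) e (Suc m) b \<longrightarrow> sm (usph U) e (Suc m) c \<longrightarrow> bd b = 0 \<longrightarrow> bd c = 0 \<longrightarrow>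
       (\<exists>u. sm (usph U) d (Suc (Suc m)) u \<and> (bd u = b \<or> bd u = c \<or> bd u = b + c))"
      using e0 by blast
  qed
  ultimately show ?case
    unfolding sphere_like_def using Suc.hyps(2) by metis
qed

subsection \<open>The alternating sign functional of Ky Fan\<close>

fun alt :: "bool \<Rightarrow> bool list \<Rightarrow> bool" where
  "alt b [] = True"
| "alt b (x # xs) = (x = b \<and> alt (\<not> b) xs)"

definition av :: "bool \<Rightarrow> bool list \<Rightarrow> bit" where
  "av b bs = of_bool (alt b bs)"

lemma ext_av_cn: "ext (av b) (cn x c) = (if x = b then ext (av (\<not> b)) c else 0)"
proof (rule additive_eq[where F = "\<lambda>c. ext (av b) (cn x c)" and G = "\<lambda>c. if x = b then ext (av (\<not> b)) c else 0"])
  show "ext (av b) (cn x (sg xs)) = (if x = b then ext (av (\<not> b)) (sg xs) else 0)" for xs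
    by (simp add: av_def)
qed simp_all

text \<open>In an alternating word only the deletion of an end leaves an alternating word, and
  exactly one of these results starts with \<open>b\<close>. In any other word such deletions come
  in pairs, one for each of two equal neighbours.\<close>

lemma ext_av_bdl: "ext (av b) (bdl bs) = av True bs + av False bs"
proof (induction bs arbitrary: b)
  case (Cons x xs)
  have "av True (x # xs) + av False (x # xs) = av (\<not> x) xs"
    by (cases x) (simp_all add: av_def)
  then show ?case
    using Cons.IH
    by (cases b; cases x; cases "av True xs"; cases "av False xs") (simp_all add: ext_av_cn)
qed (simp add: av_def)

lemma ext_push: "ext f (push g c) = ext (\<lambda>xs. f (map g xs)) c"
  by (rule additive_eq) simp_all

lemma ext_cn: "ext f (cn x c) = ext (\<lambda>ys. f (x # ys)) c"
  by (rule additive_eq) simp_all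

lemma ext_bd: "ext f (bd c) = ext (\<lambda>xs. ext f (bdl xs)) c"
  by (rule additive_eq) simp_all

text \<open>For a function of the multiset of vertices the sum over all faces ignores their order,
  so labels may be sorted before they are counted.\<close>

lemma ext_mset_bdl:
  fixes g :: "'a multiset \<Rightarrow> 'm::char_two"
  shows "ext (\<lambda>ys. g (mset ys)) (bdl xs) = (\<Sum>y\<in>#mset xs. g (mset xs - {#y#}))"
proof (induction xs arbitrary: g)
  case (Cons x xs)
  have "ext (\<lambda>ys. g (mset ys)) (bdl (x # xs)) = g (mset xs) + (\<Sum>y\<in>#mset xs. g (add_mset x (mset xs - {#y#})))"
    using Cons.IH[of "\<lambda>M. g (add_mset x M)"] by (simp add: ext_cn)
  also have "(\<Sum>y\<in>#mset xs. g (add_mset x (mset xs - {#y#}))) = (\<Sum>y\<in>#mset xs. g (mset (x # xs) - {#y#}))"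
    by (intro arg_cong[of _ _ sum_mset] image_mset_cong) (simp add: insert_DiffM2)
  finally show ?case by simp
qed simp

definition fanv :: "bool \<Rightarrow> nat list \<Rightarrow> bit" where
  "fanv b ls = av b (map odd (sort ls))"

lemma sorted_bdl: "ys \<in> Poly_Mapping.keys (bdl xs) \<Longrightarrow> sorted xs \<Longrightarrow> sorted ys"
proof (induction xs arbitrary: ys)
  case (Cons x xs)
  from Cons.prems(1) consider "ys = xs" | zs where "zs \<in> Poly_Mapping.keys (bdl xs)" "ys = x # zs"
    using keys_add[of "sg xs" "cn x (bdl xs)"] keys_cn[of x "bdl xs"] by auto
  then show ?case
    using Cons.prems(2) Cons.IH keys_bdl[of _ xs] by cases auto
qed simp

text \<open>Ky Fan's identity: the number of alternating facets of a simplex is odd iff the simplex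
  itself is alternating.\<close>

lemma ext_fanv_bdl: "ext (fanv b) (bdl ls) = fanv True ls + fanv False ls"
proof -
  define g where "g = (\<lambda>M :: nat multiset. av b (map odd (sorted_list_of_multiset M)))"
  have g: "fanv b = (\<lambda>ys. g (mset ys))"
    by (simp add: g_def fanv_def fun_eq_iff)
  have "ext (fanv b) (bdl ls) = ext (fanv b) (bdl (sort ls))"
    unfolding g ext_mset_bdl by simp
  also have "\<dots> = ext (\<lambda>ys. av b (map odd ys)) (bdl (sort ls))"
    by (rule ext_cong) (simp add: fanv_def sorted_bdl sorted_sort_id)
  also have "\<dots> = ext (av b) (bdl (map odd (sort ls)))"
    by (simp add: ext_push bdl_map)
  also have "\<dots> = fanv True ls + fanv False ls"
    by (simp add: ext_av_bdl fanv_def)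
  finally show ?thesis .
qed

text \<open>A label \<open>2 i\<close> or \<open>2 i + 1\<close> records a coordinate \<open>i\<close> of large absolute value and its sign.\<close>

definition flip :: "nat \<Rightarrow> nat" where
  "flip n = (if odd n then n - 1 else n + 1)"

text \<open>Excludes complementary edges in the sense of Tucker's lemma.\<close>

definition noncomp :: "nat list \<Rightarrow> bool" where
  "noncomp ls \<longleftrightarrow> (\<forall>a\<in>set ls. \<forall>b\<in>set ls. a \<noteq> flip b)"

lemma flip_mono: "a \<le> b \<Longrightarrow> a \<noteq> flip b \<Longrightarrow> flip a \<le> flip b"
  unfolding flip_def by (auto split: if_splits elim!: oddE evenE)

lemma odd_flip [simp]: "odd (flip n) \<longleftrightarrow> even n"
  by (auto simp: flip_def)

text \<open>Flipping exchanges \<open>2 i\<close> and \<open>2 i + 1\<close>. As these never occur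
  together, the sorted order is kept while all signs are reversed.\<close>

lemma fanv_flip:
  assumes "noncomp ls"
  shows "fanv True (map flip ls) = fanv False ls"
proof -
  have "sorted (map flip (sort ls))"
    unfolding sorted_wrt_map
  proof (rule sorted_wrt_mono_rel[OF _ sorted_sort])
    fix a b assume "a \<in> set (sort ls)" "b \<in> set (sort ls)" "a \<le> b"
    then show "flip a \<le> flip b"
      using assms flip_mono[of a b] unfolding noncomp_def set_sort by blast
  qed
  then have "sort (map flip ls) = map flip (sort ls)"
    using properties_for_sort[of "map flip (sort ls)" "map flip ls"] by simp
  moreover have "alt b (map (\<lambda>n. odd (flip n)) xs) = alt (\<not> b) (map odd xs)" for b xs
    by (induction xs arbitrary: b) auto
  ultimately show ?thesis
    by (simp add: fanv_def av_def comp_def)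
qed

text \<open>Sorted neighbours of different parity that belong to the same coordinate would be
  complementary. Hence an alternating simplex uses each coordinate at most once.\<close>

lemma alt_distinct:
  "alt b (map odd xs) \<Longrightarrow> sorted xs \<Longrightarrow> noncomp xs \<Longrightarrow> distinct (map (\<lambda>n. n div 2) xs)"
proof (induction xs arbitrary: b)
  case (Cons a xs)
  have IH: "distinct (map (\<lambda>n. n div 2) xs)"
    using Cons.IH[of "\<not> b"] Cons.prems by (auto simp: noncomp_def)
  have "a div 2 < y div 2" if y: "y \<in> set xs" for y
  proof -
    obtain c zs where xs: "xs = c # zs" using y by (cases xs) auto
    have "odd a \<noteq> odd c" "a \<le> c" "c \<noteq> flip a" "c \<le> y"
      using Cons.prems y unfolding xs noncomp_def by auto
    moreover have "even a \<Longrightarrow> c \<noteq> a + 1"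
      using \<open>c \<noteq> flip a\<close> by (auto simp: flip_def)
    ultimately show ?thesis by presburger
  qed
  then have "a div 2 \<notin> (\<lambda>n. n div 2) ` set xs"
    by fastforce
  then show ?case using IH by simp
qed simp

lemma fanv_long:
  assumes "noncomp ls" "\<forall>a\<in>set ls. a < 2 * M" "length ls > M"
  shows "fanv b ls = 0"
proof (rule ccontr)
  assume "fanv b ls \<noteq> 0"
  then have "alt b (map odd (sort ls))" by (simp add: fanv_def av_def)
  then have "distinct (map (\<lambda>n. n div 2) (sort ls))"
    using assms(1) by (intro alt_distinct) (auto simp: noncomp_def)
  then have "card (set (map (\<lambda>n. n div 2) (sort ls))) = length ls"
    using distinct_card by fastforce
  moreover have "set (map (\<lambda>n. n div 2) (sort ls)) \<subseteq> {..<M}"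
    using assms(2) by auto
  then have "card (set (map (\<lambda>n. n div 2) (sort ls))) \<le> M"
    using card_mono[of "{..<M}"] by fastforce
  ultimately show False using assms(3) by simp
qed

section \<open>Labelling a point by its first large coordinate\<close>

definition lab :: "real \<Rightarrow> (nat \<Rightarrow> real) \<Rightarrow> nat" where
  "lab c y = 2 * (LEAST i. c \<le> \<bar>y i\<bar>) + of_bool (y (LEAST i. c \<le> \<bar>y i\<bar>) > 0)"

lemma lab_less: "\<exists>i<M. c \<le> \<bar>y i\<bar> \<Longrightarrow> lab c y < 2 * M"
proof -
  assume "\<exists>i<M. c \<le> \<bar>y i\<bar>"
  then have "(LEAST i. c \<le> \<bar>y i\<bar>) < M" by (meson Least_le le_less_trans)
  then show ?thesis by (auto simp: lab_def)
qed

lemma lab_uminus: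
  assumes "\<exists>i. c \<le> \<bar>y i\<bar>" "c > 0"
  shows "lab c (\<lambda>i. - y i) = flip (lab c y)"
proof -
  define k where "k = (LEAST i. c \<le> \<bar>y i\<bar>)"
  have "c \<le> \<bar>y k\<bar>" unfolding k_def using assms(1) by (rule LeastI_ex)
  then have "y k > 0 \<or> - y k > 0" using assms(2) by auto
  then show ?thesis by (auto simp: lab_def flip_def simp flip: k_def)
qed

text \<open>Complementary labels mean that one coordinate has absolute value at least
  \<open>c\<close> at both points, with opposite signs, which is a jump of at least
  \<open>2 * c\<close>.\<close>

lemma lab_noncomp:
  assumes "\<exists>i<M. c \<le> \<bar>y i\<bar>" "\<exists>i<M. c \<le> \<bar>y' i\<bar>" "c > 0"
    and "\<And>i. i < M \<Longrightarrow> \<bar>y i - y' i\<bar> < 2 * c"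
  shows "lab c y \<noteq> flip (lab c y')"
proof
  let ?i = "LEAST i. c \<le> \<bar>y i\<bar>" and ?j = "LEAST i. c \<le> \<bar>y' i\<bar>"
  assume eq: "lab c y = flip (lab c y')"
  then have "lab c y div 2 = lab c y' div 2" "odd (lab c y) \<noteq> odd (lab c y')"
    by (auto simp: flip_def elim!: oddE)
  then have ij: "?i = ?j" and s: "(y ?i > 0) \<noteq> (y' ?j > 0)"
    by (auto simp: lab_def)
  have "?i < M" using assms(1) by (meson Least_le le_less_trans)
  have "c \<le> \<bar>y ?i\<bar>" by (rule LeastI_ex) (use assms(1) in blast)
  have "c \<le> \<bar>y' ?j\<bar>" by (rule LeastI_ex) (use assms(2) in blast)
  then show False
    using assms(4)[OF \<open>?i < M\<close>] \<open>c \<le> \<bar>y ?i\<bar>\<close> s \<open>c > 0\<close> unfolding ij by linarith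
qed

text \<open>A combinatorial substitute for the mod 2 degree of a labelling; fixing the first sign
  selects one of two antipodal alternating simplices.\<close>

definition fan :: "('a \<Rightarrow> nat) \<Rightarrow> 'a chain2 \<Rightarrow> bit" where
  "fan lb = ext (\<lambda>xs. fanv True (map lb xs))"

lemma fan_add [simp]: "fan lb (c + d) = fan lb c + fan lb d"
  and fan_zero [simp]: "fan lb 0 = 0"
  by (simp_all add: fan_def)

lemma fan_empty [simp]: "fan lb (sg []) = 1"
  by (simp add: fan_def fanv_def av_def)

lemma fan_push: "fan lb (push f c) = fan (\<lambda>z. lb (f z)) c"
  by (simp add: fan_def ext_push comp_def)

lemma fan_bd: "fan lb (bd c) = fan lb c + ext (\<lambda>xs. fanv False (map lb xs)) c"
proof -
  have "ext (\<lambda>xs. fanv True (map lb xs)) (bdl xs) = fanv True (map lb xs) + fanv False (map lb xs)" for xs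
    using ext_fanv_bdl[of True "map lb xs"] by (simp add: bdl_map ext_push)
  then show ?thesis
    by (simp only: fan_def ext_bd ext_fun_add)
qed

text \<open>The negative alternating simplices of \<open>c\<close> become the positive ones of its
  image under \<open>t\<close>. This identity lifts the count by one dimension along a
  resolution.\<close>

lemma fan_bd_equivariant:
  assumes "\<And>xs. xs \<in> Poly_Mapping.keys c \<Longrightarrow> noncomp (map lb xs)"
    and "\<And>xs z. xs \<in> Poly_Mapping.keys c \<Longrightarrow> z \<in> set xs \<Longrightarrow> lb (t z) = flip (lb z)"
  shows "fan lb (bd c) = fan lb (c + push t c)"
proof -
  have "fan lb (push t c) = ext (\<lambda>xs. fanv True (map (\<lambda>z. lb (t z)) xs)) c"
    by (simp add: fan_push) (simp add: fan_def)
  also have "\<dots> = ext (\<lambda>xs. fanv False (map lb xs)) c"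
  proof (rule ext_cong)
    fix xs assume xs: "xs \<in> Poly_Mapping.keys c"
    have "map (\<lambda>z. lb (t z)) xs = map flip (map lb xs)" using assms(2)[OF xs] by simp
    then show "fanv True (map (\<lambda>z. lb (t z)) xs) = fanv False (map lb xs)"
      using fanv_flip[OF assms(1)[OF xs]] by (simp only:)
  qed
  finally show ?thesis by (simp add: fan_bd)
qed

lemma fan_long:
  assumes "\<And>xs. xs \<in> Poly_Mapping.keys c \<Longrightarrow> noncomp (map lb xs) \<and> (\<forall>z\<in>set xs. lb z < 2 * M) \<and> length xs > M"
  shows "fan lb c = 0" "fan lb (bd c) = 0"
proof -
  have *: "ext (\<lambda>xs. fanv b (map lb xs)) c = ext (\<lambda>_. 0) c" for b
    by (rule ext_cong) (use assms in \<open>auto intro!: fanv_long[where M = M]\<close>)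
  have "ext (\<lambda>_. 0 :: bit) c = 0" by (simp add: ext_def)
  with *[of True] *[of False] show "fan lb c = 0" "fan lb (bd c) = 0"
    by (simp_all add: fan_bd) (simp_all add: fan_def)
qed

subsection \<open>Spaces with two commuting involutions\<close>

text \<open>\<open>xi\<close> is odd under \<open>t1\<close>, \<open>om\<close> is odd under \<open>t2\<close>, and \<open>nu\<close> is even under \<open>t1\<close> although the
  segment from \<open>xi\<close> to \<open>nu\<close> avoids the origin. The set \<open>D s\<close> lies over a closed hemisphere of
  dimension \<open>s\<close> of the sphere of the \<open>xi\<close>.\<close>

locale double_involution =
  fixes X :: "'a::metric_space set" and t1 t2 :: "'a \<Rightarrow> 'a" and p q r :: nat
    and xi nu om :: "'a \<Rightarrow> nat \<Rightarrow> real" and c0 b0 :: real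
  assumes t1X: "z \<in> X \<Longrightarrow> t1 z \<in> X" and t2X: "z \<in> X \<Longrightarrow> t2 z \<in> X"
    and t1t1: "t1 (t1 z) = z" and t2t2: "t2 (t2 z) = z" and t12: "t1 (t2 z) = t2 (t1 z)"
    and t1d: "dist (t1 z) (t1 w) = dist z w" and t2d: "dist (t2 z) (t2 w) = dist z w"
    and xi_t1: "xi (t1 z) i = - xi z i" and xi_t2: "xi (t2 z) i = xi z i"
    and nu_t1: "nu (t1 z) i = nu z i" and om_t1: "om (t1 z) i = om z i" and om_t2: "om (t2 z) i = - om z i"
    and uc_xi: "uniformly_continuous_on X (\<lambda>z. xi z i)" and uc_nu: "uniformly_continuous_on X (\<lambda>z. nu z i)"
    and uc_om: "uniformly_continuous_on X (\<lambda>z. om z i)"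
    and c0: "c0 > 0" and om_big: "z \<in> X \<Longrightarrow> \<exists>i<p. c0 \<le> \<bar>om z i\<bar>"
    and xn_big: "z \<in> X \<Longrightarrow> 0 \<le> t \<Longrightarrow> t \<le> 1 \<Longrightarrow> \<exists>i<q. c0 \<le> \<bar>(1 - t) * xi z i + t * nu z i\<bar>"
    and b0: "z \<in> X \<Longrightarrow> \<bar>xi z i\<bar> \<le> b0" "z \<in> X \<Longrightarrow> \<bar>nu z i\<bar> \<le> b0"
    and pq: "p < q" and r0: "r > 0"
begin

definition D :: "nat \<Rightarrow> 'a set" where
  "D s = {z \<in> X. (\<forall>i. s < i \<longrightarrow> i < q \<longrightarrow> xi z i = 0) \<and> xi z s \<ge> 0}"

text \<open>In characteristic two, \<open>1 + t\<close> is both the norm and the difference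
  \<open>1 - t\<close> of the group of order two; hence it squares to zero.\<close>

definition T1 :: "'a chain2 \<Rightarrow> 'a chain2" where "T1 c = c + push t1 c"
definition T2 :: "'a chain2 \<Rightarrow> 'a chain2" where "T2 c = c + push t2 c"

lemma T_add [simp]: "T1 (c + d) = T1 c + T1 d" "T2 (c + d) = T2 c + T2 d"
  by (simp_all add: T1_def T2_def ac_simps)

lemma T_zero [simp]: "T1 0 = 0" "T2 0 = 0"
  by (simp_all add: T1_def T2_def)

lemma push_ident: "push (\<lambda>x. x) c = c"
  by (rule additive_eq[where G = "\<lambda>c. c"]) simp_all

lemma T_T [simp]: "T1 (T1 c) = 0" "T2 (T2 c) = 0"
  by (simp_all add: T1_def T2_def push_push t1t1 t2t2 push_ident ac_simps)

lemma T_comm: "T2 (T1 c) = T1 (T2 c)"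
  by (simp add: T1_def T2_def push_push t12 ac_simps)

lemma bd_T: "bd (T1 c) = T1 (bd c)" "bd (T2 c) = T2 (bd c)"
  by (simp_all add: T1_def T2_def bd_push)

lemma T_empty [simp]: "T1 (sg []) = 0" "T2 (sg []) = 0"
  by (simp_all add: T1_def T2_def)

lemma DX: "D s \<subseteq> X" by (auto simp: D_def)

lemma sm_T1: "sm (D s) e L c \<Longrightarrow> Suc s < q \<Longrightarrow> sm (D (Suc s)) e L (T1 c)"
proof -
  assume c: "sm (D s) e L c" and s: "Suc s < q"
  have "D s \<subseteq> D (Suc s)" using s by (auto simp: D_def)
  then have "sm (D (Suc s)) e L c" using c by (auto intro: sm_mono)
  moreover have "sm (D (Suc s)) e L (push t1 c)"
    by (rule sm_push[OF c]) (use s in \<open>auto simp: D_def t1X xi_t1 t1d\<close>)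
  ultimately show ?thesis unfolding T1_def by (rule sm_add)
qed

lemma sm_T2: "sm (D s) e L c \<Longrightarrow> Suc s < q \<Longrightarrow> sm (D (Suc s)) e L (T2 c)"
proof -
  assume c: "sm (D s) e L c" and s: "Suc s < q"
  have "D s \<subseteq> D (Suc s)" using s by (auto simp: D_def)
  moreover have "sm (D s) e L (push t2 c)"
    by (rule sm_push[OF c]) (auto simp: D_def t2X xi_t2 t2d)
  then have "sm (D s) e L (T2 c)" unfolding T2_def using c by (intro sm_add)
  ultimately show ?thesis by (auto intro: sm_mono)
qed

lemma sm_T1X: "sm X e L c \<Longrightarrow> sm X e L (T1 c)"
  unfolding T1_def by (intro sm_add sm_push) (auto simp: t1X t1d)

lemma sm_T2X: "sm X e L c \<Longrightarrow> sm X e L (T2 c)"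
  unfolding T2_def by (intro sm_add sm_push) (auto simp: t2X t2d)

text \<open>Half of \<open>c0\<close> leaves room for an equally large change caused by moving along
  the segment from \<open>xi\<close> to \<open>nu\<close>.\<close>

definition fine_scale :: "real \<Rightarrow> bool" where
  "fine_scale e \<longleftrightarrow> (\<forall>u\<in>X. \<forall>v\<in>X. dist u v \<le> e \<longrightarrow> (\<forall>i<q. \<bar>xi u i - xi v i\<bar> \<le> c0 / 2 \<and>
      \<bar>nu u i - nu v i\<bar> \<le> c0 / 2 \<and> \<bar>om u i - om v i\<bar> \<le> c0 / 2))"

lemma fine_exists: "\<exists>e>0. fine_scale e"
proof -
  have "c0 / 2 > 0" using c0 by simp
  obtain e1 where e1: "e1 > 0" "\<And>i u v. i \<le> q \<Longrightarrow> u \<in> X \<Longrightarrow> v \<in> X \<Longrightarrow> dist u v \<le> e1 \<Longrightarrow> dist (xi u i) (xi v i) \<le> c0 / 2"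
    using uniform_modulus[of q X "\<lambda>i z. xi z i", OF uc_xi \<open>c0 / 2 > 0\<close>] by blast
  obtain e2 where e2: "e2 > 0" "\<And>i u v. i \<le> q \<Longrightarrow> u \<in> X \<Longrightarrow> v \<in> X \<Longrightarrow> dist u v \<le> e2 \<Longrightarrow> dist (nu u i) (nu v i) \<le> c0 / 2"
    using uniform_modulus[of q X "\<lambda>i z. nu z i", OF uc_nu \<open>c0 / 2 > 0\<close>] by blast
  obtain e3 where e3: "e3 > 0" "\<And>i u v. i \<le> q \<Longrightarrow> u \<in> X \<Longrightarrow> v \<in> X \<Longrightarrow> dist u v \<le> e3 \<Longrightarrow> dist (om u i) (om v i) \<le> c0 / 2"
    using uniform_modulus[of q X "\<lambda>i z. om z i", OF uc_om \<open>c0 / 2 > 0\<close>] by blast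
  have "fine_scale (min e1 (min e2 e3))"
    unfolding fine_scale_def using e1(2) e2(2) e3(2) by (simp add: dist_real_def)
  then show ?thesis using e1(1) e2(1) e3(1) by (metis min_less_iff_conj)
qed

section \<open>Labels from \<open>om\<close> and from the segments joining \<open>xi\<close> to
  \<open>nu\<close>\<close>

definition lxn :: "real \<Rightarrow> 'a \<Rightarrow> nat" where
  "lxn t z = lab c0 (\<lambda>i. (1 - t) * xi z i + t * nu z i)"

definition lom :: "'a \<Rightarrow> nat" where
  "lom z = lab c0 (om z)"

lemma lom_noncomp:
  assumes "fine_scale e" "u \<in> X" "v \<in> X" "dist u v \<le> e"
  shows "lom u \<noteq> flip (lom v)"
  unfolding lom_def
proof (rule lab_noncomp[where M = p])
  fix i assume "i < p"
  then have "i < q" using pq by simp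
  then have "\<bar>om u i - om v i\<bar> \<le> c0 / 2" using assms unfolding fine_scale_def by blast
  then show "\<bar>om u i - om v i\<bar> < 2 * c0" using c0 by linarith
qed (use om_big assms c0 in auto)

lemma lxn_noncomp:
  assumes "fine_scale e" "u \<in> X" "v \<in> X" "dist u v \<le> e" "0 \<le> s" "s \<le> 1" "0 \<le> t" "t \<le> 1" "\<bar>s - t\<bar> * (2 * b0) \<le> c0 / 2"
  shows "lxn s u \<noteq> flip (lxn t v)"
  unfolding lxn_def
proof (rule lab_noncomp[where M = q])
  fix i assume i: "i < q"
  have d: "\<bar>xi u i - xi v i\<bar> \<le> c0 / 2" "\<bar>nu u i - nu v i\<bar> \<le> c0 / 2"
    using assms i unfolding fine_scale_def by auto
  have "((1 - s) * xi u i + s * nu u i) - ((1 - t) * xi v i + t * nu v i)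
      = (1 - s) * (xi u i - xi v i) + s * (nu u i - nu v i) + (s - t) * (nu v i - xi v i)"
    by (simp add: algebra_simps)
  moreover have "\<bar>(1 - s) * (xi u i - xi v i)\<bar> \<le> (1 - s) * (c0 / 2)"
    using mult_left_mono[OF d(1), of "1 - s"] assms(6) by (simp add: abs_mult)
  moreover have "\<bar>s * (nu u i - nu v i)\<bar> \<le> s * (c0 / 2)"
    using mult_left_mono[OF d(2), of s] assms(5) by (simp add: abs_mult)
  moreover have "\<bar>(s - t) * (nu v i - xi v i)\<bar> \<le> \<bar>s - t\<bar> * (2 * b0)"
  proof -
    have "\<bar>nu v i - xi v i\<bar> \<le> 2 * b0" using b0[OF assms(3), of i] by linarith
    then show ?thesis by (simp add: abs_mult mult_left_mono)
  qed
  moreover have "(1 - s) * (c0 / 2) + s * (c0 / 2) = c0 / 2" by (simp flip: distrib_right)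
  ultimately have "\<bar>((1 - s) * xi u i + s * nu u i) - ((1 - t) * xi v i + t * nu v i)\<bar> \<le> c0"
    using assms(9) by linarith
  then show "\<bar>((1 - s) * xi u i + s * nu u i) - ((1 - t) * xi v i + t * nu v i)\<bar> < 2 * c0"
    using c0 by linarith
qed (use xn_big assms c0 in auto)

lemma keys_noncomp_lom:
  assumes "fine_scale e" "sm X e L c" "xs \<in> Poly_Mapping.keys c"
  shows "noncomp (map lom xs)"
  using assms lom_noncomp unfolding sm_def noncomp_def by (auto simp: subset_iff)

lemma keys_noncomp_lxn:
  assumes "fine_scale e" "sm X e L c" "xs \<in> Poly_Mapping.keys c" "0 \<le> t" "t \<le> 1"
  shows "noncomp (map (lxn t) xs)"
  using assms lxn_noncomp[of e _ _ t t] c0 unfolding sm_def noncomp_def by (auto simp: subset_iff)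

lemma lom_t2: "z \<in> X \<Longrightarrow> lom (t2 z) = flip (lom z)"
proof -
  assume "z \<in> X"
  then have "\<exists>i. c0 \<le> \<bar>om z i\<bar>" using om_big by blast
  from lab_uminus[OF this c0] show ?thesis by (simp add: lom_def lab_def om_t2)
qed

lemma lom_t1: "lom (t1 z) = lom z"
  by (simp add: lom_def lab_def om_t1)

lemma lxn_t1: "z \<in> X \<Longrightarrow> lxn 0 (t1 z) = flip (lxn 0 z)"
  using lab_uminus[of c0 "xi z"] xn_big[of z 0] c0 unfolding lxn_def xi_t1 by auto

lemma fan_T1_lom [simp]: "fan lom (T1 c) = 0"
  unfolding T1_def fan_add fan_push lom_t1 by (rule add_self)

lemma fan_T1_lxn [simp]: "fan (lxn 1) (T1 c) = 0"
proof -
  have "lxn 1 (t1 z) = lxn 1 z" for z by (simp add: lxn_def lab_def nu_t1)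
  then show ?thesis unfolding T1_def fan_add fan_push by simp
qed

lemma fan_T2_bd: "fine_scale e \<Longrightarrow> sm X e L c \<Longrightarrow> fan lom (T2 c) = fan lom (bd c)"
  unfolding T2_def
  by (rule fan_bd_equivariant[symmetric]) (use keys_noncomp_lom lom_t2 in \<open>auto simp: sm_def subset_iff\<close>)

lemma fan_T1_bd: "fine_scale e \<Longrightarrow> sm X e L c \<Longrightarrow> fan (lxn 0) (T1 c) = fan (lxn 0) (bd c)"
  unfolding T1_def
  by (rule fan_bd_equivariant[symmetric]) (use keys_noncomp_lxn lxn_t1 in \<open>auto simp: sm_def subset_iff\<close>)

text \<open>A form of Borsuk--Ulam. The augmentation starts the count at 1 and oddness of
  \<open>om\<close> under \<open>t2\<close> carries it upwards; the terms \<open>T1 (d j)\<close>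
  are invisible because \<open>om\<close> is even under \<open>t1\<close>. At \<open>q\<close>
  vertices the \<open>p < q\<close> coordinates of \<open>om\<close> no longer admit an alternating
  simplex.\<close>

lemma no_t2_sequence:
  assumes e: "fine_scale e" and c: "\<And>j. j < q \<Longrightarrow> sm X e (Suc j) (c j)"
    and c0': "bd (c 0) = sg []" and cS: "\<And>j. Suc j < q \<Longrightarrow> bd (c (Suc j)) = T2 (c j) + T1 (d j)"
  shows False
proof -
  have one: "fan lom (T2 (c j)) = 1" if "j < q" for j
    using that
  proof (induction j)
    case 0
    then show ?case using fan_T2_bd[OF e c[OF 0]] c0' by simp
  next
    case (Suc j)
    then show ?case using fan_T2_bd[OF e c[OF Suc.prems]] cS[OF Suc.prems] by simp
  qed
  have q1: "q - 1 < q" using pq by simp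
  have smT: "sm X e q (T2 (c (q - 1)))" using sm_T2X[OF c[OF q1]] pq by simp
  have "fan lom (T2 (c (q - 1))) = 0"
  proof (rule fan_long(1)[where M = p])
    fix xs assume xs: "xs \<in> Poly_Mapping.keys (T2 (c (q - 1)))"
    have "length xs = q" "set xs \<subseteq> X" using smT xs by (auto simp: sm_def)
    moreover have "lom z < 2 * p" if "z \<in> X" for z
      unfolding lom_def by (rule lab_less) (use om_big[OF that] in auto)
    ultimately show "noncomp (map lom xs) \<and> (\<forall>z\<in>set xs. lom z < 2 * p) \<and> length xs > p"
      using keys_noncomp_lom[OF e smT xs] pq by auto
  qed
  with one[OF q1] show False by simp
qed

text \<open>One small step of the parameter is a prism over \<open>z\<close>. Its simplices have
  \<open>q + 1\<close> vertices, too many to alternate with \<open>q\<close> coordinates, so the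
  counts at both ends of the prism agree.\<close>

lemma fan_homotopy:
  assumes e: "fine_scale e" and z: "sm X e q z" "bd z = 0"
  shows "fan (lxn 0) z = fan (lxn 1) z"
proof -
  \<comment> \<open>For empty \<open>X\<close> the assumptions allow a negative
    \<open>b0\<close>.\<close>
  have "b0 \<ge> 0 \<or> X = {}" using b0 by force
  then consider "X = {}" | "b0 \<ge> 0" by blast
  then show ?thesis
  proof cases
    case 1
    then have "map (lxn 0) xs = map (lxn 1) xs" if "xs \<in> Poly_Mapping.keys z" for xs
      using z(1) that by (auto simp: sm_def)
    then show ?thesis unfolding fan_def by (intro ext_cong arg_cong[of _ _ "fanv True"])
  next
    case 2
    \<comment> \<open>With at least \<open>4 * b0 / c0\<close> steps, a single step changes each
      coordinate by at most \<open>c0 / 2\<close>, since \<open>nu\<close> and \<open>xi\<close>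
      differ by at most \<open>2 * b0\<close>.\<close>
    obtain m :: nat where m: "real m \<ge> 4 * b0 / c0"
      using real_arch_simple by blast
    define n where "n = Suc m"
    have n: "n > 0" "real n \<ge> 4 * b0 / c0" using m by (auto simp: n_def)
    have nb: "1 / real n * (2 * b0) \<le> c0 / 2"
      using n c0 2 by (simp add: field_simps)
    have step: "fan (lxn (real k / real n)) z = fan (lxn (real (Suc k) / real n)) z" if k: "k < n" for k
    proof -
      define lb where "lb = (\<lambda>(z, t). lxn t z)"
      define s where "s = real k / real n"
      define t where "t = real (Suc k) / real n"
      have st: "0 \<le> s" "s \<le> 1" "0 \<le> t" "t \<le> 1" "\<bar>s - t\<bar> = 1 / real n"
        using k n by (auto simp: s_def t_def field_simps abs_if)
      let ?P = "prism (\<lambda>z. (z, s)) (\<lambda>z. (z, t)) z"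
      have "fan lb (bd ?P) = 0"
      proof (rule fan_long(2)[where M = q])
        fix ys assume "ys \<in> Poly_Mapping.keys ?P"
        then obtain xs where xs: "xs \<in> Poly_Mapping.keys z" "ys \<in> Poly_Mapping.keys (prl (\<lambda>z. (z, s)) (\<lambda>z. (z, t)) xs)"
          unfolding prism_def using keys_ext[of "prl (\<lambda>z. (z, s)) (\<lambda>z. (z, t))" z] by auto
        have X: "length xs = q" "set xs \<subseteq> X" "\<And>u v. u \<in> set xs \<Longrightarrow> v \<in> set xs \<Longrightarrow> dist u v \<le> e"
          using z(1) xs(1) by (auto simp: sm_def)
        have ys: "length ys = Suc q" "set ys \<subseteq> set xs \<times> {s, t}"
          using keys_prl[OF xs(2)] X(1) by auto
        have "lb a \<noteq> flip (lb b)" if ab: "a \<in> set ys" "b \<in> set ys" for a b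
        proof -
          obtain u s' v t' where ab': "a = (u, s')" "b = (v, t')" by (cases a, cases b)
          have uv: "u \<in> set xs" "v \<in> set xs" "s' \<in> {s, t}" "t' \<in> {s, t}"
            using subsetD[OF ys(2) ab(1)] subsetD[OF ys(2) ab(2)] unfolding ab' by auto
          have "lxn s' u \<noteq> flip (lxn t' v)"
          proof (rule lxn_noncomp[OF e])
            have "\<bar>s' - t'\<bar> \<le> 1 / real n"
              using uv(3,4) st(5) n(1) by (auto simp: abs_minus_commute)
            then have "\<bar>s' - t'\<bar> * (2 * b0) \<le> 1 / real n * (2 * b0)"
              using 2 by (intro mult_right_mono) auto
            then show "\<bar>s' - t'\<bar> * (2 * b0) \<le> c0 / 2" using nb by linarith
          qed (use X uv st in auto)
          then show ?thesis by (simp add: lb_def ab')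
        qed
        moreover have "lb a < 2 * q" if a: "a \<in> set ys" for a
        proof -
          obtain u s' where a': "a = (u, s')" by (cases a)
          have "u \<in> set xs" "s' \<in> {s, t}" using subsetD[OF ys(2) a] unfolding a' by auto
          then have "\<exists>i<q. c0 \<le> \<bar>(1 - s') * xi u i + s' * nu u i\<bar>"
            using X(2) st by (intro xn_big) auto
          then show ?thesis unfolding lb_def lxn_def a' by (simp add: lab_less)
        qed
        ultimately show "noncomp (map lb ys) \<and> (\<forall>z\<in>set ys. lb z < 2 * q) \<and> length ys > q"
          using ys(1) by (auto simp: noncomp_def)
      qed
      moreover have "bd ?P = push (\<lambda>z. (z, s)) z + push (\<lambda>z. (z, t)) z"
        by (simp add: bd_prism z(2))
      ultimately have "fan (lxn s) z + fan (lxn t) z = 0"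
        by (simp only: fan_add fan_push lb_def prod.case)
      then show ?thesis
        unfolding s_def[symmetric] t_def[symmetric] by (rule eq_of_add_eq_zero)
    qed
    have "fan (lxn 0) z = fan (lxn (real k / real n)) z" if "k \<le> n" for k
      using that by (induction k) (auto simp: step simp del: of_nat_Suc)
    from this[of n] show ?thesis using n(1) by simp
  qed
qed

text \<open>Oddness of \<open>xi\<close> under \<open>t1\<close> gives the last cycle the count 1.
  Moving from \<open>xi\<close> to \<open>nu\<close> preserves the count, but \<open>nu\<close> is
  even under \<open>t1\<close>, so for it the two halves of the cycle cancel.\<close>

lemma no_t1_sequence:
  assumes e: "fine_scale e" and c: "\<And>j. j < q \<Longrightarrow> sm X e (Suc j) (c j)"
    and c0': "bd (c 0) = sg []" and cS: "\<And>j. Suc j < q \<Longrightarrow> bd (c (Suc j)) = T1 (c j)"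
  shows False
proof -
  have one: "fan (lxn 0) (T1 (c j)) = 1" if "j < q" for j
    using that
  proof (induction j)
    case 0
    then show ?case using fan_T1_bd[OF e c[OF 0]] c0' by simp
  next
    case (Suc j)
    then show ?case using fan_T1_bd[OF e c[OF Suc.prems]] cS[OF Suc.prems] by simp
  qed
  have q1: "q - 1 < q" using pq by simp
  have smT: "sm X e q (T1 (c (q - 1)))" using sm_T1X[OF c[OF q1]] pq by simp
  have "bd (T1 (c (q - 1))) = 0"
  proof (cases "q - 1")
    case 0
    then show ?thesis using c0' by (simp add: bd_T)
  next
    case (Suc j)
    then show ?thesis using cS[of j] q1 by (simp add: bd_T)
  qed
  from fan_homotopy[OF e smT this] one[OF q1] show False by simp
qed

text \<open>A homotopy-theoretic resolution of a point under the two involutions. When the chain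
  \<open>g (r - 1) 0\<close> closes up to a nontrivial cycle of length \<open>r\<close>, that cycle is the only obstruction,
  and the weights \<open>w\<close> record how often it has to be subtracted.\<close>

definition rhs :: "(nat \<Rightarrow> bool) \<Rightarrow> (nat \<Rightarrow> nat \<Rightarrow> 'a chain2) \<Rightarrow> nat \<Rightarrow> nat \<Rightarrow> 'a chain2" where
  "rhs w g i j = (if j = 0 then 0 else T2 (g i (j - 1)))
     + T1 ((if i = 0 then 0 else g (i - 1) j) + (if w i \<and> r \<le> i + j then g (r - 1) (i + j - r) else 0))"

text \<open>The double complex for two commuting involutions, truncated to \<open>i < r\<close>:
  \<open>T1\<close> lowers \<open>i\<close> and \<open>T2\<close> lowers \<open>j\<close>. The total
  degree \<open>i + j\<close> is also the dimension of the hemisphere. The correction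
  \<open>g (r - 1) (i + j - r)\<close> has total degree \<open>i + j - 1\<close>, just like the
  other terms.\<close>

definition grid :: "(nat \<Rightarrow> real) \<Rightarrow> nat \<Rightarrow> (nat \<Rightarrow> bool) \<Rightarrow> (nat \<Rightarrow> nat \<Rightarrow> 'a chain2) \<Rightarrow> bool" where
  "grid sc s w g \<longleftrightarrow> (\<forall>i j. i < r \<longrightarrow> i + j \<le> s \<longrightarrow> sm (D (i + j)) (sc (i + j)) (Suc (i + j)) (g i j) \<and>
     bd (g i j) = (if i + j = 0 then sg [] else rhs w g i j))"

text \<open>\<open>T1\<close> and \<open>T2\<close> square to zero and commute, so every mixed term
  \<open>T1 (T2 _)\<close> occurs twice; this includes the corrections, whose weight
  \<open>w i\<close> does not change with \<open>j\<close>.\<close>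

lemma bd_rhs:
  assumes g: "grid sc s w g" and i: "i < r" "i + j = Suc s"
  shows "bd (rhs w g i j) = 0"
proof -
  have bdg: "bd (g a b) = (if a + b = 0 then sg [] else rhs w g a b)" if "a < r" "a + b \<le> s" for a b
    using g that unfolding grid_def by blast
  define U where "U = (if i = 0 then 0 else g (i - 1) j)"
  define V where "V = (if w i \<and> r \<le> i + j then g (r - 1) (i + j - r) else 0)"
  have T1bd: "T1 (bd (g a b)) = T1 (T2 (if b = 0 then 0 else g a (b - 1)))" if "a < r" "a + b \<le> s" for a b
    using bdg[OF that] by (simp add: rhs_def)
  have TU: "T1 (bd U) = T1 (T2 (if i = 0 \<or> j = 0 then 0 else g (i - 1) (j - 1)))"
    unfolding U_def using T1bd[of "i - 1" j] i by auto
  have TV: "T1 (bd V) = T1 (T2 (if w i \<and> r < i + j then g (r - 1) (i + j - r - 1) else 0))"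
  proof (cases "w i \<and> r \<le> i + j")
    case True
    then have "T1 (bd V) = T1 (T2 (if i + j - r = 0 then 0 else g (r - 1) (i + j - r - 1)))"
      unfolding V_def using T1bd[of "r - 1" "i + j - r"] i r0 by simp
    then show ?thesis using True by auto
  qed (auto simp: V_def)
  have "bd (rhs w g i j) = (if j = 0 then 0 else T2 (bd (g i (j - 1)))) + T1 (bd U) + T1 (bd V)"
    unfolding rhs_def U_def V_def by (simp add: bd_T ac_simps)
  also have "\<dots> = 0"
  proof (cases "j = 0")
    case True
    then show ?thesis using i unfolding TU TV by simp
  next
    case False
    have "T2 (bd (g i (j - 1))) = T2 (T1 ((if i = 0 then 0 else g (i - 1) (j - 1)) +
        (if w i \<and> r \<le> i + (j - 1) then g (r - 1) (i + (j - 1) - r) else 0)))"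
      using bdg[of i "j - 1"] i False by (auto simp: rhs_def)
    moreover have "r \<le> i + (j - 1) \<longleftrightarrow> r < i + j" "i + (j - 1) - r = i + j - r - 1"
      using False by auto
    ultimately show ?thesis
      using False unfolding TU TV by (simp add: T_comm ac_simps)
  qed
  finally show ?thesis .
qed

lemma sm_rhs:
  assumes g: "grid sc s w g" and i: "i < r" "i + j = Suc s" and s: "Suc s < q"
  shows "sm (D (Suc s)) (sc s) (Suc s) (rhs w g i j)"
proof -
  have *: "sm (D s) (sc s) (Suc s) (g a b)" if "a < r" "a + b = s" for a b
    using g that unfolding grid_def by force
  have "sm (D s) (sc s) (Suc s) ((if i = 0 then 0 else g (i - 1) j) + (if w i \<and> r \<le> i + j then g (r - 1) (i + j - r) else 0))"
    using *[of "i - 1" j] *[of "r - 1" "i + j - r"] i r0 by (intro sm_add) auto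
  from sm_T1[OF this s] show ?thesis
    unfolding rhs_def using *[of i "j - 1"] sm_T2 i s by (intro sm_add) auto
qed

lemma rhs_cong:
  assumes "\<And>a b. a + b = s \<Longrightarrow> g' a b = g a b" "i < r" "i + j = Suc s"
  shows "rhs w g' i j = rhs w g i j"
proof -
  have "j \<noteq> 0 \<Longrightarrow> g' i (j - 1) = g i (j - 1)" "i \<noteq> 0 \<Longrightarrow> g' (i - 1) j = g (i - 1) j"
    "r \<le> i + j \<Longrightarrow> g' (r - 1) (i + j - r) = g (r - 1) (i + j - r)"
    using assms r0 by auto
  then show ?thesis unfolding rhs_def by auto
qed

lemma grid_extend:
  assumes g: "grid sc s w g"
    and Y: "\<And>i. i < r \<Longrightarrow> i \<le> Suc s \<Longrightarrow> sm (D (Suc s)) (sc (Suc s)) (Suc (Suc s)) (Y i) \<and> bd (Y i) = rhs w g i (Suc s - i)"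
  shows "grid sc (Suc s) w (\<lambda>i j. if i + j = Suc s then Y i else g i j)" (is "grid _ _ _ ?g")
  unfolding grid_def
proof (intro allI impI)
  fix i j assume ij: "i < r" "i + j \<le> Suc s"
  show "sm (D (i + j)) (sc (i + j)) (Suc (i + j)) (?g i j) \<and> bd (?g i j) = (if i + j = 0 then sg [] else rhs w ?g i j)"
  proof (cases "i + j = Suc s")
    case True
    then have "rhs w ?g i j = rhs w g i j" using ij by (intro rhs_cong) auto
    moreover have "j = Suc s - i" using True by simp
    ultimately show ?thesis using Y[of i] True ij by simp
  next
    case False
    have "rhs w ?g i j = rhs w g i j" if nz: "i + j \<noteq> 0"
    proof -
      obtain s' where "i + j = Suc s'" using not0_implies_Suc[OF nz] by blast
      then show ?thesis using ij False by (intro rhs_cong[where s = s']) auto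
    qed
    then show ?thesis using g False ij unfolding grid_def by simp
  qed
qed

lemma grid_weights: "grid sc s w g \<Longrightarrow> s < r \<Longrightarrow> grid sc s w' g"
  unfolding grid_def rhs_def by auto

text \<open>Right-hand sides with fewer than \<open>r\<close> vertices bound. At \<open>r\<close>
  vertices the single cycle \<open>kap\<close> decides which of the two impossible sequences can be
  completed. For \<open>q \<le> r\<close> this point is never reached and the grid is complete
  before.\<close>

theorem contradiction:
  assumes like: "\<And>s. s < q \<Longrightarrow> sphere_like (D s) (D s) r" and "z0 \<in> D 0"
  shows False
proof -
  obtain e0 where e0: "e0 > 0" "fine_scale e0" using fine_exists by blast
  define P where "P = (\<lambda>d e. 0 < e \<and> e \<le> d \<and> (\<forall>s<q. (\<forall>L\<le>q. L \<noteq> r \<longrightarrow>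
      (\<forall>c. sm (D s) e L c \<longrightarrow> bd c = 0 \<longrightarrow> (\<exists>u. sm (D s) d (Suc L) u \<and> bd u = c))) \<and>
      (\<forall>b c. sm (D s) e r b \<longrightarrow> sm (D s) e r c \<longrightarrow> bd b = 0 \<longrightarrow> bd c = 0 \<longrightarrow>
       (\<exists>u. sm (D s) d (Suc r) u \<and> (bd u = b \<or> bd u = c \<or> bd u = b + c)))))"
  have "\<exists>e. P d e" if d: "d > 0" for d
  proof -
    have "\<exists>e>0. s < q \<longrightarrow> L \<noteq> r \<longrightarrow> (\<forall>c. sm (D s) e L c \<longrightarrow> bd c = 0 \<longrightarrow> (\<exists>u. sm (D s) d (Suc L) u \<and> bd u = c))" for s L
    proof (cases "s < q \<and> L \<noteq> r")
      case True
      then have "bounds_in (D s) (D s) L" using like by (simp add: sphere_like_def)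
      from this[unfolded bounds_in_def, rule_format, OF d] show ?thesis by blast
    qed (auto intro: exI[of _ 1])
    then obtain e1 where e1: "\<And>s L. e1 s L > (0::real)" "\<And>s L c. s < q \<Longrightarrow> L \<noteq> r \<Longrightarrow> sm (D s) (e1 s L) L c \<Longrightarrow> bd c = 0 \<Longrightarrow>
        \<exists>u. sm (D s) d (Suc L) u \<and> bd u = c"
      by metis
    have "\<exists>e>0. s < q \<longrightarrow> (\<forall>b c. sm (D s) e r b \<longrightarrow> sm (D s) e r c \<longrightarrow> bd b = 0 \<longrightarrow> bd c = 0 \<longrightarrow>
       (\<exists>u. sm (D s) d (Suc r) u \<and> (bd u = b \<or> bd u = c \<or> bd u = b + c)))" for s
    proof (cases "s < q")
      case True
      then have "two_in (D s) (D s) r" using like by (simp add: sphere_like_def)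
      from this[unfolded two_in_def, rule_format, OF d] show ?thesis by blast
    qed (auto intro: exI[of _ 1])
    then obtain e2 where e2: "\<And>s. e2 s > 0" "\<And>s b c. s < q \<Longrightarrow> sm (D s) (e2 s) r b \<Longrightarrow> sm (D s) (e2 s) r c \<Longrightarrow>
        bd b = 0 \<Longrightarrow> bd c = 0 \<Longrightarrow> \<exists>u. sm (D s) d (Suc r) u \<and> (bd u = b \<or> bd u = c \<or> bd u = b + c)"
      by metis
    define F where "F = insert d (e2 ` {..q} \<union> (\<lambda>(s, L). e1 s L) ` ({..q} \<times> {..q}))"
    have F: "finite F" "F \<noteq> {}" by (auto simp: F_def)
    have "Min F > 0" using F e1(1) e2(1) d by (subst Min_gr_iff) (auto simp: F_def)
    moreover have "Min F \<le> d" by (rule Min_le[OF F(1)]) (simp add: F_def)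
    moreover have m2: "Min F \<le> e2 s" if "s < q" for s by (rule Min_le[OF F(1)]) (use that in \<open>auto simp: F_def\<close>)
    moreover have m1: "Min F \<le> e1 s L" if "s < q" "L \<le> q" for s L
      by (rule Min_le[OF F(1)]) (use that in \<open>auto simp: F_def\<close>)
    ultimately have "P d (Min F)"
      unfolding P_def using e1(2)[OF _ _ sm_smaller[OF _ m1]] e2(2)[OF _ sm_smaller[OF _ m2] sm_smaller[OF _ m2]]
      by blast
    then show ?thesis by blast
  qed
  then obtain ee where ee: "\<And>d. d > 0 \<Longrightarrow> P d (ee d)" by metis
  \<comment> \<open>Every filling coarsens its cycle, so the scales are iterated downwards from
    \<open>e0\<close> at the top dimension \<open>q\<close>; the starting point gets the finest
    scale.\<close>
  define sc where "sc = (\<lambda>s. (ee ^^ (q - s)) e0)"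
  have eepos: "(ee ^^ n) e0 > 0 \<and> (ee ^^ n) e0 \<le> e0" for n
  proof (induction n)
    case (Suc n)
    then show ?case using ee[of "(ee ^^ n) e0"] by (auto simp: P_def)
  qed (use e0 in auto)
  have scP: "P (sc (Suc s)) (sc s)" if "s < q" for s
  proof -
    have "q - s = Suc (q - Suc s)" using that by simp
    then have "sc s = ee (sc (Suc s))" by (simp add: sc_def)
    then show ?thesis using ee[of "sc (Suc s)"] eepos[of "q - Suc s"] by (simp add: sc_def)
  qed
  have scpos: "sc s > 0" "sc s \<le> e0" for s using eepos[of "q - s"] by (auto simp: sc_def)
  have bound: "\<exists>u. sm (D (Suc s)) (sc (Suc s)) (Suc (Suc s)) u \<and> bd u = c"
    if "Suc s < q" "Suc s \<noteq> r" "sm (D (Suc s)) (sc s) (Suc s) c" "bd c = 0" for s c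
    using scP[of s] that unfolding P_def by (meson Suc_lessD less_imp_le)
  have two: "\<exists>u. sm (D (Suc s)) (sc (Suc s)) (Suc (Suc s)) u \<and> (bd u = b \<or> bd u = c \<or> bd u = b + c)"
    if "Suc s < q" "Suc s = r" "sm (D (Suc s)) (sc s) (Suc s) b" "sm (D (Suc s)) (sc s) (Suc s) c" "bd b = 0" "bd c = 0" for s b c
    using scP[of s] that unfolding P_def by (metis Suc_lessD)
  have step: "\<exists>g'. grid sc (Suc s) w g'" if g: "grid sc s w g" and s: "Suc s < q" "Suc s \<noteq> r" for s w g
  proof -
    have "\<exists>u. sm (D (Suc s)) (sc (Suc s)) (Suc (Suc s)) u \<and> bd u = rhs w g i (Suc s - i)" if "i < r" "i \<le> Suc s" for i
      using that bound[OF s sm_rhs[OF g, of i "Suc s - i"] bd_rhs[OF g, of i "Suc s - i"]] s by simp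
    then obtain Y where "\<And>i. i < r \<Longrightarrow> i \<le> Suc s \<Longrightarrow> sm (D (Suc s)) (sc (Suc s)) (Suc (Suc s)) (Y i) \<and> bd (Y i) = rhs w g i (Suc s - i)"
      by metis
    from grid_extend[OF g this] show ?thesis by blast
  qed
  have fin: False if g: "grid sc (q - 1) w g" for w g
  proof (rule no_t2_sequence[OF e0(2), where c = "g 0" and d = "\<lambda>j. if w 0 \<and> r \<le> Suc j then g (r - 1) (Suc j - r) else 0"])
    have G: "sm (D j) (sc j) (Suc j) (g 0 j) \<and> bd (g 0 j) = (if j = 0 then sg [] else rhs w g 0 j)" if "j < q" for j
      using g[unfolded grid_def, rule_format, of 0 j] that r0 by simp
    show "sm X e0 (Suc j) (g 0 j)" if "j < q" for j
      using G[OF that] DX scpos(2) by (auto intro: sm_mono)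
    show "bd (g 0 0) = sg []" using G[of 0] pq by simp
    show "bd (g 0 (Suc j)) = T2 (g 0 j) + T1 (if w 0 \<and> r \<le> Suc j then g (r - 1) (Suc j - r) else 0)" if "Suc j < q" for j
      using G[OF that] by (simp add: rhs_def)
  qed
  have g0: "grid sc 0 (\<lambda>_. False) (\<lambda>_ _. sg [z0])"
    unfolding grid_def using \<open>z0 \<in> D 0\<close> scpos(1)[of 0] by (auto simp: sm_sg less_imp_le)
  have low: "\<exists>g. grid sc s (\<lambda>_. False) g" if "s < q" "s < r" for s
    using that
  proof (induction s)
    case (Suc s)
    then show ?case using step by (metis Suc_lessD nat_neq_iff)
  qed (use g0 in blast)
  have high: "\<exists>g. grid sc (s + k) w g" if "grid sc s w g" "r \<le> s" "s + k < q" for s k w g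
    using that(3)
  proof (induction k)
    case (Suc k)
    then obtain g' where "grid sc (s + k) w g'" by auto
    then show ?case using step[of "s + k" w g'] Suc.prems \<open>r \<le> s\<close> by auto
  qed (use that in auto)
  show False
  proof (cases "q \<le> r")
    case True
    then have "q - 1 < q" "q - 1 < r" using pq by auto
    from low[OF this] show False using fin by blast
  next
    case False
    then have rq: "r < q" by simp
    have "r - 1 < q" "r - 1 < r" using rq r0 by auto
    from low[OF this] obtain g where g: "grid sc (r - 1) (\<lambda>_. False) g" by blast
    have r1: "Suc (r - 1) = r" using r0 by simp
    \<comment> \<open>It has \<open>r\<close> vertices, the only length in which a cycle of
      \<open>D r\<close> may fail to bound.\<close>
    define kap where "kap = T1 (g (r - 1) 0)"
    have gr: "sm (D (r - 1)) (sc (r - 1)) r (g (r - 1) 0)"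
      "bd (g (r - 1) 0) = (if r - 1 = 0 then sg [] else rhs (\<lambda>_. False) g (r - 1) 0)"
      using g[unfolded grid_def, rule_format, of "r - 1" 0] r1 by simp_all
    have kap: "sm (D r) (sc (r - 1)) r kap" "bd kap = 0"
    proof -
      show "sm (D r) (sc (r - 1)) r kap" unfolding kap_def using sm_T1[OF gr(1)] rq r1 by simp
      show "bd kap = 0" unfolding kap_def bd_T gr(2) by (simp add: rhs_def)
    qed
    show False
    proof (cases "\<exists>u. sm (D r) (sc r) (Suc r) u \<and> bd u = kap")
      case True
      then obtain u where u: "sm (D r) (sc r) (Suc r) u" "bd u = kap" by blast
      \<comment> \<open>If \<open>kap\<close> bounds, the column \<open>g i 0\<close> continues
        under \<open>T1\<close> alone: all later cycles have more than \<open>r\<close> vertices and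
        bound.\<close>
      define seq where "seq = (\<lambda>n (c :: nat \<Rightarrow> 'a chain2). \<forall>i\<le>n. sm (D i) (sc i) (Suc i) (c i) \<and>
          bd (c i) = (if i = 0 then sg [] else T1 (c (i - 1))))"
      have base: "seq r (\<lambda>i. if i = r then u else g i 0)"
        unfolding seq_def
      proof (intro allI impI)
        fix i assume i: "i \<le> r"
        show "sm (D i) (sc i) (Suc i) (if i = r then u else g i 0) \<and>
          bd (if i = r then u else g i 0) = (if i = 0 then sg [] else T1 (if i - 1 = r then u else g (i - 1) 0))"
        proof (cases "i = r")
          case True
          then show ?thesis using u r0 by (auto simp: kap_def)
        next
          case False
          then have "i < r" "i + 0 \<le> r - 1" using i by auto
          then have "sm (D i) (sc i) (Suc i) (g i 0) \<and> bd (g i 0) = (if i = 0 then sg [] else rhs (\<lambda>_. False) g i 0)"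
            using g[unfolded grid_def, rule_format, of i 0] by simp
          then show ?thesis using \<open>i < r\<close> by (auto simp: rhs_def)
        qed
      qed
      have "\<exists>c. seq (r + k) c" if "r + k < q" for k
        using that
      proof (induction k)
        case (Suc k)
        then obtain c where c: "seq (r + k) c" by auto
        let ?s = "r + k"
        have cs: "sm (D ?s) (sc ?s) (Suc ?s) (c ?s)" "bd (c ?s) = T1 (c (?s - 1))"
          using c r0 unfolding seq_def by (auto split: if_splits)
        have "sm (D (Suc ?s)) (sc ?s) (Suc ?s) (T1 (c ?s))" using sm_T1[OF cs(1)] Suc.prems by simp
        moreover have "bd (T1 (c ?s)) = 0" by (simp add: bd_T cs(2))
        ultimately obtain v where v: "sm (D (Suc ?s)) (sc (Suc ?s)) (Suc (Suc ?s)) v" "bd v = T1 (c ?s)"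
          using bound[of ?s "T1 (c ?s)"] Suc.prems by auto
        have "seq (Suc ?s) (\<lambda>i. if i = Suc ?s then v else c i)"
          unfolding seq_def
        proof (intro allI impI)
          fix i assume "i \<le> Suc ?s"
          then consider "i = Suc ?s" | "i \<le> ?s" by linarith
          then show "sm (D i) (sc i) (Suc i) (if i = Suc ?s then v else c i) \<and>
            bd (if i = Suc ?s then v else c i) = (if i = 0 then sg [] else T1 (if i - 1 = Suc ?s then v else c (i - 1)))"
            using v c unfolding seq_def by cases auto
        qed
        then show ?case by auto
      qed (use base in auto)
      from this[of "q - 1 - r"] rq obtain c where c: "seq (q - 1) c" by auto
      show False
      proof (rule no_t1_sequence[OF e0(2), where c = c])
        have C: "sm (D j) (sc j) (Suc j) (c j) \<and> bd (c j) = (if j = 0 then sg [] else T1 (c (j - 1)))" if "j < q" for j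
          using c that unfolding seq_def by auto
        show "sm X e0 (Suc j) (c j)" if "j < q" for j
          using C[OF that] DX scpos(2) by (auto intro: sm_mono)
        show "bd (c 0) = sg []" using C[of 0] pq by simp
        show "bd (c (Suc j)) = T1 (c j)" if "Suc j < q" for j
          using C[OF that] by simp
      qed
    next
      case nb: False
      \<comment> \<open>A \<open>kap\<close> that does not bound represents the only nonzero class,
        so each right-hand side bounds either as it stands or after \<open>kap\<close> is added;
        \<open>w\<close> records which.\<close>
      have "\<exists>w y. sm (D r) (sc r) (Suc r) y \<and> bd y = rhs (\<lambda>_. False) g i (r - i) + (if w then kap else 0)" if i: "i < r" for i
      proof -
        let ?Z = "rhs (\<lambda>_. False) g i (r - i)"
        have Z: "sm (D r) (sc (r - 1)) r ?Z" "bd ?Z = 0"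
          using sm_rhs[OF g i, of "r - i"] bd_rhs[OF g i, of "r - i"] i rq r1 by auto
        obtain y where y: "sm (D r) (sc r) (Suc r) y" "bd y = kap \<or> bd y = ?Z \<or> bd y = kap + ?Z"
          using two[of "r - 1" kap ?Z] kap Z rq r1 by auto
        then have "bd y = ?Z \<or> bd y = kap + ?Z" using nb by blast
        then show ?thesis
        proof
          assume "bd y = ?Z"
          then show ?thesis using y(1) by (intro exI[of _ False] exI[of _ y]) simp
        next
          assume "bd y = kap + ?Z"
          then show ?thesis using y(1) by (intro exI[of _ True] exI[of _ y]) (simp add: ac_simps)
        qed
      qed
      then obtain w Y where wY: "\<And>i. i < r \<Longrightarrow> sm (D r) (sc r) (Suc r) (Y i) \<and>
          bd (Y i) = rhs (\<lambda>_. False) g i (r - i) + (if w i then kap else 0)"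
        by metis
      \<comment> \<open>The weights enter the equations only from total degree \<open>r\<close> on,
        so they can be fixed at this stage.\<close>
      have gw: "grid sc (r - 1) w g" using grid_weights[OF g] r0 by simp
      have "rhs w g i (r - i) = rhs (\<lambda>_. False) g i (r - i) + (if w i then kap else 0)" if "i < r" for i
        using that unfolding rhs_def kap_def by (simp add: ac_simps)
      then have "grid sc (Suc (r - 1)) w (\<lambda>i j. if i + j = Suc (r - 1) then Y i else g i j)"
        using wY by (intro grid_extend[OF gw]) (simp add: r1)
      then obtain g' where "grid sc r w g'" using r1 by auto
      from high[OF this order_refl, of "q - 1 - r"] rq fin show False by auto
    qed
  qed
qed

end

subsection \<open>Bundles of cones over a spacelike sphere\<close>

text \<open>Composed with a right inverse \<open>H\<close> of \<open>G\<close>, the map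
  \<open>F n\<close> is eventually within 1/2 of the identity on \<open>range G\<close>, hence
  injective there.\<close>

lemma dim_range_lower_semicontinuous:
  fixes F :: "nat \<Rightarrow> 'a::euclidean_space \<Rightarrow> 'b::euclidean_space"
  assumes F: "\<And>n. linear (F n)" and G: "linear G" and lim: "\<And>v. (\<lambda>n. F n v) \<longlonglongrightarrow> G v"
  shows "\<forall>\<^sub>F n in sequentially. dim (range G) \<le> dim (range (F n))"
proof -
  obtain H where H: "linear H" "\<And>y. y \<in> range G \<Longrightarrow> G (H y) = y"
    using linear_exists_right_inverse_on[OF G subspace_UNIV] by blast
  have "(\<lambda>n. \<Sum>b\<in>Basis. norm (F n (H b) - G (H b))) \<longlonglongrightarrow> (\<Sum>b\<in>(Basis::'b set). norm (G (H b) - G (H b)))"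
    by (intro tendsto_intros lim)
  then have "\<forall>\<^sub>F n in sequentially. (\<Sum>b\<in>(Basis::'b set). norm (F n (H b) - G (H b))) < 1 / 2"
    by (intro order_tendstoD(2)) auto
  then show ?thesis
  proof eventually_elim
    case (elim n)
    define E where "E = (\<lambda>y. F n (H y) - G (H y))"
    have linE: "linear E"
      unfolding E_def using linear_compose[OF H(1) F[of n]] linear_compose[OF H(1) G]
      by (intro linear_compose_sub) (simp_all add: comp_def)
    have E: "norm (E y) \<le> 1 / 2 * norm y" for y
    proof -
      have "E y = (\<Sum>b\<in>Basis. (y \<bullet> b) *\<^sub>R E b)"
        by (subst euclidean_representation[of y, symmetric]) (simp add: linear_sum[OF linE] linear_scale[OF linE])
      then have "norm (E y) \<le> (\<Sum>b\<in>Basis. norm ((y \<bullet> b) *\<^sub>R E b))"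
        by (metis norm_sum)
      also have "\<dots> \<le> (\<Sum>b\<in>Basis. norm y * norm (E b))"
        by (intro sum_mono) (simp add: Basis_le_norm mult_right_mono)
      also have "\<dots> = norm y * (\<Sum>b\<in>(Basis::'b set). norm (E b))" by (simp add: sum_distrib_left)
      also have "\<dots> \<le> norm y * (1 / 2)"
        using elim by (intro mult_left_mono) (auto simp: E_def)
      finally show ?thesis by simp
    qed
    have lin: "linear (\<lambda>y. F n (H y))"
      using linear_compose[OF H(1) F[of n]] by (simp add: comp_def)
    have sub: "subspace (range G)" using G linear_subspace_image subspace_UNIV by blast
    have "inj_on (\<lambda>y. F n (H y)) (range G)"
    proof (subst linear_injective_on_subspace_0[OF lin sub], intro ballI impI)
      fix y assume y: "y \<in> range G" "F n (H y) = 0"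
      then have "norm (E y) = norm y" using H(2) by (simp add: E_def)
      then show "y = 0" using E[of y] by simp
    qed
    then have "dim ((\<lambda>y. F n (H y)) ` range G) = dim (range G)"
      using dim_image_eq[OF lin, of "range G"] span_eq_iff[THEN iffD2, OF sub] by metis
    moreover have "(\<lambda>y. F n (H y)) ` range G \<subseteq> range (F n)" by auto
    ultimately show ?case by (metis dim_subset)
  qed
qed

text \<open>Adjoin the vector as an additional column. Along the sequence it lies in the range, so
  the enlarged map still has rank at most \<open>d\<close>. By semicontinuity this persists in the
  limit, where \<open>A\<close> alone has rank \<open>d\<close>; the limit vector therefore lies in
  the limit range.\<close>

lemma closed_graph_range:
  fixes A :: "'v::euclidean_space \<Rightarrow> 'v \<Rightarrow> 'v"
  assumes "closed S" and lin: "\<And>x. linear (A x)" and cont: "continuous_on UNIV (\<lambda>z. A (fst z) (snd z))"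
    and d: "\<And>x. x \<in> S \<Longrightarrow> dim (range (A x)) = d"
  shows "closed {z. fst z \<in> S \<and> snd z \<in> range (A (fst z))}"
proof (subst closed_sequential_limits, intro allI impI, elim conjE)
  fix s and l assume s: "\<forall>n. s n \<in> {z. fst z \<in> S \<and> snd z \<in> range (A (fst z))}" and lim: "s \<longlonglongrightarrow> l"
  have l1: "(\<lambda>n. fst (s n)) \<longlonglongrightarrow> fst l" and l2: "(\<lambda>n. snd (s n)) \<longlonglongrightarrow> snd l"
    using lim by (auto intro: tendsto_intros)
  have S: "fst l \<in> S"
    by (rule closed_sequentially[OF assms(1) _ l1]) (use s in auto)
  define F where "F = (\<lambda>n z. A (fst (s n)) (fst z) + (snd z :: real) *\<^sub>R snd (s n))"
  define G where "G = (\<lambda>z. A (fst l) (fst z) + (snd z :: real) *\<^sub>R snd l)"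
  have linF: "linear (F n)" for n
    unfolding F_def using lin[of "fst (s n)"]
    by (intro linearI) (simp_all add: linear_add linear_scale algebra_simps)
  have linG: "linear G"
    unfolding G_def using lin[of "fst l"]
    by (intro linearI) (simp_all add: linear_add linear_scale algebra_simps)
  have "(\<lambda>n. F n z) \<longlonglongrightarrow> G z" for z
  proof -
    have "isCont (\<lambda>z. A (fst z) (snd z)) (fst l, fst z)"
      using cont by (simp add: continuous_on_eq_continuous_at)
    moreover have "(\<lambda>n. (fst (s n), fst z)) \<longlonglongrightarrow> (fst l, fst z)" by (intro tendsto_intros l1)
    ultimately have "(\<lambda>n. A (fst (s n)) (fst z)) \<longlonglongrightarrow> A (fst l) (fst z)"
      using isCont_tendsto_compose by fastforce
    then show ?thesis unfolding F_def G_def by (intro tendsto_intros l2)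
  qed
  from dim_range_lower_semicontinuous[OF linF linG this]
  obtain n where n: "dim (range G) \<le> dim (range (F n))"
    unfolding eventually_sequentially by blast
  obtain v where v: "snd (s n) = A (fst (s n)) v" "fst (s n) \<in> S" using s by blast
  have "range (F n) \<subseteq> range (A (fst (s n)))"
  proof
    fix y assume "y \<in> range (F n)"
    then obtain z where "y = A (fst (s n)) (fst z) + snd z *\<^sub>R A (fst (s n)) v" by (auto simp: F_def v)
    then have "y = A (fst (s n)) (fst z + snd z *\<^sub>R v)" by (simp add: linear_add[OF lin] linear_scale[OF lin])
    then show "y \<in> range (A (fst (s n)))" by blast
  qed
  then have "dim (range (F n)) \<le> d" using dim_subset d[OF v(2)] by metis
  then have "dim (range G) \<le> dim (range (A (fst l)))" using n d[OF S] by simp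
  moreover have "range (A (fst l)) \<subseteq> range G"
  proof
    fix y assume "y \<in> range (A (fst l))"
    then obtain w where "y = A (fst l) w" by blast
    then have "y = G (w, 0)" by (simp add: G_def)
    then show "y \<in> range G" by blast
  qed
  ultimately have "range (A (fst l)) = range G"
    using lin linG by (intro subspace_dim_equal) (auto intro: linear_subspace_image)
  moreover have "snd l \<in> range G"
  proof -
    have "snd l = G (0, 1)" by (simp add: G_def linear_0[OF lin])
    then show ?thesis by blast
  qed
  ultimately show "l \<in> {z. fst z \<in> S \<and> snd z \<in> range (A (fst z))}" using S by simp
qed

text \<open>The map \<open>K x\<close> sends the nonnegative cone of \<open>range (A x)\<close> to the nonpositive one, where the
  \<open>p\<close> coordinates \<open>B _ (e i)\<close> do not vanish simultaneously.\<close>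

locale cone_bundle =
  fixes B :: "'v::euclidean_space \<Rightarrow> 'v \<Rightarrow> real" and f e :: "nat \<Rightarrow> 'v" and p q r d :: nat
    and A K :: "'v \<Rightarrow> 'v \<Rightarrow> 'v" and S :: "'v set"
  assumes bil: "bilinear B" and sym: "B x y = B y x"
    and ortho: "i < q \<Longrightarrow> j < q \<Longrightarrow> B (f i) (f j) = (if i = j then 1 else 0)"
    and plus: "u \<noteq> 0 \<Longrightarrow> B u u \<ge> 0 \<Longrightarrow> \<exists>i<q. B u (f i) \<noteq> 0"
    and minus: "u \<noteq> 0 \<Longrightarrow> B u u \<le> 0 \<Longrightarrow> \<exists>i<p. B u (e i) \<noteq> 0"
    and linA: "linear (A x)" and contA: "continuous_on UNIV (\<lambda>z. A (fst z) (snd z))" and evenA: "A (- x) = A x"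
    and linK: "linear (K x)" and contK: "continuous_on UNIV (\<lambda>z. K (fst z) (snd z))" and evenK: "K (- x) = K x"
    and S_def: "S = {x \<in> span (f ` {..<q}). B x x = 1}"
    and dimA: "x \<in> S \<Longrightarrow> dim (range (A x)) = d"
    and perp: "x \<in> S \<Longrightarrow> B x (A x u) = 0"
    and KA: "x \<in> S \<Longrightarrow> u \<in> range (A x) \<Longrightarrow> u \<noteq> 0 \<Longrightarrow> B u u \<ge> 0 \<Longrightarrow> K x u \<noteq> 0 \<and> B (K x u) (K x u) \<le> 0"
    and split: "x \<in> S \<Longrightarrow> \<exists>P pr. subspace P \<and> dim P = r \<and> P \<subseteq> range (A x) \<and> linear pr \<and> (\<forall>u\<in>P. pr u = u) \<and>
       (\<forall>u\<in>range (A x). pr u \<in> P \<and> B (pr u) (pr u) \<ge> 0 \<and> B (pr u) (u - pr u) = 0 \<and>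
         (u \<noteq> pr u \<longrightarrow> B (u - pr u) (u - pr u) < 0))"
    and nullity: "(\<forall>x\<in>S. \<forall>u\<in>range (A x). B u u = 0) \<or>
       (\<forall>x\<in>S. \<forall>u\<in>range (A x). (\<forall>v. B u (A x v) = 0) \<longrightarrow> u = 0)"
    and pq: "p < q" and r0: "r > 0"
begin

lemma bb: "bounded_bilinear B"
  using bil by (simp add: bilinear_conv_bounded_bilinear)

lemmas cB [continuous_intros] = bounded_bilinear.continuous_on[OF bb]
lemmas B_simps = bounded_bilinear.add_left[OF bb] bounded_bilinear.add_right[OF bb]
  bounded_bilinear.scaleR_left[OF bb] bounded_bilinear.scaleR_right[OF bb]
  bounded_bilinear.minus_left[OF bb] bounded_bilinear.minus_right[OF bb]
  bounded_bilinear.diff_left[OF bb] bounded_bilinear.diff_right[OF bb]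
  bounded_bilinear.zero_left[OF bb] bounded_bilinear.zero_right[OF bb]

lemma cA [continuous_intros]:
  "continuous_on T g \<Longrightarrow> continuous_on T h \<Longrightarrow> continuous_on T (\<lambda>z. A (g z) (h z))"
  using continuous_on_compose2[OF contA, of T "\<lambda>z. (g z, h z)"] by (auto intro: continuous_on_Pair)

lemma cK [continuous_intros]:
  "continuous_on T g \<Longrightarrow> continuous_on T h \<Longrightarrow> continuous_on T (\<lambda>z. K (g z) (h z))"
  using continuous_on_compose2[OF contK, of T "\<lambda>z. (g z, h z)"] by (auto intro: continuous_on_Pair)

lemma span_coords: "x \<in> span (f ` {..<q}) \<Longrightarrow> x = (\<Sum>i<q. B x (f i) *\<^sub>R f i)"
proof (induction rule: span_induct)
  case base
  show ?case
    by (auto simp: subspace_def B_simps scaleR_add_left sum.distrib simp flip: scaleR_scaleR scaleR_right.sum)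
next
  case (step x)
  then obtain j where j: "j < q" "x = f j" by auto
  have "(\<Sum>i<q. B (f j) (f i) *\<^sub>R f i) = (\<Sum>i<q. if i = j then f i else 0)"
    using j by (intro sum.cong) (auto simp: ortho)
  then show ?case using j by simp
qed

lemma B_coords: "x \<in> span (f ` {..<q}) \<Longrightarrow> B x y = (\<Sum>i<q. B x (f i) * B y (f i))"
proof -
  assume x: "x \<in> span (f ` {..<q})"
  have "B x y = B (\<Sum>i<q. B x (f i) *\<^sub>R f i) y" using span_coords[OF x] by simp
  also have "\<dots> = (\<Sum>i<q. B x (f i) * B (f i) y)"
    by (simp add: bounded_bilinear.sum_left[OF bb] B_simps)
  finally show ?thesis by (simp add: sym[of y])
qed

lemma S_coord: "x \<in> S \<Longrightarrow> (\<Sum>i<q. (B x (f i))\<^sup>2) = 1"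
  using B_coords[of x x] by (simp add: S_def power2_eq_square)

lemma S_coord_le: "x \<in> S \<Longrightarrow> i < q \<Longrightarrow> \<bar>B x (f i)\<bar> \<le> 1"
proof -
  assume "x \<in> S" "i < q"
  then have "(B x (f i))\<^sup>2 \<le> 1\<^sup>2"
    using member_le_sum[of i "{..<q}" "\<lambda>i. (B x (f i))\<^sup>2"] S_coord[of x] by auto
  then show ?thesis by (metis abs_le_square_iff abs_one)
qed

lemma compact_S: "compact S"
proof -
  have "closed S"
  proof -
    have "S = span (f ` {..<q}) \<inter> {x. B x x = 1}" by (auto simp: S_def)
    moreover have "closed {x. B x x = 1}" by (intro closed_Collect_eq continuous_intros)
    ultimately show ?thesis by (simp add: closed_Int closed_span)
  qed
  moreover have "norm x \<le> (\<Sum>i<q. norm (f i))" if x: "x \<in> S" for x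
  proof -
    have "norm x = norm (\<Sum>i<q. B x (f i) *\<^sub>R f i)" using span_coords[of x] x by (simp add: S_def)
    also have "\<dots> \<le> (\<Sum>i<q. norm (B x (f i) *\<^sub>R f i))" by (rule norm_sum)
    also have "\<dots> \<le> (\<Sum>i<q. 1 * norm (f i))"
      unfolding norm_scaleR using S_coord_le[OF x] by (intro sum_mono mult_right_mono) auto
    finally show ?thesis by simp
  qed
  ultimately show ?thesis by (auto simp: compact_eq_bounded_closed bounded_iff)
qed

lemma linA_range: "subspace (range (A x))"
  using linA linear_subspace_image subspace_UNIV by blast

section \<open>The compact space of unit vectors in the ranges\<close>

definition Y :: "('v \<times> 'v) set" where
  "Y = {z. fst z \<in> S \<and> snd z \<in> range (A (fst z)) \<and> norm (snd z) = 1}"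

definition X :: "('v \<times> 'v) set" where
  "X = {z. fst z \<in> S \<and> snd z \<in> range (A (fst z)) \<and> norm (snd z) = 1 \<and> B (snd z) (snd z) \<ge> 0}"

lemma compact_Y: "compact Y"
proof -
  have "Y = {z. fst z \<in> S \<and> snd z \<in> range (A (fst z))} \<inter> (S \<times> sphere 0 1)"
    by (auto simp: Y_def)
  moreover have "closed {z. fst z \<in> S \<and> snd z \<in> range (A (fst z))}"
    using compact_S linA contA dimA by (intro closed_graph_range) (auto simp: compact_imp_closed)
  ultimately show ?thesis
    by (simp add: closed_Int_compact compact_Times compact_S)
qed

lemma compact_X: "compact X"
proof -
  have "X = Y \<inter> {z. B (snd z) (snd z) \<ge> 0}" by (auto simp: X_def Y_def)
  moreover have "closed {z :: 'v \<times> 'v. B (snd z) (snd z) \<ge> 0}" by (intro closed_Collect_le continuous_intros)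
  ultimately show ?thesis using compact_Y by (simp add: compact_Int_closed)
qed

text \<open>The transpose of \<open>A x\<close> for the Euclidean inner product.\<close>

definition At :: "'v \<Rightarrow> 'v \<Rightarrow> 'v" where
  "At x w = (\<Sum>b\<in>Basis. (w \<bullet> A x b) *\<^sub>R b)"

definition G :: "'v \<Rightarrow> 'v" where
  "G u = (\<Sum>b\<in>Basis. B u b *\<^sub>R b)"

definition Lx :: "'v \<Rightarrow> 'v \<Rightarrow> 'v" where
  "Lx x w = A x (At x w)"

lemma At_inner: "At x w \<bullet> v = w \<bullet> A x v"
proof -
  have "A x v = (\<Sum>b\<in>Basis. (v \<bullet> b) *\<^sub>R A x b)"
    by (subst euclidean_representation[of v, symmetric]) (simp add: linear_sum[OF linA] linear_scale[OF linA])
  then show ?thesis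
    by (simp add: At_def inner_sum_left inner_sum_right inner_commute mult.commute)
qed

lemma G_inner: "G u \<bullet> v = B u v"
proof -
  have "B u v = B u (\<Sum>b\<in>Basis. (v \<bullet> b) *\<^sub>R b)" by (simp add: euclidean_representation)
  also have "\<dots> = (\<Sum>b\<in>Basis. (v \<bullet> b) * B u b)"
    by (simp add: bounded_bilinear.sum_right[OF bb] B_simps)
  also have "\<dots> = G u \<bullet> v"
    unfolding G_def inner_sum_left inner_scaleR_left by (simp add: inner_commute mult.commute)
  finally show ?thesis by simp
qed

lemma cAt [continuous_intros]:
  "continuous_on T g \<Longrightarrow> continuous_on T h \<Longrightarrow> continuous_on T (\<lambda>z. At (g z) (h z))"
  unfolding At_def by (intro continuous_intros)

lemma cG [continuous_intros]: "continuous_on T g \<Longrightarrow> continuous_on T (\<lambda>z. G (g z))"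
  unfolding G_def by (intro continuous_intros)

lemma cL [continuous_intros]:
  "continuous_on T g \<Longrightarrow> continuous_on T h \<Longrightarrow> continuous_on T (\<lambda>z. Lx (g z) (h z))"
  unfolding Lx_def by (intro continuous_intros)

lemma Lx_inner: "Lx x w \<bullet> w = (norm (At x w))\<^sup>2"
  unfolding Lx_def by (simp add: power2_norm_eq_inner At_inner inner_commute)

text \<open>Hence \<open>B u u\<close> grows along \<open>Lx x (G u)\<close>, a direction inside
  \<open>range (A x)\<close>, unless \<open>u\<close> is \<open>B\<close>-orthogonal to that
  range.\<close>

lemma B_L: "B (Lx x (G u)) u = (norm (At x (G u)))\<^sup>2"
  using Lx_inner[of x "G u"] G_inner[of u "Lx x (G u)"] sym[of u "Lx x (G u)"] by (simp add: inner_commute)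

lemma positive_lower_bound:
  fixes g :: "'v \<times> 'v \<Rightarrow> real"
  assumes "compact T" "continuous_on T g" "\<And>z. z \<in> T \<Longrightarrow> g z > 0"
  shows "\<exists>c>0. \<forall>z\<in>T. c \<le> g z"
proof (cases "T = {}")
  case False
  then obtain z where "z \<in> T" "\<forall>w\<in>T. g z \<le> g w"
    using continuous_attains_inf[OF assms(1) False assms(2)] by blast
  then show ?thesis using assms(3) by blast
qed (auto intro: exI[of _ 1])

lemma upper_bound:
  fixes g :: "'v \<times> 'v \<Rightarrow> real"
  assumes "compact T" "continuous_on T g"
  shows "\<exists>c>0. \<forall>z\<in>T. \<bar>g z\<bar> \<le> c"
proof -
  have "bounded (g ` T)" using assms by (intro compact_imp_bounded compact_continuous_image)
  then obtain b where "\<forall>y\<in>g ` T. norm y \<le> b" using bounded_iff by blast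
  then show ?thesis by (intro exI[of _ "max b 1"]) auto
qed

text \<open>Finitely many Landweber steps for \<open>A x\<close> give a map that depends continuously on \<open>x\<close> and
  substitutes for the orthogonal projection onto \<open>range (A x)\<close>.\<close>

lemma projection_like:
  assumes "\<beta> > 0"
  obtains h where "\<And>x w. h x w \<in> range (A x)" "\<And>x u. x \<in> S \<Longrightarrow> u \<in> range (A x) \<Longrightarrow> norm (h x u - u) \<le> \<beta> * norm u"
    "\<And>T g k. continuous_on T g \<Longrightarrow> continuous_on T k \<Longrightarrow> continuous_on (T :: ('v \<times> 'v \<times> 'v) set) (\<lambda>z. h (g z) (k z))"
proof -
  have "\<exists>c>0. \<forall>z\<in>S \<times> sphere 0 1. \<bar>norm (A (fst z) (snd z))\<bar> \<le> c"
    by (rule upper_bound) (auto intro!: continuous_intros compact_Times compact_S)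
  then obtain M where M: "M > 0" "\<And>z. z \<in> S \<times> sphere 0 1 \<Longrightarrow> \<bar>norm (A (fst z) (snd z))\<bar> \<le> M"
    by blast
  have AM: "norm (A x v) \<le> M * norm v" if "x \<in> S" for x v
  proof (cases "v = 0")
    case False
    have "norm (A x (sgn v)) \<le> M" using M(2)[of "(x, sgn v)"] that False by (simp add: norm_sgn)
    moreover have "A x (sgn v) = (1 / norm v) *\<^sub>R A x v"
      by (simp add: sgn_div_norm linear_scale[OF linA] divide_inverse)
    ultimately show ?thesis using False by (simp add: field_simps)
  qed (simp add: linear_0[OF linA])
  have Atpos: "norm (At (fst z) (snd z)) > 0" if zY: "z \<in> Y" for z
  proof -
    have "snd z \<in> range (A (fst z))" and nz: "norm (snd z) = 1" using zY by (auto simp: Y_def)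
    then obtain v where v: "snd z = A (fst z) v" "norm (snd z) = 1" by blast
    have "At (fst z) (snd z) \<noteq> 0"
    proof
      assume "At (fst z) (snd z) = 0"
      then have "snd z \<bullet> snd z = 0" using At_inner[of "fst z" "snd z" v] v by simp
      then show False using v(2) by simp
    qed
    then show ?thesis by simp
  qed
  have "\<exists>c>0. \<forall>z\<in>Y. c \<le> norm (At (fst z) (snd z))"
    by (rule positive_lower_bound[OF compact_Y]) (use Atpos in \<open>auto intro!: continuous_intros\<close>)
  then obtain a where a: "a > 0" "\<And>z. z \<in> Y \<Longrightarrow> a \<le> norm (At (fst z) (snd z))" by blast
  have Ata: "a * norm u \<le> norm (At x u)" if "x \<in> S" "u \<in> range (A x)" for x u
  proof (cases "u = 0")
    case False
    have "sgn u \<in> range (A x)" using that(2) linA_range[of x] by (simp add: sgn_div_norm subspace_scale)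
    then have "a \<le> norm (At x (sgn u))" using a(2)[of "(x, sgn u)"] that(1) False by (simp add: Y_def norm_sgn)
    moreover have "At x (sgn u) = (1 / norm u) *\<^sub>R At x u"
      by (simp add: At_def sgn_div_norm scaleR_right.sum divide_inverse)
    ultimately show ?thesis using False by (simp add: field_simps)
  qed simp
  \<comment> \<open>On \<open>S\<close>, \<open>M\<close> bounds the norm of \<open>A x\<close> from
    above and \<open>a\<close> its nonzero singular values from below. The step length
    \<open>1 / M\<^sup>2\<close> then makes \<open>R x\<close> a contraction of the range, with a
    factor independent of \<open>x\<close>.\<close>
  define R where "R = (\<lambda>x w. w - (1 / M\<^sup>2) *\<^sub>R Lx x w)"
  \<comment> \<open>If \<open>Y\<close> is empty, \<open>a\<close> is an arbitrary positive number
    that may exceed \<open>M\<close>; hence \<open>max 0\<close>.\<close>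
  define \<rho> where "\<rho> = sqrt (max 0 (1 - a\<^sup>2 / M\<^sup>2))"
  have \<rho>: "0 \<le> \<rho>" "\<rho> < 1" using a(1) M(1) by (auto simp: \<rho>_def max_def)
  have Rr: "R x u \<in> range (A x)" if "u \<in> range (A x)" for x u
  proof -
    have "Lx x u \<in> range (A x)" by (simp add: Lx_def)
    then show ?thesis unfolding R_def using that linA_range[of x] by (intro subspace_diff subspace_scale)
  qed
  have R1: "norm (R x u) \<le> \<rho> * norm u" if x: "x \<in> S" and u: "u \<in> range (A x)" for x u
  proof -
    have eq1: "(norm (R x u))\<^sup>2 = (norm u)\<^sup>2 - 2 * ((norm (At x u))\<^sup>2 / M\<^sup>2) + (norm (Lx x u))\<^sup>2 / M ^ 4"
    proof -
      have "(norm (R x u))\<^sup>2 = (norm u)\<^sup>2 - 2 * ((1 / M\<^sup>2) * (Lx x u \<bullet> u)) + (1 / M\<^sup>2)\<^sup>2 * (norm (Lx x u))\<^sup>2"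
        unfolding R_def power2_norm_eq_inner by (simp add: inner_simps inner_commute power2_eq_square algebra_simps)
      then show ?thesis unfolding Lx_inner by (simp add: power_divide)
    qed
    have "(norm (Lx x u))\<^sup>2 \<le> M\<^sup>2 * (norm (At x u))\<^sup>2"
      unfolding Lx_def using power_mono[OF AM[OF x, of "At x u"], of 2] by (simp add: power_mult_distrib)
    then have l3: "(norm (Lx x u))\<^sup>2 / M ^ 4 \<le> (norm (At x u))\<^sup>2 / M\<^sup>2"
      using M(1) by (simp add: field_simps power2_eq_square power4_eq_xxxx)
    have "(a * norm u)\<^sup>2 \<le> (norm (At x u))\<^sup>2"
      using Ata[OF x u] a(1) by (intro power_mono) auto
    then have l4: "(a\<^sup>2 / M\<^sup>2) * (norm u)\<^sup>2 \<le> (norm (At x u))\<^sup>2 / M\<^sup>2"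
      using M(1) by (simp add: divide_right_mono power_mult_distrib)
    have "(norm (R x u))\<^sup>2 \<le> (norm u)\<^sup>2 - (a\<^sup>2 / M\<^sup>2) * (norm u)\<^sup>2"
      using eq1 l3 l4 by linarith
    also have "\<dots> = (1 - a\<^sup>2 / M\<^sup>2) * (norm u)\<^sup>2" by (simp add: algebra_simps)
    also have "\<dots> \<le> \<rho>\<^sup>2 * (norm u)\<^sup>2" by (intro mult_right_mono) (auto simp: \<rho>_def)
    finally have "(norm (R x u))\<^sup>2 \<le> (\<rho> * norm u)\<^sup>2" unfolding power_mult_distrib .
    then show ?thesis by (rule power2_le_imp_le) (simp add: \<rho>(1))
  qed
  have Rk: "(R x ^^ k) u \<in> range (A x) \<and> norm ((R x ^^ k) u) \<le> \<rho> ^ k * norm u" if "x \<in> S" "u \<in> range (A x)" for x u k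
  proof (induction k)
    case (Suc k)
    have "norm (R x ((R x ^^ k) u)) \<le> \<rho> * norm ((R x ^^ k) u)" using R1 Suc that by blast
    also have "\<dots> \<le> \<rho> * (\<rho> ^ k * norm u)" using Suc \<rho> by (intro mult_left_mono) auto
    finally show ?case using Suc Rr by simp
  qed (use that in simp)
  obtain k where k: "\<rho> ^ k \<le> \<beta>"
    using real_arch_pow_inv[OF assms \<rho>(2)] less_imp_le by blast
  \<comment> \<open>The difference from \<open>w\<close> is a sum of values of \<open>Lx x\<close>,
    so \<open>h x w\<close> lies in the range for every \<open>w\<close>; on vectors of the range
    its error is the small remainder of the contraction.\<close>
  define h where "h = (\<lambda>x w. w - (R x ^^ k) w)"
  have "w - (R x ^^ n) w \<in> range (A x)" for x w n
  proof (induction n)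
    case (Suc n)
    have "w - (R x ^^ Suc n) w = (w - (R x ^^ n) w) + (1 / M\<^sup>2) *\<^sub>R Lx x ((R x ^^ n) w)"
      by (simp add: R_def)
    moreover have "Lx x ((R x ^^ n) w) \<in> range (A x)" by (simp add: Lx_def)
    ultimately show ?case using Suc linA_range[of x] by (metis subspace_add subspace_scale)
  qed (use linA_range[of x] subspace_0 in auto)
  then have h1: "h x w \<in> range (A x)" for x w by (simp add: h_def)
  have h2: "norm (h x u - u) \<le> \<beta> * norm u" if "x \<in> S" "u \<in> range (A x)" for x u
  proof -
    have "norm (h x u - u) = norm ((R x ^^ k) u)" by (simp add: h_def)
    also have "\<dots> \<le> \<rho> ^ k * norm u" using Rk that by blast
    also have "\<dots> \<le> \<beta> * norm u" using k by (intro mult_right_mono) auto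
    finally show ?thesis .
  qed
  have h3: "continuous_on T (\<lambda>z. h (g z) (m z))" if "continuous_on T g" "continuous_on T m" for T :: "('v \<times> 'v \<times> 'v) set" and g m
  proof -
    have "continuous_on T (\<lambda>z. (R (g z) ^^ n) (m z))" for n
    proof (induction n)
      case (Suc n)
      then show ?case using that unfolding R_def by (auto intro!: continuous_intros)
    qed (use that in simp)
    then show ?thesis unfolding h_def using that by (intro continuous_intros)
  qed
  show ?thesis by (rule that[OF h1 h2 h3])
qed

end

context cone_bundle
begin

section \<open>Transport between neighbouring fibres\<close>

lemma B_diff_bound:
  obtains b where "b > 0" "\<And>v w. \<bar>B w w - B v v\<bar> \<le> b * (norm w + norm v) * norm (w - v)"
proof -
  obtain b where b: "b > 0" "\<And>x y. norm (B x y) \<le> norm x * norm y * b"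
    using bounded_bilinear.pos_bounded[OF bb] by blast
  have "\<bar>B w w - B v v\<bar> \<le> b * (norm w + norm v) * norm (w - v)" for v w
  proof -
    have "B w w - B v v = B (w - v) w + B v (w - v)" by (simp add: B_simps)
    then have "\<bar>B w w - B v v\<bar> \<le> \<bar>B (w - v) w\<bar> + \<bar>B v (w - v)\<bar>" by linarith
    also have "\<dots> \<le> norm (w - v) * norm w * b + norm v * norm (w - v) * b"
      using b(2)[of "w - v" w] b(2)[of v "w - v"] by simp
    finally show ?thesis by (simp add: algebra_simps)
  qed
  then show ?thesis using b(1) that by blast
qed

text \<open>Unless all ranges are isotropic, \<open>u\<close> is first pushed into the interior of
  the cone over \<open>x\<close>, where \<open>B\<close> is at least \<open>b1 > 0\<close>. This
  leaves room for the error of the approximate projection to the range over \<open>x'\<close>;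
  finally the result is normalized.\<close>

lemma transport:
  assumes "\<delta> > 0"
  obtains \<eta> \<tau> where "\<eta> > 0"
    "\<And>x x' u. (x, u) \<in> X \<Longrightarrow> x' \<in> S \<Longrightarrow> dist x x' \<le> \<eta> \<Longrightarrow> (x', \<tau> x x' u) \<in> X \<and> dist u (\<tau> x x' u) \<le> \<delta>"
    "continuous_on {(x, x', u). (x, u) \<in> X \<and> x' \<in> S \<and> dist x x' \<le> \<eta>} (\<lambda>(x, x', u). \<tau> x x' u)"
proof -
  obtain bB where bB: "bB > 0" "\<And>v w. \<bar>B w w - B v v\<bar> \<le> bB * (norm w + norm v) * norm (w - v)"
    using B_diff_bound by blast
  define V where "V = (\<lambda>\<kappa> x u. u + \<kappa> *\<^sub>R Lx x (G u))"
  have VW: "V \<kappa> x u \<in> range (A x)" if "u \<in> range (A x)" for \<kappa> x u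
  proof -
    have "Lx x (G u) \<in> range (A x)" by (simp add: Lx_def)
    then show ?thesis unfolding V_def using that linA_range[of x] by (intro subspace_add subspace_scale)
  qed
  have "\<exists>c>0. \<forall>z\<in>X. \<bar>norm (Lx (fst z) (G (snd z)))\<bar> \<le> c"
    by (rule upper_bound[OF compact_X]) (intro continuous_intros)
  then obtain N1 where N1: "N1 > 0" "\<And>z. z \<in> X \<Longrightarrow> norm (Lx (fst z) (G (snd z))) \<le> N1" by auto
  define \<sigma> where "\<sigma> = min (\<delta> / 2) (1 / 2)"
  have \<sigma>: "\<sigma> > 0" "2 * \<sigma> \<le> \<delta>" "\<sigma> \<le> 1 / 2" using assms by (auto simp: \<sigma>_def)
  have "\<exists>\<kappa> b1. \<kappa> > 0 \<and> \<kappa> * N1 \<le> \<sigma> / 2 \<and> b1 > 0 \<and>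
      ((\<forall>x\<in>S. \<forall>u\<in>range (A x). B u u = 0) \<or> (\<forall>z\<in>X. B (V \<kappa> (fst z) (snd z)) (V \<kappa> (fst z) (snd z)) \<ge> b1))"
    using nullity
  proof
    assume "\<forall>x\<in>S. \<forall>u\<in>range (A x). B u u = 0"
    then show ?thesis using \<sigma>(1) N1(1) by (intro exI[of _ "\<sigma> / 2 / N1"] exI[of _ 1]) auto
  next
    assume nd: "\<forall>x\<in>S. \<forall>u\<in>range (A x). (\<forall>v. B u (A x v) = 0) \<longrightarrow> u = 0"
    have "norm (At (fst z) (G (snd z))) > 0" if z: "z \<in> X" for z
    proof -
      have "At (fst z) (G (snd z)) \<noteq> 0"
      proof
        assume "At (fst z) (G (snd z)) = 0"
        then have "B (snd z) (A (fst z) v) = 0" for v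
          using At_inner[of "fst z" "G (snd z)" v] by (simp add: G_inner)
        then have "snd z = 0" using nd z by (auto simp: X_def)
        then show False using z by (simp add: X_def)
      qed
      then show ?thesis by simp
    qed
    then have "\<exists>c>0. \<forall>z\<in>X. c \<le> norm (At (fst z) (G (snd z)))"
      by (intro positive_lower_bound[OF compact_X]) (auto intro!: continuous_intros)
    then obtain g where g: "g > 0" "\<And>z. z \<in> X \<Longrightarrow> g \<le> norm (At (fst z) (G (snd z)))" by blast
    have "\<exists>c>0. \<forall>z\<in>X. \<bar>B (Lx (fst z) (G (snd z))) (Lx (fst z) (G (snd z)))\<bar> \<le> c"
      by (rule upper_bound[OF compact_X]) (intro continuous_intros)
    then obtain N2 where N2: "N2 > 0" "\<And>z. z \<in> X \<Longrightarrow> \<bar>B (Lx (fst z) (G (snd z))) (Lx (fst z) (G (snd z)))\<bar> \<le> N2" by blast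
    \<comment> \<open>The first bound keeps the push below \<open>\<sigma> / 2\<close>. The second
      makes the quadratic term at worst \<open>- \<kappa> * g\<^sup>2\<close>, half of the linear
      gain \<open>2 * \<kappa> * g\<^sup>2\<close>.\<close>
    define \<kappa> where "\<kappa> = min (\<sigma> / 2 / N1) (g\<^sup>2 / N2)"
    have \<kappa>: "\<kappa> > 0" "\<kappa> * N1 \<le> \<sigma> / 2" "\<kappa> * N2 \<le> g\<^sup>2"
      using \<sigma>(1) N1(1) N2(1) g(1) by (auto simp: \<kappa>_def min_def field_simps)
    have "B (V \<kappa> (fst z) (snd z)) (V \<kappa> (fst z) (snd z)) \<ge> \<kappa> * g\<^sup>2" if z: "z \<in> X" for z
    proof -
      let ?l = "Lx (fst z) (G (snd z))"
      have "B (V \<kappa> (fst z) (snd z)) (V \<kappa> (fst z) (snd z)) = B (snd z) (snd z) + 2 * \<kappa> * B ?l (snd z) + \<kappa> * (\<kappa> * B ?l ?l)"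
        by (simp add: V_def B_simps sym[of "snd z" ?l] algebra_simps)
      moreover have "B ?l (snd z) \<ge> g\<^sup>2" unfolding B_L using g(2)[OF z] g(1) by (intro power_mono) auto
      then have "2 * \<kappa> * B ?l (snd z) \<ge> 2 * \<kappa> * g\<^sup>2" using \<kappa>(1) by (intro mult_left_mono) auto
      moreover have "\<kappa> * (\<kappa> * B ?l ?l) \<ge> \<kappa> * (- g\<^sup>2)"
      proof (intro mult_left_mono)
        have "\<bar>\<kappa> * B ?l ?l\<bar> \<le> \<kappa> * N2" using N2(2)[OF z] \<kappa>(1) by (simp add: abs_mult)
        then show "- g\<^sup>2 \<le> \<kappa> * B ?l ?l" using \<kappa>(3) by linarith
      qed (use \<kappa>(1) in simp)
      moreover have "B (snd z) (snd z) \<ge> 0" using z by (simp add: X_def)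
      ultimately show ?thesis by (simp add: algebra_simps)
    qed
    then show ?thesis using \<kappa> g(1) by (intro exI[of _ \<kappa>] exI[of _ "\<kappa> * g\<^sup>2"]) auto
  qed
  then obtain \<kappa> b1 where \<kappa>: "\<kappa> > 0" "\<kappa> * N1 \<le> \<sigma> / 2" "b1 > 0" and
    dich: "(\<forall>x\<in>S. \<forall>u\<in>range (A x). B u u = 0) \<or> (\<forall>z\<in>X. B (V \<kappa> (fst z) (snd z)) (V \<kappa> (fst z) (snd z)) \<ge> b1)"
    by blast
  \<comment> \<open>Below, \<open>norm ?w + norm ?v \<le> 4\<close> and
    \<open>norm (?w - ?v) \<le> 3 * \<beta>\<close>, so \<open>B\<close> changes by at most
    \<open>12 * bB * \<beta>\<close>, which does not exceed \<open>b1\<close>.\<close>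
  define \<beta> where "\<beta> = min (\<sigma> / 8) (b1 / (16 * bB))"
  have \<beta>: "\<beta> > 0" "\<beta> \<le> \<sigma> / 8" "bB * 4 * (3 * \<beta>) \<le> b1"
    using \<sigma>(1) \<kappa>(3) bB(1) by (auto simp: \<beta>_def min_def field_simps)
  obtain h where h: "\<And>x w. h x w \<in> range (A x)" "\<And>x u. x \<in> S \<Longrightarrow> u \<in> range (A x) \<Longrightarrow> norm (h x u - u) \<le> \<beta> * norm u"
    "\<And>T g k. continuous_on T g \<Longrightarrow> continuous_on T k \<Longrightarrow> continuous_on (T :: ('v \<times> 'v \<times> 'v) set) (\<lambda>z. h (g z) (k z))"
    using projection_like[OF \<beta>(1)] by blast
  define Hm where "Hm = (\<lambda>z :: 'v \<times> 'v \<times> 'v. h (fst z) (V \<kappa> (fst (snd z)) (snd (snd z))))"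
  have cH: "continuous_on T Hm" for T
    unfolding Hm_def V_def by (intro h(3) continuous_intros)
  have "uniformly_continuous_on (S \<times> X) Hm"
    by (intro compact_uniformly_continuous compact_Times compact_S compact_X cH)
  then obtain \<eta>0 where \<eta>0: "\<eta>0 > 0" "\<And>z w. z \<in> S \<times> X \<Longrightarrow> w \<in> S \<times> X \<Longrightarrow> dist w z < \<eta>0 \<Longrightarrow> dist (Hm w) (Hm z) < \<beta>"
    unfolding uniformly_continuous_on_def using \<beta>(1) by meson
  define \<eta> where "\<eta> = \<eta>0 / 2"
  have \<eta>: "\<eta> > 0" "\<eta> < \<eta>0" using \<eta>0(1) by (auto simp: \<eta>_def)
  define \<tau> where "\<tau> = (\<lambda>x x' u. sgn (Hm (x', x, u)))"
  have main: "(x', \<tau> x x' u) \<in> X \<and> dist u (\<tau> x x' u) \<le> \<delta> \<and> Hm (x', x, u) \<noteq> 0"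
    if xu: "(x, u) \<in> X" and x': "x' \<in> S" and d: "dist x x' \<le> \<eta>" for x x' u
  proof -
    let ?v = "V \<kappa> x u" and ?w = "Hm (x', x, u)"
    have x: "x \<in> S" "u \<in> range (A x)" "norm u = 1" using xu by (auto simp: X_def)
    have vu: "norm (?v - u) \<le> \<sigma> / 2"
    proof -
      have "norm (?v - u) = \<kappa> * norm (Lx x (G u))" using \<kappa>(1) by (simp add: V_def)
      also have "\<dots> \<le> \<kappa> * N1" using N1(2)[OF xu] \<kappa>(1) by (intro mult_left_mono) auto
      finally show ?thesis using \<kappa>(2) by linarith
    qed
    have v2: "norm ?v \<le> 2" using norm_triangle_ineq[of u "?v - u"] vu \<sigma>(3) x(3) by simp
    have "norm (Hm (x, x, u) - ?v) \<le> \<beta> * norm ?v"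
      unfolding Hm_def using h(2)[OF x(1) VW[OF x(2)]] by simp
    also have "\<dots> \<le> \<beta> * 2" using v2 \<beta>(1) by (intro mult_left_mono) auto
    finally have "norm (Hm (x, x, u) - ?v) \<le> 2 * \<beta>" by simp
    moreover have "dist ?w (Hm (x, x, u)) < \<beta>"
    proof (rule \<eta>0(2))
      have "dist (x', x, u) (x, x, u) = dist x' x" by (simp add: dist_Pair_Pair)
      then show "dist (x', x, u) (x, x, u) < \<eta>0" using d \<eta>(2) by (simp add: dist_commute)
    qed (use xu x' x in auto)
    ultimately have wv: "norm (?w - ?v) \<le> 3 * \<beta>"
      using norm_triangle_ineq[of "?w - Hm (x, x, u)" "Hm (x, x, u) - ?v"] by (simp add: dist_norm)
    then have wu: "norm (?w - u) \<le> \<sigma>"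
      using norm_triangle_ineq[of "?w - ?v" "?v - u"] vu \<beta>(2) \<sigma>(1) by simp
    then have w1: "norm ?w \<ge> 1 - \<sigma>" "norm ?w \<le> 1 + \<sigma>"
      using norm_triangle_ineq3[of ?w u] x(3) by linarith+
    then have nz: "?w \<noteq> 0" using \<sigma>(3) by auto
    have "?w - sgn ?w = (1 - 1 / norm ?w) *\<^sub>R ?w"
      by (simp add: sgn_div_norm scaleR_diff_left divide_inverse)
    then have "norm (?w - sgn ?w) = \<bar>1 - 1 / norm ?w\<bar> * norm ?w" by simp
    also have "\<dots> = \<bar>norm ?w - 1\<bar>"
      using nz by (simp add: abs_mult_pos left_diff_distrib)
    finally have "norm (?w - sgn ?w) \<le> \<sigma>" using w1 by linarith
    then have "norm (u - sgn ?w) \<le> 2 * \<sigma>"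
      using norm_triangle_ineq[of "u - ?w" "?w - sgn ?w"] wu by (simp add: norm_minus_commute)
    then have near: "dist u (\<tau> x x' u) \<le> \<delta>" using \<sigma>(2) by (simp add: \<tau>_def dist_norm)
    have wr: "?w \<in> range (A x')" unfolding Hm_def by (simp add: h(1))
    have Bw: "B ?w ?w \<ge> 0"
      using dich
    proof
      assume "\<forall>x\<in>S. \<forall>u\<in>range (A x). B u u = 0"
      then have "B ?w ?w = 0" using wr x' by blast
      then show ?thesis by simp
    next
      assume "\<forall>z\<in>X. B (V \<kappa> (fst z) (snd z)) (V \<kappa> (fst z) (snd z)) \<ge> b1"
      then have b: "B ?v ?v \<ge> b1" using xu by force
      have "\<bar>B ?w ?w - B ?v ?v\<bar> \<le> bB * (norm ?w + norm ?v) * norm (?w - ?v)" by (rule bB(2))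
      also have "\<dots> \<le> bB * 4 * (3 * \<beta>)"
        using wv v2 w1(2) \<sigma>(3) bB(1) by (intro mult_mono) auto
      finally show ?thesis using b \<beta>(3) by linarith
    qed
    have "B (sgn ?w) (sgn ?w) = (inverse (norm ?w))\<^sup>2 * B ?w ?w"
      by (simp add: sgn_div_norm B_simps power2_eq_square)
    then have "(x', \<tau> x x' u) \<in> X"
      unfolding X_def \<tau>_def using x' wr nz Bw linA_range[of x']
      by (simp add: norm_sgn) (simp add: sgn_div_norm subspace_scale)
    then show ?thesis using near nz by blast
  qed
  have cont: "continuous_on {(x, x', u). (x, u) \<in> X \<and> x' \<in> S \<and> dist x x' \<le> \<eta>} (\<lambda>(x, x', u). \<tau> x x' u)"
    unfolding \<tau>_def case_prod_unfold
  proof (rule continuous_on_sgn)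
    show "continuous_on {z. (fst z, snd (snd z)) \<in> X \<and> fst (snd z) \<in> S \<and> dist (fst z) (fst (snd z)) \<le> \<eta>}
       (\<lambda>z. Hm (fst (snd z), fst z, snd (snd z)))"
      by (rule continuous_on_compose2[OF cH[of UNIV]]) (auto intro!: continuous_intros)
    show "\<forall>z\<in>{z. (fst z, snd (snd z)) \<in> X \<and> fst (snd z) \<in> S \<and> dist (fst z) (fst (snd z)) \<le> \<eta>}.
       Hm (fst (snd z), fst z, snd (snd z)) \<noteq> 0"
      using main by blast
  qed
  show ?thesis by (rule that[OF \<eta>(1) _ cont]) (use main in blast)
qed

section \<open>The part of the space over a hemisphere\<close>

definition Ds :: "nat \<Rightarrow> ('v \<times> 'v) set" where
  "Ds s = {z \<in> X. (\<forall>i. s < i \<longrightarrow> i < q \<longrightarrow> B (fst z) (f i) = 0) \<and> B (fst z) (f s) \<ge> 0}"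

lemma compact_Ds: "compact (Ds s)"
proof -
  have "Ds s = X \<inter> ((\<Inter>i\<in>{i. s < i \<and> i < q}. {z. B (fst z) (f i) = 0}) \<inter> {z. B (fst z) (f s) \<ge> 0})"
    by (auto simp: Ds_def)
  moreover have "closed ((\<Inter>i\<in>{i. s < i \<and> i < q}. {z :: 'v \<times> 'v. B (fst z) (f i) = 0}) \<inter> {z :: 'v \<times> 'v. B (fst z) (f s) \<ge> 0})"
    by (intro closed_Int closed_INT ballI closed_Collect_eq closed_Collect_le continuous_intros)
  ultimately show ?thesis using compact_X by (simp add: compact_Int_closed)
qed

lemma f_in_S: "s < q \<Longrightarrow> f s \<in> S"
  by (auto simp: S_def ortho intro: span_base)

text \<open>\<open>pr u\<close> and \<open>u - pr u\<close> are orthogonal and the second is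
  negative, so shrinking it can only increase \<open>B\<close>. After normalization this retracts
  the cone to the unit sphere of \<open>P\<close>.\<close>

lemma sphere_like_fibre:
  assumes "x \<in> S"
  shows "sphere_like {u. (x, u) \<in> X} {u. (x, u) \<in> X} r"
proof -
  let ?F = "{u. (x, u) \<in> X}"
  obtain P pr where P: "subspace P" "dim P = r" "P \<subseteq> range (A x)" "linear pr" "\<And>u. u \<in> P \<Longrightarrow> pr u = u"
    and pr: "\<And>u. u \<in> range (A x) \<Longrightarrow> pr u \<in> P \<and> B (pr u) (pr u) \<ge> 0 \<and> B (pr u) (u - pr u) = 0 \<and>
         (u \<noteq> pr u \<longrightarrow> B (u - pr u) (u - pr u) < 0)"
    using split[OF assms] by blast
  have F: "u \<in> ?F \<longleftrightarrow> u \<in> range (A x) \<and> norm u = 1 \<and> B u u \<ge> 0" for u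
    using assms by (auto simp: X_def)
  define h where "h = (\<lambda>t u. pr u + (1 - t) *\<^sub>R (u - pr u))"
  have hr: "h t u \<in> range (A x)" if "u \<in> ?F" for t u
    unfolding h_def using that pr[of u] P(3) linA_range[of x] F by (intro subspace_add subspace_scale subspace_diff) auto
  have hnz: "h t u \<noteq> 0" if u: "u \<in> ?F" for t u
  proof
    assume "h t u = 0"
    then have "pr (h t u) = 0" using linear_0[OF P(4)] by simp
    moreover have "pr (pr u) = pr u" using pr[of u] P(5) u F by blast
    then have "pr (h t u) = pr u"
      unfolding h_def by (simp add: linear_add[OF P(4)] linear_scale[OF P(4)] linear_diff[OF P(4)])
    ultimately have "pr u = 0" by simp
    then show False using pr[of u] u F by (metis diff_zero norm_zero not_le zero_neq_one)
  qed
  have hB: "B (h t u) (h t u) \<ge> 0" if u: "u \<in> ?F" and t: "t \<in> {0..1}" for t u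
  proof -
    let ?p = "pr u" and ?m = "u - pr u"
    have p: "B ?p ?m = 0" "B ?m ?p = 0" using pr[of u] u F sym[of ?m ?p] by auto
    have "B ?m ?m \<le> 0"
      using pr[of u] u F by (cases "u = pr u") (auto simp: B_simps)
    moreover have "(1 - t)\<^sup>2 \<le> 1" using t by (intro power_le_one) auto
    ultimately have "(1 - t)\<^sup>2 * B ?m ?m \<ge> 1 * B ?m ?m" by (intro mult_right_mono_neg)
    moreover have "B (h t u) (h t u) = B ?p ?p + (1 - t)\<^sup>2 * B ?m ?m"
      unfolding h_def by (simp add: bounded_bilinear.add_left[OF bb] bounded_bilinear.add_right[OF bb]
          bounded_bilinear.scaleR_left[OF bb] bounded_bilinear.scaleR_right[OF bb] p power2_eq_square)
    moreover have "B u u = B ?p ?p + B ?m ?m"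
    proof -
      have "B u u = B (?p + ?m) (?p + ?m)" by simp
      also have "\<dots> = B ?p ?p + B ?m ?m"
        by (simp only: bounded_bilinear.add_left[OF bb] bounded_bilinear.add_right[OF bb] p add_0_left add_0_right)
      finally show ?thesis .
    qed
    moreover have "B u u \<ge> 0" using u F by blast
    ultimately show ?thesis by linarith
  qed
  have sgnF: "sgn w \<in> ?F" if "w \<in> range (A x)" "w \<noteq> 0" "B w w \<ge> 0" for w
  proof -
    have "B (sgn w) (sgn w) = (inverse (norm w))\<^sup>2 * B w w"
      by (simp add: sgn_div_norm B_simps power2_eq_square)
    then show ?thesis
      unfolding F using that linA_range[of x] by (simp add: norm_sgn) (simp add: sgn_div_norm subspace_scale)
  qed
  have cpr: "continuous_on T pr" for T using P(4) by (simp add: linear_continuous_on linear_conv_bounded_linear)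
  have cF: "compact ?F"
  proof -
    have "?F = snd ` (X \<inter> {z. fst z = x})" by force
    moreover have "compact (X \<inter> {z. fst z = x})"
      by (intro compact_Int_closed compact_X closed_Collect_eq continuous_intros)
    then have "compact (snd ` (X \<inter> {z. fst z = x}))"
      by (intro compact_continuous_image continuous_on_snd continuous_on_id)
    ultimately show ?thesis by simp
  qed
  have "deforms_into ?F ?F (usph P)"
  proof (rule deforms_into_homotopy[where h = "\<lambda>t u. sgn (h t u)"])
    show "continuous_on ({0..1} \<times> ?F) (\<lambda>(t, z). sgn (h t z))"
      unfolding case_prod_unfold
    proof (rule continuous_on_sgn)
      show "continuous_on ({0..1} \<times> ?F) (\<lambda>z. h (fst z) (snd z))"
        unfolding h_def by (intro continuous_intros continuous_on_compose2[OF cpr[of UNIV]]) auto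
    qed (use hnz in auto)
    show "sgn (h 0 z) = z" if "z \<in> ?F" for z
      using that F by (simp add: h_def sgn_div_norm)
    show "sgn (h 1 z) \<in> usph P" if z: "z \<in> ?F" for z
    proof -
      have "h 1 z \<in> P" unfolding h_def using pr[of z] z F by simp
      then show ?thesis using hnz[OF z, of 1] P(1) by (simp add: usph_def norm_sgn) (simp add: sgn_div_norm subspace_scale)
    qed
    show "sgn (h t z) \<in> ?F" if "t \<in> {0..1}" "z \<in> ?F" for t z
      by (intro sgnF hr hnz hB that)
  qed (rule cF)
  moreover have "usph P \<subseteq> ?F"
  proof
    fix u assume "u \<in> usph P"
    then have "u \<in> P" "norm u = 1" "u \<in> range (A x)" using P(3) by (auto simp: usph_def)
    then show "u \<in> ?F" unfolding F using pr[of u] P(5)[of u] by simp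
  qed
  ultimately show ?thesis
    using sphere_like_deform sphere_like_mono sphere_like_usph[OF P(1)] P(2) by blast
qed

text \<open>The hemisphere contracts along normalized segments to its pole \<open>f s\<close>.
  Transport lifts the contraction step by step and so deforms everything above the hemisphere into
  the fibre over the pole.\<close>

lemma sphere_like_Ds:
  assumes s: "s < q"
  shows "sphere_like (Ds s) (Ds s) r"
proof -
  define N where "N = {z \<in> X. fst z = f s}"
  have "sphere_like N N r"
  proof (rule sphere_like_homeo[OF sphere_like_fibre[OF f_in_S[OF s]]])
    show "uniformly_continuous_on {u. (f s, u) \<in> X} (\<lambda>u. (f s, u))"
      unfolding uniformly_continuous_on_def by (auto simp: dist_Pair_Pair)
    show "uniformly_continuous_on N snd"
      unfolding uniformly_continuous_on_def by (meson dist_snd_le le_less_trans)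
  qed (auto simp: N_def)
  moreover have "N \<subseteq> Ds s" using s by (auto simp: N_def Ds_def ortho)
  ultimately have lN: "sphere_like N (Ds s) r" by (rule sphere_like_mono)
  define g where "g = (\<lambda>t x. (1 - t) *\<^sub>R x + t *\<^sub>R f s)"
  define \<psi> where "\<psi> = (\<lambda>t x. (1 / sqrt (B (g t x) (g t x))) *\<^sub>R g t x)"
  define E where "E = {x \<in> S. (\<forall>i. s < i \<longrightarrow> i < q \<longrightarrow> B x (f i) = 0) \<and> B x (f s) \<ge> 0}"
  have DE: "z \<in> Ds s \<longleftrightarrow> z \<in> X \<and> fst z \<in> E" for z by (auto simp: Ds_def E_def X_def)
  have cE: "compact E"
  proof -
    have "E = S \<inter> ((\<Inter>i\<in>{i. s < i \<and> i < q}. {z. B z (f i) = 0}) \<inter> {z. B z (f s) \<ge> 0})"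
      by (auto simp: E_def)
    moreover have "closed ((\<Inter>i\<in>{i. s < i \<and> i < q}. {z. B z (f i) = 0}) \<inter> {z. B z (f s) \<ge> 0})"
      by (intro closed_Int closed_INT ballI closed_Collect_eq closed_Collect_le continuous_intros)
    ultimately show ?thesis using compact_S by (simp add: compact_Int_closed)
  qed
  have gB: "B (g t x) (g t x) > 0" if x: "x \<in> E" and t: "t \<in> {0..1}" for t x
  proof -
    have "B (g t x) (g t x) = (1 - t)\<^sup>2 * B x x + t\<^sup>2 * B (f s) (f s) + 2 * (t * (1 - t)) * B x (f s)"
      by (simp add: g_def B_simps sym[of "f s" x] power2_eq_square algebra_simps)
    also have "\<dots> = (1 - t)\<^sup>2 + t\<^sup>2 + 2 * (t * (1 - t)) * B x (f s)"
      using x s by (simp add: E_def S_def ortho)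
    finally have "B (g t x) (g t x) = (1 - t)\<^sup>2 + t\<^sup>2 + 2 * (t * (1 - t)) * B x (f s)" .
    moreover have "2 * (t * (1 - t)) * B x (f s) \<ge> 0" using x t by (auto simp: E_def)
    moreover have "(1 - t)\<^sup>2 + t\<^sup>2 > 0" by (simp add: sum_power2_gt_zero_iff)
    ultimately show ?thesis by linarith
  qed
  have \<psi>E: "\<psi> t x \<in> E" if x: "x \<in> E" and t: "t \<in> {0..1}" for t x
  proof -
    have "g t x \<in> span (f ` {..<q})"
      using x s unfolding g_def by (intro span_add span_scale) (auto simp: E_def S_def intro: span_base)
    then have "\<psi> t x \<in> span (f ` {..<q})" by (simp add: \<psi>_def span_scale)
    moreover have "B (\<psi> t x) (\<psi> t x) = 1"
      using gB[OF x t] by (simp add: \<psi>_def B_simps field_simps)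
    moreover have "B (\<psi> t x) (f i) = 0" if "s < i" "i < q" for i
      using x that s by (simp add: \<psi>_def g_def B_simps E_def ortho)
    moreover have "B (\<psi> t x) (f s) \<ge> 0"
      using x s t gB[OF x t] by (simp add: \<psi>_def g_def B_simps E_def ortho)
    ultimately show ?thesis by (auto simp: E_def S_def)
  qed
  have \<psi>0: "\<psi> 0 x = x" if "x \<in> E" for x using that by (simp add: \<psi>_def g_def E_def S_def)
  have \<psi>1: "\<psi> 1 x = f s" for x using s by (simp add: \<psi>_def g_def ortho)
  have c\<psi>: "continuous_on ({0..1} \<times> E) (\<lambda>z. \<psi> (fst z) (snd z))"
  proof -
    have "continuous_on ({0..1} \<times> E) (\<lambda>z. g (fst z) (snd z))" unfolding g_def by (intro continuous_intros)
    then show ?thesis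
      unfolding \<psi>_def using gB by (intro continuous_intros) force+
  qed
  have "deforms_into (Ds s) (Ds s) N"
    unfolding deforms_into_def
  proof (intro allI impI)
    fix d :: real assume "d > 0"
    then obtain \<eta> \<tau> where \<eta>: "\<eta> > 0"
      and \<tau>: "\<And>x x' u. (x, u) \<in> X \<Longrightarrow> x' \<in> S \<Longrightarrow> dist x x' \<le> \<eta> \<Longrightarrow> (x', \<tau> x x' u) \<in> X \<and> dist u (\<tau> x x' u) \<le> d / 2"
      and c\<tau>: "continuous_on {(x, x', u). (x, u) \<in> X \<and> x' \<in> S \<and> dist x x' \<le> \<eta>} (\<lambda>(x, x', u). \<tau> x x' u)"
      using transport[of "d / 2"] half_gt_zero by blast
    define m where "m = min \<eta> (d / 2)"
    have m: "m > 0" "m \<le> \<eta>" "m \<le> d / 2" using \<eta> \<open>d > 0\<close> by (auto simp: m_def)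
    have "uniformly_continuous_on ({0..1} \<times> E) (\<lambda>z. \<psi> (fst z) (snd z))"
      by (intro compact_uniformly_continuous c\<psi> compact_Times cE compact_Icc)
    then obtain e0 where e0: "e0 > 0" "\<And>t t' x. t \<in> {0..1} \<Longrightarrow> t' \<in> {0..1} \<Longrightarrow> x \<in> E \<Longrightarrow> dist t t' < e0 \<Longrightarrow> dist (\<psi> t x) (\<psi> t' x) < m"
      unfolding uniformly_continuous_on_def using m(1) by (fastforce simp: dist_Pair_Pair)
    obtain n0 :: nat where n0: "1 / real (Suc n0) < e0" using nat_approx_posE[OF e0(1)] by blast
    define n where "n = Suc n0"
    have n: "n > 0" "1 / real n < e0" using n0 by (auto simp: n_def)
    define T where "T = (\<lambda>i. real i / real n)"
    have T: "T i \<in> {0..1}" if "i \<le> n" for i using that n(1) by (auto simp: T_def field_simps)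
    have TT: "dist (T i) (T (Suc i)) < e0" for i
      using n by (simp add: T_def dist_real_def diff_divide_distrib[symmetric])
    \<comment> \<open>The base point follows \<open>\<psi>\<close> and the vector is transported
      once per step; only the last step counts for \<open>dist (F i z) (F (Suc i) z)\<close>, so the
      accumulated drift is harmless.\<close>
    define F where "F = rec_nat (\<lambda>z. z) (\<lambda>i G z. (\<psi> (T (Suc i)) (fst z), \<tau> (\<psi> (T i) (fst z)) (\<psi> (T (Suc i)) (fst z)) (snd (G z))))"
    have F0: "F 0 = (\<lambda>z. z)" by (simp add: F_def)
    have FS: "F (Suc i) = (\<lambda>z. (\<psi> (T (Suc i)) (fst z), \<tau> (\<psi> (T i) (fst z)) (\<psi> (T (Suc i)) (fst z)) (snd (F i z))))" for i
      by (simp add: F_def)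
    have near: "dist (\<psi> (T i) x) (\<psi> (T (Suc i)) x) < m" if "Suc i \<le> n" "x \<in> E" for i x
      using e0(2)[OF T T that(2) TT] that(1) by simp
    have Ffst: "fst (F i z) = \<psi> (T i) (fst z)" if "z \<in> Ds s" for i z
      using that \<psi>0 by (cases i) (auto simp: F0 FS T_def DE)
    have FD: "F i z \<in> Ds s" if z: "z \<in> Ds s" and i: "i \<le> n" for i z
      using i
    proof (induction i)
      case (Suc i)
      have zE: "fst z \<in> E" using z DE by blast
      have "(\<psi> (T i) (fst z), snd (F i z)) \<in> X"
        using Suc DE Ffst[OF z, of i] by (metis Suc_leD prod.collapse)
      moreover have E': "\<psi> (T (Suc i)) (fst z) \<in> E" using \<psi>E[OF zE T[OF Suc.prems]] .
      moreover have "dist (\<psi> (T i) (fst z)) (\<psi> (T (Suc i)) (fst z)) \<le> \<eta>"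
        using near[OF Suc.prems zE] m(2) by linarith
      ultimately have "F (Suc i) z \<in> X" unfolding FS using \<tau> by (auto simp: E_def)
      then show ?case using E' by (simp add: DE FS)
    qed (use z in \<open>simp add: F0\<close>)
    have cF: "continuous_on (Ds s) (F i)" if "i \<le> n" for i
      using that
    proof (induction i)
      case (Suc i)
      have c1: "continuous_on (Ds s) (\<lambda>z. \<psi> (T j) (fst z))" if "j \<le> n" for j
        by (rule continuous_on_compose2[OF c\<psi>, of "Ds s" "\<lambda>z. (T j, fst z)", simplified])
          (use T[OF that] DE in \<open>auto intro!: continuous_intros\<close>)
      have "continuous_on (Ds s) (\<lambda>z. (\<lambda>(x, x', u). \<tau> x x' u) (\<psi> (T i) (fst z), \<psi> (T (Suc i)) (fst z), snd (F i z)))"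
      proof (rule continuous_on_compose2[OF c\<tau>])
        show "continuous_on (Ds s) (\<lambda>z. (\<psi> (T i) (fst z), \<psi> (T (Suc i)) (fst z), snd (F i z)))"
          using Suc c1[of i] c1[of "Suc i"] by (intro continuous_on_Pair continuous_on_snd) auto
        show "(\<lambda>z. (\<psi> (T i) (fst z), \<psi> (T (Suc i)) (fst z), snd (F i z))) ` Ds s \<subseteq> {(x, x', u). (x, u) \<in> X \<and> x' \<in> S \<and> dist x x' \<le> \<eta>}"
        proof (clarsimp)
          fix a b assume z: "(a, b) \<in> Ds s"
          then have zE: "a \<in> E" using DE by auto
          have "F i (a, b) \<in> X" using FD[OF z] Suc.prems DE by auto
          then have "(\<psi> (T i) a, snd (F i (a, b))) \<in> X"
            using Ffst[OF z, of i] by (metis fst_conv prod.collapse)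
          moreover have "\<psi> (T (Suc i)) a \<in> S" using \<psi>E[OF zE T[OF Suc.prems]] by (simp add: E_def)
          moreover have "dist (\<psi> (T i) a) (\<psi> (T (Suc i)) a) \<le> \<eta>"
            using near[OF Suc.prems zE] m(2) by linarith
          ultimately show "(\<psi> (T i) a, snd (F i (a, b))) \<in> X \<and> \<psi> (T (Suc i)) a \<in> S \<and> dist (\<psi> (T i) a) (\<psi> (T (Suc i)) a) \<le> \<eta>"
            by blast
        qed
      qed
      then show ?case unfolding FS using c1[OF Suc.prems] by (intro continuous_on_Pair) auto
    qed (simp add: F0)
    have "dist (F i z) (F (Suc i) z) \<le> d" if i: "i < n" and z: "z \<in> Ds s" for i z
    proof -
      have zE: "fst z \<in> E" using z DE by blast
      have iX: "(\<psi> (T i) (fst z), snd (F i z)) \<in> X"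
        using FD[OF z, of i] i DE Ffst[OF z, of i] by (metis less_imp_le prod.collapse)
      have nr: "dist (\<psi> (T i) (fst z)) (\<psi> (T (Suc i)) (fst z)) < m" using near[of i "fst z"] i zE by simp
      have E': "\<psi> (T (Suc i)) (fst z) \<in> S" using \<psi>E[OF zE T, of "Suc i"] i by (simp add: E_def)
      have "dist (snd (F i z)) (snd (F (Suc i) z)) \<le> d / 2"
        unfolding FS using \<tau>[OF iX E'] nr m(2) by auto
      moreover have "dist (fst (F i z)) (fst (F (Suc i) z)) \<le> d / 2"
        unfolding FS using Ffst[OF z, of i] nr m(3) by simp
      moreover have "dist (F i z) (F (Suc i) z) \<le> dist (fst (F i z)) (fst (F (Suc i) z)) + dist (snd (F i z)) (snd (F (Suc i) z))"
        unfolding dist_prod_def by (intro sqrt_sum_squares_le_sum) auto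
      ultimately show ?thesis by linarith
    qed
    moreover have "F n z \<in> N" if "z \<in> Ds s" for z
      using FD[OF that order_refl] Ffst[OF that, of n] \<psi>1 n(1) by (simp add: N_def DE T_def)
    moreover have "uniformly_continuous_on (Ds s) (F i)" if "i \<le> n" for i
      using cF[OF that] compact_Ds by (rule compact_uniformly_continuous)
    ultimately show "\<exists>(n::nat) f. (\<forall>z\<in>Ds s. f 0 z = z \<and> f n z \<in> N) \<and>
       (\<forall>i\<le>n. (\<forall>z\<in>Ds s. f i z \<in> Ds s) \<and> uniformly_continuous_on (Ds s) (f i)) \<and>
       (\<forall>i<n. \<forall>z\<in>Ds s. dist (f i z) (f (Suc i) z) \<le> d)"
      using FD F0 by (intro exI[of _ n] exI[of _ F]) auto
  qed
  then show ?thesis using lN by (rule sphere_like_deform)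
qed

section \<open>Coordinates that realize the double involution\<close>

lemma sum_large_term:
  fixes a :: "nat \<Rightarrow> real"
  assumes "c \<le> (\<Sum>i<n. a i)" "c > 0"
  shows "\<exists>i<n. c / real (Suc n) \<le> a i"
proof (rule ccontr)
  assume "\<not> ?thesis"
  then have "(\<Sum>i<n. a i) \<le> (\<Sum>i<n. c / real (Suc n))" by (intro sum_mono) (auto simp: not_le intro: less_imp_le)
  also have "\<dots> = c * (real n / real (Suc n))" by simp
  also have "\<dots> < c * 1" using assms(2) by (intro mult_strict_left_mono) auto
  finally show False using assms(1) by simp
qed

theorem inconsistent: False
proof -
  \<comment> \<open>Cut off at \<open>q\<close> because the bounds by \<open>b0\<close> are demanded
    for every index.\<close>
  define xi where "xi = (\<lambda>(z :: 'v \<times> 'v) i. if i < q then B (fst z) (f i) else 0)"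
  define nu where "nu = (\<lambda>(z :: 'v \<times> 'v) i. if i < q then B (snd z) (f i) else 0)"
  define om where "om = (\<lambda>(z :: 'v \<times> 'v) i. B (K (fst z) (snd z)) (e i))"
  have c_xi: "continuous_on X (\<lambda>z. xi z i)" for i
    unfolding xi_def by (cases "i < q") (auto intro!: continuous_intros)
  have c_nu: "continuous_on X (\<lambda>z. nu z i)" for i
    unfolding nu_def by (cases "i < q") (auto intro!: continuous_intros)
  have c_om: "continuous_on X (\<lambda>z. om z i)" for i
    unfolding om_def by (intro continuous_intros)
  have "(\<Sum>i<p. \<bar>om z i\<bar>) > 0" if z: "z \<in> X" for z
  proof -
    have "snd z \<noteq> 0" using z by (auto simp: X_def)
    then have "K (fst z) (snd z) \<noteq> 0" "B (K (fst z) (snd z)) (K (fst z) (snd z)) \<le> 0"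
      using KA[of "fst z" "snd z"] z by (auto simp: X_def)
    then obtain i where i: "i < p" "om z i \<noteq> 0" using minus unfolding om_def by blast
    have "\<bar>om z i\<bar> \<le> (\<Sum>i<p. \<bar>om z i\<bar>)" using i by (intro member_le_sum) auto
    then show ?thesis using i by linarith
  qed
  then have "\<exists>c>0. \<forall>z\<in>X. c \<le> (\<Sum>i<p. \<bar>om z i\<bar>)"
    by (intro positive_lower_bound[OF compact_X] continuous_intros c_om)
  then obtain c1 where c1: "c1 > 0" "\<And>z. z \<in> X \<Longrightarrow> c1 \<le> (\<Sum>i<p. \<bar>om z i\<bar>)" by blast
  have "(\<Sum>i<q. (nu z i)\<^sup>2) > 0" if z: "z \<in> X" for z
  proof -
    have "snd z \<noteq> 0" "B (snd z) (snd z) \<ge> 0" using z by (auto simp: X_def)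
    then obtain i where i: "i < q" "nu z i \<noteq> 0" using plus unfolding nu_def by force
    have "(nu z i)\<^sup>2 \<le> (\<Sum>i<q. (nu z i)\<^sup>2)" using i by (intro member_le_sum) auto
    moreover have "(nu z i)\<^sup>2 > 0" using i by simp
    ultimately show ?thesis by linarith
  qed
  then have "\<exists>c>0. \<forall>z\<in>X. c \<le> (\<Sum>i<q. (nu z i)\<^sup>2)"
    by (intro positive_lower_bound[OF compact_X] continuous_intros c_nu)
  then obtain c2 where c2: "c2 > 0" "\<And>z. z \<in> X \<Longrightarrow> c2 \<le> (\<Sum>i<q. (nu z i)\<^sup>2)" by blast
  \<comment> \<open>\<open>2 * c3\<close> bounds both squared norms from below, and
    \<open>(1 - t)\<^sup>2 + t\<^sup>2 \<ge> 1/2\<close> accounts for the remaining factor.\<close>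
  define c3 where "c3 = min 1 c2 / 2"
  have c3: "c3 > 0" "2 * c3 \<le> 1" "2 * c3 \<le> c2" using c2(1) by (auto simp: c3_def)
  \<comment> \<open>As \<open>x\<close> lies in the span of the \<open>f i\<close>, the Euclidean
    product of the two coordinate vectors is \<open>B x u = 0\<close>. By Pythagoras the segment
    between them misses the origin.\<close>
  have xn: "c3 \<le> (\<Sum>i<q. ((1 - t) * xi z i + t * nu z i)\<^sup>2)" if z: "z \<in> X" for z t
  proof -
    have x: "fst z \<in> S" using z by (simp add: X_def)
    then have xs: "fst z \<in> span (f ` {..<q})" by (simp add: S_def)
    have "(\<Sum>i<q. xi z i * nu z i) = B (fst z) (snd z)"
      unfolding B_coords[OF xs, of "snd z"] by (intro sum.cong) (auto simp: xi_def nu_def)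
    also have "\<dots> = 0" using z perp by (auto simp: X_def)
    finally have 0: "(\<Sum>i<q. xi z i * nu z i) = 0" .
    have 1: "(\<Sum>i<q. (xi z i)\<^sup>2) = 1"
      using S_coord[OF x] by (simp add: xi_def)
    have "(\<Sum>i<q. ((1 - t) * xi z i + t * nu z i)\<^sup>2)
        = (\<Sum>i<q. (1 - t)\<^sup>2 * (xi z i)\<^sup>2 + t\<^sup>2 * (nu z i)\<^sup>2 + (2 * t * (1 - t)) * (xi z i * nu z i))"
      by (intro sum.cong) (auto simp: power2_eq_square algebra_simps)
    also have "\<dots> = (1 - t)\<^sup>2 + t\<^sup>2 * (\<Sum>i<q. (nu z i)\<^sup>2)"
      unfolding sum.distrib sum_distrib_left[symmetric] by (simp add: 0 1)
    also have "\<dots> \<ge> (1 - t)\<^sup>2 * (2 * c3) + t\<^sup>2 * (2 * c3)"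
      using c2(2)[OF z] c3 by (intro add_mono mult_left_mono) (auto simp: mult_left_le)
    finally have "(\<Sum>i<q. ((1 - t) * xi z i + t * nu z i)\<^sup>2) \<ge> c3 * (2 * ((1 - t)\<^sup>2 + t\<^sup>2))"
      by (simp add: algebra_simps)
    moreover have "2 * ((1 - t)\<^sup>2 + t\<^sup>2) = 1 + (1 - 2 * t)\<^sup>2" by (simp add: power2_eq_square algebra_simps)
    then have "c3 * (2 * ((1 - t)\<^sup>2 + t\<^sup>2)) \<ge> c3 * 1" using c3(1) by (intro mult_left_mono) auto
    ultimately show ?thesis by linarith
  qed
  have "\<exists>b>0. \<forall>z\<in>X. \<bar>\<Sum>i<q. \<bar>xi z i\<bar> + \<bar>nu z i\<bar>\<bar> \<le> b"
    by (rule upper_bound[OF compact_X]) (intro continuous_intros c_xi c_nu)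
  then obtain b0 where b0: "b0 > 0" "\<And>z. z \<in> X \<Longrightarrow> \<bar>\<Sum>i<q. \<bar>xi z i\<bar> + \<bar>nu z i\<bar>\<bar> \<le> b0" by blast
  have bd0: "\<bar>xi z i\<bar> \<le> b0 \<and> \<bar>nu z i\<bar> \<le> b0" if z: "z \<in> X" for z i
  proof (cases "i < q")
    case True
    then have "\<bar>xi z i\<bar> + \<bar>nu z i\<bar> \<le> (\<Sum>i<q. \<bar>xi z i\<bar> + \<bar>nu z i\<bar>)"
      using member_le_sum[of i "{..<q}" "\<lambda>i. \<bar>xi z i\<bar> + \<bar>nu z i\<bar>"] by auto
    then show ?thesis using b0(2)[OF z] by linarith
  qed (use b0(1) in \<open>auto simp: xi_def nu_def\<close>)
  define c0 where "c0 = min (c1 / real (Suc p)) (sqrt (c3 / real (Suc q)))"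
  have c0: "c0 > 0" "c0 \<le> c1 / real (Suc p)" "c0 \<le> sqrt (c3 / real (Suc q))"
    using c1(1) c3(1) by (auto simp: c0_def)
  interpret double_involution X "\<lambda>z. (- fst z, snd z)" "\<lambda>z. (fst z, - snd z)" p q r xi nu om c0 b0
  proof
    have Sm: "- x \<in> S" if "x \<in> S" for x using that by (simp add: S_def B_simps span_neg)
    fix z w :: "'v \<times> 'v" and i :: nat and t :: real
    show "(- fst z, snd z) \<in> X" if "z \<in> X" using that Sm by (auto simp: X_def evenA)
    show "(fst z, - snd z) \<in> X" if "z \<in> X"
      using that linA_range[of "fst z"] by (auto simp: X_def B_simps subspace_neg)
    show "dist (- fst z, snd z) (- fst w, snd w) = dist z w" "dist (fst z, - snd z) (fst w, - snd w) = dist z w"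
      by (simp_all add: dist_prod_def dist_minus)
    show "om (fst z, - snd z) i = - om z i" by (simp add: om_def linear_neg[OF linK] B_simps)
    show "uniformly_continuous_on X (\<lambda>z. xi z i)" "uniformly_continuous_on X (\<lambda>z. nu z i)" "uniformly_continuous_on X (\<lambda>z. om z i)"
      by (intro compact_uniformly_continuous compact_X c_xi c_nu c_om)+
    show "\<exists>i<p. c0 \<le> \<bar>om z i\<bar>" if "z \<in> X"
      using sum_large_term[OF c1(2)[OF that] c1(1)] c0(2) by (meson order_trans)
    show "\<exists>i<q. c0 \<le> \<bar>(1 - t) * xi z i + t * nu z i\<bar>" if z: "z \<in> X"
    proof -
      obtain i where i: "i < q" "c3 / real (Suc q) \<le> ((1 - t) * xi z i + t * nu z i)\<^sup>2"
        using sum_large_term[OF xn[OF z] c3(1)] by blast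
      then have "sqrt (c3 / real (Suc q)) \<le> \<bar>(1 - t) * xi z i + t * nu z i\<bar>"
        using real_sqrt_le_mono[OF i(2)] by simp
      then show ?thesis using i(1) c0(3) by (meson order_trans)
    qed
    show "\<bar>xi z i\<bar> \<le> b0" "\<bar>nu z i\<bar> \<le> b0" if "z \<in> X" using bd0[OF that] by auto
  qed (auto simp: xi_def nu_def om_def B_simps evenK c0 pq r0)
  have DD: "D s = Ds s" if "s < q" for s
    unfolding D_def Ds_def using that by (auto simp: xi_def)
  have q0: "0 < q" using pq by simp
  obtain P where P: "subspace P" "dim P = r" "P \<subseteq> range (A (f 0))"
    and Pp: "\<And>u. u \<in> P \<Longrightarrow> B u u \<ge> 0"
  proof -
    obtain P pr where PP: "subspace P" "dim P = r" "P \<subseteq> range (A (f 0))" and pr: "\<forall>u\<in>P. pr u = u"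
      "\<forall>u\<in>range (A (f 0)). pr u \<in> P \<and> B (pr u) (pr u) \<ge> 0 \<and> B (pr u) (u - pr u) = 0 \<and>
         (u \<noteq> pr u \<longrightarrow> B (u - pr u) (u - pr u) < 0)"
      using split[OF f_in_S[OF q0]] by blast
    moreover have "B u u \<ge> 0" if u: "u \<in> P" for u
      using pr(1)[rule_format, OF u] pr(2)[rule_format, OF subsetD[OF PP(3) u]] by simp
    ultimately show ?thesis using that by blast
  qed
  have "P \<noteq> {0}" using P(2) r0 by auto
  then obtain u where u: "u \<in> P" "u \<noteq> 0" using subspace_0[OF P(1)] by blast
  have "sgn u \<in> P" using u P(1) by (simp add: sgn_div_norm subspace_scale)
  then have "(f 0, sgn u) \<in> X"
    unfolding X_def using f_in_S[OF q0] P(3) Pp[of "sgn u"] u(2) by (auto simp: norm_sgn)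
  then have "(f 0, sgn u) \<in> D 0"
    unfolding DD[OF q0] Ds_def using q0 by (auto simp: ortho)
  then show False
    by (rule contradiction[rotated]) (simp add: DD sphere_like_Ds)
qed

end

subsection \<open>Polynomials in a linear map\<close>

text \<open>The value of \<open>p(f)\<close> at a vector, by Horner's scheme.\<close>

definition pev :: "real poly \<Rightarrow> ('v::real_vector \<Rightarrow> 'v) \<Rightarrow> 'v \<Rightarrow> 'v" where
  "pev p f = fold_coeffs (\<lambda>a g v. a *\<^sub>R v + f (g v)) p (\<lambda>v. 0)"

lemma pev_0 [simp]: "pev 0 f v = 0"
  by (simp add: pev_def)

lemma pev_pCons: "linear f \<Longrightarrow> pev (pCons a p) f v = a *\<^sub>R v + f (pev p f v)"
  by (cases "p = 0"; cases "a = 0") (simp_all add: pev_def linear_0)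

lemma linear_pev: "linear f \<Longrightarrow> linear (pev p f)"
  by (induction p) (auto intro!: linearI simp: pev_pCons linear_add linear_scale algebra_simps)

lemma pev_add: "linear f \<Longrightarrow> pev (p + q) f v = pev p f v + pev q f v"
  by (induction p q rule: poly_induct2) (simp_all add: pev_pCons linear_0 linear_add algebra_simps)

lemma pev_smult: "linear f \<Longrightarrow> pev (smult c p) f v = c *\<^sub>R pev p f v"
  by (induction p) (simp_all add: pev_pCons linear_scale algebra_simps)

lemma pev_diff: "linear f \<Longrightarrow> pev (p - q) f v = pev p f v - pev q f v"
  using pev_add[of f p "smult (-1) q" v] pev_smult[of f "-1" q v] by simp

lemma pev_mult: "linear f \<Longrightarrow> pev (p * q) f v = pev p f (pev q f v)"
  by (induction p) (simp_all add: pev_pCons pev_add pev_smult linear_0)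

lemma pev_commute: "linear f \<Longrightarrow> pev p f (pev q f v) = pev q f (pev p f v)"
  by (metis mult.commute pev_mult)

lemma pev_1: "linear f \<Longrightarrow> pev 1 f v = v"
  by (simp add: one_pCons pev_pCons linear_0)

lemma pev_sum: "linear f \<Longrightarrow> pev (\<Sum>i\<in>I. h i) f v = (\<Sum>i\<in>I. pev (h i) f v)"
  by (induction I rule: infinite_finite_induct) (simp_all add: pev_add)

lemma pev_monom: "linear f \<Longrightarrow> pev (monom c i) f v = c *\<^sub>R (f ^^ i) v"
  by (induction i) (simp_all add: monom_0 monom_Suc pev_pCons linear_0 linear_scale)

lemma pev_eigen: "linear f \<Longrightarrow> f v = c *\<^sub>R v \<Longrightarrow> pev p f v = poly p c *\<^sub>R v"
  by (induction p) (simp_all add: pev_pCons linear_scale algebra_simps)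

lemma pev_conj:
  assumes "linear f" "linear g" "linear P" "\<And>v. g (P v) = P (f v)"
  shows "pev p g (P v) = P (pev p f v)"
  by (induction p) (simp_all add: pev_pCons assms linear_0 linear_add linear_scale)

lemma pev_self_adjoint:
  assumes "bilinear B" "linear f" "\<And>u v. B (f u) v = B u (f v)"
  shows "B (pev p f u) v = B u (pev p f v)"
proof (induction p arbitrary: u v)
  case (pCons a p)
  have "B (f (pev p f u)) v = B u (f (pev p f v))"
    using pCons assms(3)[of "pev p f u" v] pev_commute[OF assms(2), of p "[:0, 1:]" v]
    by (simp add: pev_pCons assms(2) linear_0)
  then show ?case
    by (simp add: pev_pCons assms(1,2) bilinear_ladd bilinear_radd bilinear_lmul bilinear_rmul)
qed (simp add: assms(1) bilinear_lzero bilinear_rzero)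

lemma continuous_on_pev:
  fixes J :: "'a::euclidean_space \<Rightarrow> 'a \<Rightarrow> 'a"
  assumes "\<And>x. linear (J x)" "continuous_on UNIV (\<lambda>z. J (fst z) (snd z))"
  shows "continuous_on UNIV (\<lambda>z. pev p (J (fst z)) (snd z))"
proof (induction p)
  case (pCons a p)
  have "continuous_on UNIV (\<lambda>z :: 'a \<times> 'a. (fst z, pev p (J (fst z)) (snd z)))"
    by (intro continuous_intros pCons)
  from continuous_on_compose2[OF assms(2) this]
  have "continuous_on UNIV (\<lambda>z. J (fst z) (pev p (J (fst z)) (snd z)))" by simp
  then show ?case by (simp add: pev_pCons assms(1)) (intro continuous_intros)
qed simp

text \<open>Among \<open>DIM('v) + 1\<close> iterates of \<open>v\<close> two coincide, or they form
  a set too large to be independent. Coinciding iterates are treated apart because a set would hide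
  them.\<close>

lemma vector_annihilator:
  fixes f :: "'v::euclidean_space \<Rightarrow> 'v"
  assumes f: "linear f"
  shows "\<exists>p. p \<noteq> 0 \<and> pev p f v = 0"
proof (cases "inj_on (\<lambda>i. (f ^^ i) v) {..DIM('v)}")
  case True
  let ?S = "(\<lambda>i. (f ^^ i) v) ` {..DIM('v)}"
  have "card ?S = Suc DIM('v)" using True by (simp add: card_image)
  then have "dependent ?S" using independent_bound[of ?S] by auto
  then obtain u where u: "\<exists>w\<in>?S. u w \<noteq> 0" "(\<Sum>w\<in>?S. u w *\<^sub>R w) = 0"
    using dependent_finite[of ?S] by auto
  define p where "p = (\<Sum>i\<le>DIM('v). monom (u ((f ^^ i) v)) i)"
  have "pev p f v = (\<Sum>i\<le>DIM('v). u ((f ^^ i) v) *\<^sub>R (f ^^ i) v)"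
    by (simp add: p_def pev_sum[OF f] pev_monom[OF f])
  also have "\<dots> = 0" using u(2) True by (simp add: sum.reindex)
  finally have "pev p f v = 0" .
  moreover obtain j where j: "j \<le> DIM('v)" "u ((f ^^ j) v) \<noteq> 0" using u(1) by auto
  have "coeff p j = u ((f ^^ j) v)" using j(1) by (simp add: p_def coeff_sum)
  then have "p \<noteq> 0" using j(2) by auto
  ultimately show ?thesis by blast
next
  case False
  then obtain i j where ij: "i \<noteq> j" "(f ^^ i) v = (f ^^ j) v" by (auto simp: inj_on_def)
  let ?p = "monom 1 i - monom 1 j :: real poly"
  have "coeff ?p i = 1" using ij(1) by simp
  then have "?p \<noteq> 0" by (metis coeff_0 zero_neq_one)
  moreover have "pev ?p f v = 0" using ij(2) by (simp add: pev_diff[OF f] pev_monom[OF f])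
  ultimately show ?thesis by blast
qed

text \<open>The product over a basis works, since polynomials in \<open>f\<close> commute and the
  factor belonging to a basis vector can be applied first.\<close>

lemma annihilator:
  fixes f :: "'v::euclidean_space \<Rightarrow> 'v"
  assumes f: "linear f"
  shows "\<exists>p. p \<noteq> 0 \<and> (\<forall>v. pev p f v = 0)"
proof -
  obtain P where P: "\<And>v. P v \<noteq> 0" "\<And>v. pev (P v) f v = 0"
    using vector_annihilator[OF f] by metis
  define p where "p = (\<Prod>b\<in>Basis. P b)"
  have b: "pev p f b = 0" if "b \<in> Basis" for b
  proof -
    have "p = (\<Prod>b\<in>Basis - {b}. P b) * P b"
      unfolding p_def using that by (simp add: prod.remove mult.commute)
    then show ?thesis using P(2)[of b] by (simp add: pev_mult[OF f] linear_0[OF linear_pev[OF f]])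
  qed
  have "pev p f v = 0" for v
  proof -
    have "pev p f (\<Sum>b\<in>Basis. (v \<bullet> b) *\<^sub>R b) = 0"
      by (simp add: linear_sum[OF linear_pev[OF f]] linear_scale[OF linear_pev[OF f]] b)
    then show ?thesis by (simp add: euclidean_representation)
  qed
  moreover have "p \<noteq> 0" using P(1) by (simp add: p_def)
  ultimately show ?thesis by blast
qed

text \<open>The real quadratic polynomial with roots \<open>\<alpha> + i \<beta>\<close> and
  \<open>\<alpha> - i \<beta>\<close>.\<close>

abbreviation quad :: "real \<Rightarrow> real \<Rightarrow> real poly" where
  "quad \<alpha> \<beta> \<equiv> [:\<alpha>\<^sup>2 + \<beta>\<^sup>2, - (2 * \<alpha>), 1:]"

lemma degree_less_2E:
  assumes "degree p < 2" obtains a b where "p = [:a, b:]"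
proof -
  have "p = [:coeff p 0, coeff p 1:]"
  proof (rule poly_eqI)
    fix n show "coeff p n = coeff [:coeff p 0, coeff p 1:] n"
      using assms coeff_eq_0[of p n] by (auto simp: coeff_pCons split: nat.splits)
  qed
  then show ?thesis by (rule that)
qed

lemma poly_map_of_real_add:
  "poly (map_poly complex_of_real (p + q)) z = poly (map_poly of_real p) z + poly (map_poly of_real q) z"
  by (induction p q rule: poly_induct2) (simp_all add: map_poly_pCons algebra_simps)

lemma poly_map_of_real_smult:
  "poly (map_poly complex_of_real (smult c p)) z = of_real c * poly (map_poly of_real p) z"
  by (induction p) (simp_all add: map_poly_pCons algebra_simps)

lemma poly_map_of_real_mult:
  "poly (map_poly complex_of_real (p * q)) z = poly (map_poly of_real p) z * poly (map_poly of_real q) z"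
  by (induction p) (simp_all add: map_poly_pCons poly_map_of_real_add poly_map_of_real_smult algebra_simps)

lemma poly_map_of_real_of_real:
  "poly (map_poly complex_of_real p) (of_real c) = of_real (poly p c)"
  by (induction p) (simp_all add: map_poly_pCons)

lemma quad_dvd:
  fixes m :: "real poly"
  assumes z: "poly (map_poly of_real m) z = (0 :: complex)" and "Im z \<noteq> 0"
  shows "quad (Re z) (Im z) dvd m"
proof -
  let ?g = "quad (Re z) (Im z)"
  have deg: "degree (m mod ?g) < 2"
    using degree_mod_less[of ?g m] by auto
  have g: "poly (map_poly complex_of_real ?g) z = 0"
    by (simp add: map_poly_pCons complex_eq_iff power2_eq_square algebra_simps)
  have "poly (map_poly complex_of_real (m div ?g * ?g + m mod ?g)) z = 0"
    using z by (simp only: div_mult_mod_eq)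
  then have 0: "poly (map_poly complex_of_real (m mod ?g)) z = 0"
    unfolding poly_map_of_real_add poly_map_of_real_mult g by simp
  obtain a b where ab: "m mod ?g = [:a, b:]"
    using deg by (rule degree_less_2E)
  have "complex_of_real a + z * complex_of_real b = 0" using 0 by (simp add: ab map_poly_pCons)
  then have "b * Im z = 0" "a + b * Re z = 0" by (simp_all add: complex_eq_iff mult.commute)
  then have "a = 0" "b = 0" using assms(2) by auto
  then have "m mod ?g = 0" by (simp add: ab)
  then show ?thesis by auto
qed

text \<open>A complex root is taken out. If it is not real, its conjugate gives the quadratic
  factor; if it is real, either it is a root of the cofactor again or it joins the distinct roots
  found by induction.\<close>

lemma real_poly_cases:
  fixes m :: "real poly"
  assumes "m \<noteq> 0"
  shows "(\<exists>c. [:- c, 1:] * [:- c, 1:] dvd m) \<or> (\<exists>\<alpha> \<beta>. \<beta> \<noteq> 0 \<and> quad \<alpha> \<beta> dvd m) \<or>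
    (\<exists>C k. finite C \<and> m = smult k (\<Prod>c\<in>C. [:- c, 1:]))"
  using assms
proof (induction "degree m" arbitrary: m rule: less_induct)
  case less
  show ?case
  proof (cases "degree m = 0")
    case True
    then obtain k where "m = [:k:]" by (metis degree_eq_zeroE)
    then have "finite {} \<and> m = smult k (\<Prod>c\<in>{}. [:- c, 1:])" by simp
    then show ?thesis by blast
  next
    case False
    let ?M = "map_poly complex_of_real m"
    have "degree ?M = degree m" by (simp add: degree_map_poly)
    then have "\<not> constant (poly ?M)" using False by (simp add: constant_degree)
    then obtain z where z: "poly ?M z = 0" using fundamental_theorem_of_algebra by blast
    show ?thesis
    proof (cases "Im z = 0")
      case False
      then show ?thesis using quad_dvd[OF z] by blast
    next
      case True
      then have "z = complex_of_real (Re z)" by (simp add: complex_eq_iff)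
      then have "complex_of_real (poly m (Re z)) = 0" using z poly_map_of_real_of_real[of m "Re z"] by metis
      then have "poly m (Re z) = 0" by simp
      then obtain n where n: "m = [:- Re z, 1:] * n" using poly_eq_0_iff_dvd by blast
      have n0: "n \<noteq> 0" using n less.prems by auto
      have "degree m = Suc (degree n)" using n0 unfolding n by (subst degree_mult_eq) auto
      then have IH: "(\<exists>c. [:- c, 1:] * [:- c, 1:] dvd n) \<or> (\<exists>\<alpha> \<beta>. \<beta> \<noteq> 0 \<and> quad \<alpha> \<beta> dvd n) \<or>
          (\<exists>C k. finite C \<and> n = smult k (\<Prod>c\<in>C. [:- c, 1:]))"
        using less.hyps[of n] n0 by simp
      have nm: "h dvd m" if "h dvd n" for h using that n dvd_mult by blast
      show ?thesis
      proof (cases "[:- Re z, 1:] dvd n")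
        case True
        then have "[:- Re z, 1:] * [:- Re z, 1:] dvd m" unfolding n by (intro mult_dvd_mono dvd_refl)
        then show ?thesis by blast
      next
        case False
        have "\<exists>C k. finite C \<and> m = smult k (\<Prod>c\<in>C. [:- c, 1:])" if fC: "finite C" and nC: "n = smult k (\<Prod>c\<in>C. [:- c, 1:])" for C k
        proof -
          have "Re z \<notin> C"
          proof
            assume "Re z \<in> C"
            then have "[:- Re z, 1:] dvd (\<Prod>c\<in>C. [:- c, 1:])" using fC by (intro dvd_prodI)
            then show False using False nC dvd_smult by blast
          qed
          then have "m = smult k (\<Prod>c\<in>insert (Re z) C. [:- c, 1:])"
            using fC unfolding n nC by (simp only: prod.insert mult_smult_right not_False_eq_True)
          then show ?thesis using fC by (metis finite.insertI)
        qed
        then show ?thesis using IH nm by blast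
      qed
    qed
  qed
qed

text \<open>Applying all factors but one to \<open>v\<close> gives a vector \<open>w\<close> with
  \<open>f w = c *\<^sub>R w\<close>; subtracting the right multiple of it leaves a vector killed by
  the shorter product.\<close>

lemma split_annihilator_span:
  assumes f: "linear f" and "finite C"
  shows "pev (\<Prod>c\<in>C. [:- c, 1:]) f v = 0 \<Longrightarrow> v \<in> span {w. \<exists>c. f w = c *\<^sub>R w}"
  using assms(2)
proof (induction C arbitrary: v rule: finite_induct)
  case empty
  then show ?case by (simp add: pev_1[OF f] span_zero)
next
  case (insert c C)
  let ?q = "\<Prod>c\<in>C. [:- c, 1:]"
  define w where "w = pev ?q f v"
  have "pev ([:- c, 1:] * ?q) f v = 0" using insert by (simp only: prod.insert not_False_eq_True)
  then have "- c *\<^sub>R w + f w = 0"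
    unfolding pev_mult[OF f] w_def by (simp add: pev_pCons[OF f] linear_0[OF f])
  then have w: "f w = c *\<^sub>R w" by (simp add: neg_eq_iff_add_eq_0[symmetric])
  have qc: "poly ?q c \<noteq> 0" using insert.hyps by (auto simp: poly_prod)
  have "pev ?q f (v - (1 / poly ?q c) *\<^sub>R w) = 0"
    using qc unfolding linear_diff[OF linear_pev[OF f]] linear_scale[OF linear_pev[OF f]] pev_eigen[OF f w]
    by (simp add: w_def)
  then have "v - (1 / poly ?q c) *\<^sub>R w \<in> span {w. \<exists>c. f w = c *\<^sub>R w}" by (rule insert.IH)
  moreover have "(1 / poly ?q c) *\<^sub>R w \<in> span {w. \<exists>c. f w = c *\<^sub>R w}"
    using w by (intro span_scale span_base) auto
  ultimately show ?case using span_add by fastforce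
qed

text \<open>\<open>a\<close> is the minimal polynomial divided by a repeated or a nonreal factor, so
  \<open>a(f)\<close> is nonzero by minimality. If the removed factor still divides
  \<open>a\<close>, then the minimal polynomial divides the square of \<open>a\<close>.\<close>

lemma not_diagonalizable_cases:
  fixes f :: "'v::euclidean_space \<Rightarrow> 'v"
  assumes f: "linear f" and nd: "\<not> diagonalizable f"
  obtains a v where "pev a f v \<noteq> 0" "\<And>u. pev a f (pev a f u) = 0"
  | a v \<alpha> \<beta> where "pev a f v \<noteq> 0" "\<beta> \<noteq> 0" "\<And>u. pev (quad \<alpha> \<beta>) f (pev a f u) = 0"
    "\<And>u. pev (quad \<alpha> \<beta>) f u = 0 \<Longrightarrow> pev a f u = 0 \<Longrightarrow> u = 0"
proof -
  define ann where "ann = (\<lambda>p. p \<noteq> 0 \<and> (\<forall>v. pev p f v = 0))"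
  obtain p0 where "ann p0" using annihilator[OF f] by (auto simp: ann_def)
  then obtain m where m: "ann m" "\<And>p. ann p \<Longrightarrow> degree m \<le> degree p"
    using ex_has_least_nat[of ann p0 degree] by blast
  have m0: "m \<noteq> 0" "\<And>v. pev m f v = 0" using m(1) by (auto simp: ann_def)
  have min: "\<exists>v. pev a f v \<noteq> 0" if mga: "m = g * a" and g: "degree g > 0" for g a
  proof (rule ccontr)
    assume "\<not> ?thesis"
    then have "ann a" using m0(1) mga by (auto simp: ann_def)
    moreover have "degree m = degree g + degree a" using m0(1) unfolding mga by (intro degree_mult_eq) auto
    ultimately show False using m(2)[of a] g by simp
  qed
  from real_poly_cases[OF m0(1)] consider
    c where "[:- c, 1:] * [:- c, 1:] dvd m"
    | \<alpha> \<beta> where "\<beta> \<noteq> 0" "quad \<alpha> \<beta> dvd m"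
    | C k where "finite C" "m = smult k (\<Prod>c\<in>C. [:- c, 1:])"
    by blast
  then show ?thesis
  proof cases
    case (1 c)
    then obtain n where n: "m = [:- c, 1:] * [:- c, 1:] * n" by (rule dvdE)
    define a where "a = [:- c, 1:] * n"
    have mg: "m = [:- c, 1:] * a" unfolding n a_def mult.assoc ..
    obtain v where "pev a f v \<noteq> 0" using min[OF mg] by auto
    moreover have "pev a f (pev a f u) = 0" for u
    proof -
      have "a * a = n * m" unfolding n a_def by (simp only: ac_simps)
      then have "pev a f (pev a f u) = pev n f (pev m f u)" by (simp flip: pev_mult[OF f])
      then show ?thesis by (simp add: m0(2) linear_0[OF linear_pev[OF f]])
    qed
    ultimately show ?thesis by (rule that(1))
  next
    case (2 \<alpha> \<beta>)
    let ?g = "quad \<alpha> \<beta>"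
    obtain a where a: "m = ?g * a" using 2(2) by (rule dvdE)
    obtain v where v: "pev a f v \<noteq> 0" using min[OF a] by auto
    show ?thesis
    proof (cases "?g dvd a")
      case True
      then obtain n where n: "a = ?g * n" by (rule dvdE)
      have "pev a f (pev a f u) = 0" for u
      proof -
        have "a * a = n * m" unfolding a by (subst n) (simp only: ac_simps)
        then have "pev a f (pev a f u) = pev n f (pev m f u)" by (simp flip: pev_mult[OF f])
        then show ?thesis by (simp add: m0(2) linear_0[OF linear_pev[OF f]])
      qed
      then show ?thesis using that(1) v by blast
    next
      case False
      have "pev ?g f (pev a f u) = 0" for u using m0(2)[of u] unfolding a pev_mult[OF f] .
      \<comment> \<open>On a common kernel vector the remainder of \<open>a\<close> modulo
        \<open>?g\<close>, of degree below 2, vanishes too. This would make \<open>u\<close> an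
        eigenvector with a real eigenvalue that is a root of \<open>?g\<close>.\<close>
      moreover have "u = 0" if gu: "pev ?g f u = 0" and au: "pev a f u = 0" for u
      proof (rule ccontr)
        assume u0: "u \<noteq> 0"
        have "degree (a mod ?g) < 2" using degree_mod_less[of ?g a] by auto
        then obtain b0 b1 where b: "a mod ?g = [:b0, b1:]"
          by (rule degree_less_2E)
        have "a mod ?g = a - (a div ?g) * ?g" by (rule minus_div_mult_eq_mod[symmetric])
        then have "pev (a mod ?g) f u = 0"
          by (simp only: pev_diff[OF f] pev_mult[OF f] gu au linear_0[OF linear_pev[OF f]]) simp
        then have bu: "b0 *\<^sub>R u + b1 *\<^sub>R f u = 0"
          by (simp add: b pev_pCons[OF f] linear_0[OF f] linear_scale[OF f])
        show False
        proof (cases "b1 = 0")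
          case True
          then have "b0 = 0" using bu u0 by simp
          then show False using b True False by auto
        next
          case b1: False
          have "b1 *\<^sub>R f u = - (b0 *\<^sub>R u)" using bu by (simp add: eq_neg_iff_add_eq_0 add.commute)
          then have "(1 / b1) *\<^sub>R (b1 *\<^sub>R f u) = (1 / b1) *\<^sub>R (- (b0 *\<^sub>R u))" by simp
          then have fu: "f u = (- b0 / b1) *\<^sub>R u" using b1 by simp
          have "poly ?g (- b0 / b1) *\<^sub>R u = 0" using gu pev_eigen[OF f fu] by metis
          then have "poly ?g (- b0 / b1) = 0" using u0 by simp
          moreover have "poly ?g c = (c - \<alpha>)\<^sup>2 + \<beta>\<^sup>2" for c by (simp add: power2_eq_square algebra_simps)
          ultimately have "(- b0 / b1 - \<alpha>)\<^sup>2 + \<beta>\<^sup>2 = 0" by metis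
          then show False using 2(1) by (simp add: sum_power2_eq_zero_iff)
        qed
      qed
      ultimately show ?thesis using that(2) v 2(1) by blast
    qed
  next
    case (3 C k)
    have k: "k \<noteq> 0" using 3(2) m0(1) by auto
    have all: "v \<in> span {w. \<exists>c. f w = c *\<^sub>R w}" for v
    proof (rule split_annihilator_span[OF f 3(1)])
      show "pev (\<Prod>c\<in>C. [:- c, 1:]) f v = 0"
        using m0(2)[of v] k unfolding 3(2) pev_smult[OF f] by simp
    qed
    obtain E where E: "E \<subseteq> {w. \<exists>c. f w = c *\<^sub>R w}" "independent E" "{w. \<exists>c. f w = c *\<^sub>R w} \<subseteq> span E"
      using maximal_independent_subset by blast
    have "span E = UNIV" using all span_minimal[OF E(3) subspace_span] by blast
    then have "diagonalizable f" unfolding diagonalizable_def using E(1,2) by blast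
    then show ?thesis using nd by blast
  qed
qed

subsection \<open>Symmetric bilinear forms\<close>

locale sym_form =
  fixes C :: "'v::euclidean_space \<Rightarrow> 'v \<Rightarrow> real"
  assumes bil: "bilinear C" and sym: "C x y = C y x"
begin

lemmas C_simps = bilinear_ladd[OF bil] bilinear_radd[OF bil] bilinear_lmul[OF bil] bilinear_rmul[OF bil]
  bilinear_lneg[OF bil] bilinear_rneg[OF bil] bilinear_lsub[OF bil] bilinear_rsub[OF bil]
  bilinear_lzero[OF bil] bilinear_rzero[OF bil]

definition orthonormal :: "(nat \<Rightarrow> 'v) \<Rightarrow> nat \<Rightarrow> bool" where
  "orthonormal f k \<longleftrightarrow> (\<forall>i<k. \<forall>j<k. C (f i) (f j) = (if i = j then 1 else 0))"

definition proj :: "(nat \<Rightarrow> 'v) \<Rightarrow> nat \<Rightarrow> 'v \<Rightarrow> 'v" where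
  "proj f k u = (\<Sum>i<k. C u (f i) *\<^sub>R f i)"

lemma linear_proj: "linear (proj f k)"
  unfolding proj_def
  by (rule linearI) (simp_all add: C_simps scaleR_add_left sum.distrib scaleR_right.sum)

lemma proj_in_span: "proj f k u \<in> span (f ` {..<k})"
  unfolding proj_def by (intro span_sum span_scale span_base) auto

lemma sum_left: "C (\<Sum>i\<in>I. h i) v = (\<Sum>i\<in>I. C (h i) v)"
  by (induction I rule: infinite_finite_induct) (simp_all add: C_simps)

lemma C_sum_orthonormal:
  assumes "orthonormal f k" "j < k"
  shows "C (\<Sum>i<k. a i *\<^sub>R f i) (f j) = a j"
proof -
  have "C (\<Sum>i<k. a i *\<^sub>R f i) (f j) = (\<Sum>i<k. if i = j then a i else 0)"
    unfolding sum_left using assms by (intro sum.cong) (auto simp: orthonormal_def C_simps)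
  then show ?thesis using assms(2) by simp
qed

lemma C_diff_proj: "orthonormal f k \<Longrightarrow> j < k \<Longrightarrow> C (u - proj f k u) (f j) = 0"
  using C_sum_orthonormal[of f k j "\<lambda>i. C u (f i)"] by (simp add: C_simps proj_def)

lemma C_span_zero:
  assumes "w \<in> span (f ` {..<k})" "\<And>i. i < k \<Longrightarrow> C u (f i) = 0"
  shows "C u w = 0"
  using assms(1) by (induction rule: span_induct) (auto simp: subspace_def C_simps assms(2))

lemma proj_span:
  assumes "orthonormal f k" "w \<in> span (f ` {..<k})"
  shows "proj f k w = w"
  using assms(2)
proof (induction rule: span_induct)
  case base
  show ?case using linear_proj[of f k] by (auto simp: subspace_def linear_0 linear_add linear_scale)
next
  case (step x)
  then obtain j where j: "j < k" "x = f j" by auto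
  have "proj f k (f j) = (\<Sum>i<k. if i = j then f i else 0)"
    unfolding proj_def using j assms(1) by (intro sum.cong) (auto simp: orthonormal_def)
  then show ?case using j by simp
qed

lemma orthonormal_positive:
  assumes o: "orthonormal f k" and w: "w \<in> span (f ` {..<k})" "w \<noteq> 0"
  shows "C w w > 0"
proof -
  have wc: "w = (\<Sum>i<k. C w (f i) *\<^sub>R f i)" using proj_span[OF o w(1)] by (simp add: proj_def)
  from this have "C w w = C (\<Sum>i<k. C w (f i) *\<^sub>R f i) w" by (rule arg_cong)
  also have "\<dots> = (\<Sum>i<k. C w (f i) * C w (f i))"
    unfolding sum_left C_simps real_scaleR_def by (intro sum.cong refl arg_cong2[where f = "(*)"]) (rule sym)
  finally have "C w w = (\<Sum>i<k. C w (f i) * C w (f i))" .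
  moreover have "\<exists>i<k. C w (f i) \<noteq> 0"
  proof (rule ccontr)
    assume "\<not> ?thesis"
    then have "(\<Sum>i<k. C w (f i) *\<^sub>R f i) = 0" by simp
    then show False using w(2) wc by simp
  qed
  then obtain i where i: "i < k" "C w (f i) \<noteq> 0" by blast
  have "0 < C w (f i) * C w (f i)" using i by (auto simp: zero_less_mult_iff linorder_neq_iff)
  then have "(\<Sum>i<k. C w (f i) * C w (f i)) > 0"
    using i(1) by (intro sum_pos2[of _ i]) auto
  ultimately show ?thesis by simp
qed

lemma dim_orthonormal:
  assumes o: "orthonormal f k"
  shows "dim (span (f ` {..<k})) = k"
proof -
  have inj: "inj_on f {..<k}"
  proof (rule inj_onI)
    fix i j assume "i \<in> {..<k}" "j \<in> {..<k}" "f i = f j"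
    then have "C (f i) (f j) = 1" "i < k" "j < k" using o by (auto simp: orthonormal_def)
    then show "i = j" using o by (auto simp: orthonormal_def split: if_splits)
  qed
  have "independent (f ` {..<k})"
  proof
    assume "dependent (f ` {..<k})"
    then obtain u where u: "\<exists>w\<in>f ` {..<k}. u w \<noteq> 0" "(\<Sum>w\<in>f ` {..<k}. u w *\<^sub>R w) = 0"
      using dependent_finite[of "f ` {..<k}"] by auto
    then have s: "(\<Sum>i<k. u (f i) *\<^sub>R f i) = 0" using inj by (simp add: sum.reindex)
    obtain j where j: "j < k" "u (f j) \<noteq> 0" using u(1) by auto
    have "C (\<Sum>i<k. u (f i) *\<^sub>R f i) (f j) = u (f j)" by (rule C_sum_orthonormal[OF o j(1)])
    then show False using s j(2) by (simp add: C_simps)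
  qed
  then show ?thesis using dim_eq_card_independent[of "f ` {..<k}"] inj by (simp add: card_image)
qed

lemma orthonormal_extend:
  assumes o: "orthonormal f k" and u: "C u u > 0" "\<And>i. i < k \<Longrightarrow> C u (f i) = 0"
  shows "orthonormal (f(k := (1 / sqrt (C u u)) *\<^sub>R u)) (Suc k)"
proof -
  have "C (f i) u = 0" if "i < k" for i using u(2)[OF that] sym by metis
  moreover have "sqrt (C u u) * sqrt (C u u) = C u u" using u(1) by simp
  ultimately show ?thesis
    using o u unfolding orthonormal_def by (auto simp: C_simps less_Suc_eq field_simps)
qed

lemma orthonormal_basis:
  assumes W: "subspace W" "\<And>w. w \<in> W \<Longrightarrow> w \<noteq> 0 \<Longrightarrow> C w w > 0"
  obtains f where "orthonormal f (dim W)" "span (f ` {..<dim W}) = W"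
proof -
  define Q where "Q = (\<lambda>k. \<exists>f. orthonormal f k \<and> f ` {..<k} \<subseteq> W)"
  have bound: "k \<le> dim W" if Qk: "Q k" for k
  proof -
    obtain f where f: "orthonormal f k" "f ` {..<k} \<subseteq> W" using Qk by (auto simp: Q_def)
    have "span (f ` {..<k}) \<subseteq> W" using f(2) W(1) by (rule span_minimal)
    then show ?thesis using dim_subset dim_orthonormal[OF f(1)] by metis
  qed
  have "Q 0" by (simp add: Q_def orthonormal_def)
  then obtain k where k: "Q k" "\<And>j. Q j \<Longrightarrow> j \<le> k"
    using bound ex_has_greatest_nat[of Q 0 "\<lambda>k. k" "Suc (dim W)"] by (metis le_imp_less_Suc)
  obtain f where f: "orthonormal f k" "f ` {..<k} \<subseteq> W" using k(1) by (auto simp: Q_def)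
  have sub: "span (f ` {..<k}) \<subseteq> W" using f(2) W(1) by (rule span_minimal)
  have "W \<subseteq> span (f ` {..<k})"
  proof (rule subsetI, rule ccontr)
    fix w assume w: "w \<in> W" "w \<notin> span (f ` {..<k})"
    let ?u = "w - proj f k w"
    have "proj f k w \<in> W" using sub proj_in_span by blast
    then have u: "?u \<in> W" using w(1) W(1) by (simp add: subspace_diff)
    have "?u \<noteq> 0" using w(2) proj_in_span[of f k w] by auto
    then have pos: "C ?u ?u > 0" using W(2) u by blast
    have o: "orthonormal (f(k := (1 / sqrt (C ?u ?u)) *\<^sub>R ?u)) (Suc k)"
      by (intro orthonormal_extend f(1) pos C_diff_proj)
    have "(f(k := (1 / sqrt (C ?u ?u)) *\<^sub>R ?u)) ` {..<Suc k} \<subseteq> W"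
      using f(2) u W(1) by (auto simp: less_Suc_eq subspace_scale)
    then have "Q (Suc k)" using o unfolding Q_def by blast
    then show False using k(2) by fastforce
  qed
  then have s: "span (f ` {..<k}) = W" using sub by blast
  then have "k = dim W" using dim_orthonormal[OF f(1)] by simp
  then show ?thesis using that f(1) s by blast
qed

text \<open>Maximality excludes positive vectors in the complement. An isotropic one would pair
  nontrivially with another vector of the complement, and a suitable combination of both would be
  positive.\<close>

lemma maximal_complement_negative:
  assumes W: "subspace W" and nd: "\<And>u. u \<in> W \<Longrightarrow> (\<And>v. v \<in> W \<Longrightarrow> C u v = 0) \<Longrightarrow> u = 0"
    and o: "orthonormal f k" and fW: "f ` {..<k} \<subseteq> W"
    and max: "\<And>Q. spacelike_subspace C Q \<Longrightarrow> Q \<subseteq> W \<Longrightarrow> dim Q \<le> k"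
    and u: "u \<in> W" "u \<noteq> 0" "\<And>i. i < k \<Longrightarrow> C u (f i) = 0"
  shows "C u u < 0"
proof -
  have nonpos: "C w w \<le> 0" if w: "w \<in> W" "\<And>i. i < k \<Longrightarrow> C w (f i) = 0" for w
  proof (rule ccontr)
    assume "\<not> ?thesis"
    then have pos: "C w w > 0" by simp
    define g where "g = f(k := (1 / sqrt (C w w)) *\<^sub>R w)"
    have g: "orthonormal g (Suc k)" unfolding g_def by (intro orthonormal_extend o pos w(2))
    have "g ` {..<Suc k} \<subseteq> W"
      using fW w(1) W by (auto simp: g_def less_Suc_eq subspace_scale)
    then have "span (g ` {..<Suc k}) \<subseteq> W" using W by (rule span_minimal)
    moreover have "spacelike_subspace C (span (g ` {..<Suc k}))"
      using orthonormal_positive[OF g] by (simp add: spacelike_subspace_def)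
    ultimately show False using max dim_orthonormal[OF g] by fastforce
  qed
  have "C u u \<noteq> 0"
  proof
    assume 0: "C u u = 0"
    obtain v where v: "v \<in> W" "C u v \<noteq> 0" using nd[OF u(1)] u(2) by blast
    have ps: "proj f k v \<in> span (f ` {..<k})" by (rule proj_in_span)
    then have "proj f k v \<in> W" using span_minimal[OF fW W] by blast
    then have vW: "v - proj f k v \<in> W" using v(1) W by (simp add: subspace_diff)
    define v' where "v' = v - proj f k v"
    have uv: "C u v' = C u v" using C_span_zero[OF ps u(3)] by (simp add: v'_def C_simps)
    \<comment> \<open>The value at which \<open>v' + t *\<^sub>R u\<close> has square exactly
      1.\<close>
    define t where "t = (1 - C v' v') / (2 * C u v)"
    have "C (v' + t *\<^sub>R u) (v' + t *\<^sub>R u) = C v' v' + 2 * t * C u v'"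
      by (simp add: C_simps 0 sym[of v' u] algebra_simps)
    also have "\<dots> = 1" using v(2) by (simp add: uv t_def field_simps)
    finally have "C (v' + t *\<^sub>R u) (v' + t *\<^sub>R u) = 1" .
    moreover have "v' + t *\<^sub>R u \<in> W" using vW u(1) W unfolding v'_def by (intro subspace_add subspace_scale)
    moreover have "C (v' + t *\<^sub>R u) (f i) = 0" if i: "i < k" for i
      using C_diff_proj[OF o i, of v] u(3)[OF i] by (simp add: v'_def C_simps)
    ultimately show False using nonpos by fastforce
  qed
  then show ?thesis using nonpos[OF u(1) u(3)] by simp
qed

lemma uminus_form: "sym_form (\<lambda>u v. - C u v)"
proof
  show "bilinear (\<lambda>u v. - C u v)" unfolding bilinear_def by (auto intro!: linearI simp: C_simps)
qed (simp add: sym)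

text \<open>\<open>C (K u) (K u) = - C u u\<close>, so \<open>K\<close> exchanges positive and
  negative vectors and \<open>C\<close> has neutral signature on \<open>W\<close>. \<open>P\<close>
  is the complement of a maximal negative subspace \<open>U\<close>, and evenness of
  \<open>dim W\<close> gives the final implication.\<close>

lemma complex_structure_split:
  assumes W: "subspace W" and nd: "\<And>u. u \<in> W \<Longrightarrow> (\<And>v. v \<in> W \<Longrightarrow> C u v = 0) \<Longrightarrow> u = 0"
    and K: "linear K" "\<And>u. u \<in> W \<Longrightarrow> K u \<in> W" "\<And>u. u \<in> W \<Longrightarrow> K (K u) = - u"
    and Ks: "\<And>u v. C (K u) v = C u (K v)"
  shows "\<exists>P pr. subspace P \<and> dim P = dim W div 2 \<and> P \<subseteq> W \<and> linear pr \<and> (\<forall>u\<in>P. pr u = u) \<and>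
       (\<forall>u\<in>W. pr u \<in> P \<and> C (pr u) (pr u) \<ge> 0 \<and> C (pr u) (u - pr u) = 0 \<and>
         (u \<noteq> pr u \<longrightarrow> C (u - pr u) (u - pr u) < 0)) \<and> (dim W > 0 \<longrightarrow> dim W div 2 > 0)"
proof -
  \<comment> \<open>Negative subspaces are spacelike for the negated form, so the lemmas on positive
    subspaces apply to them.\<close>
  interpret N: sym_form "\<lambda>u v. - C u v" by (rule uminus_form)
  define Q where "Q = (\<lambda>k. \<exists>U. spacelike_subspace (\<lambda>u v. - C u v) U \<and> U \<subseteq> W \<and> dim U = k)"
  have "spacelike_subspace (\<lambda>u v. - C u v) {0}" by (simp add: spacelike_subspace_def)
  moreover have "{0} \<subseteq> W" using subspace_0[OF W] by simp
  ultimately have "Q 0" unfolding Q_def by (intro exI[of _ "{0}"]) simp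
  moreover have "k < Suc (dim W)" if "Q k" for k using that dim_subset by (auto simp: Q_def less_Suc_eq_le)
  ultimately obtain k where k: "Q k" "\<And>j. Q j \<Longrightarrow> j \<le> k"
    using ex_has_greatest_nat[of Q 0 "\<lambda>k. k" "Suc (dim W)"] by metis
  then obtain U where U: "spacelike_subspace (\<lambda>u v. - C u v) U" "U \<subseteq> W" "dim U = k" by (auto simp: Q_def)
  have max: "dim U' \<le> k" if "spacelike_subspace (\<lambda>u v. - C u v) U'" "U' \<subseteq> W" for U'
    using k(2)[of "dim U'"] that by (auto simp: Q_def)
  have Us: "subspace U" and Un: "\<And>u. u \<in> U \<Longrightarrow> u \<noteq> 0 \<Longrightarrow> C u u < 0"
    using U(1) by (auto simp: spacelike_subspace_def)
  obtain e where e: "N.orthonormal e k" "span (e ` {..<k}) = U"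
    using N.orthonormal_basis[OF Us] Un U(3) by auto
  have eW: "e ` {..<k} \<subseteq> W" using e(2) U(2) span_superset[of "e ` {..<k}"] by simp
  define pr where "pr = (\<lambda>u. u - N.proj e k u)"
  define P where "P = {u \<in> W. \<forall>i<k. C u (e i) = 0}"
  have Ppos: "C u u > 0" if uP: "u \<in> P" and u0: "u \<noteq> 0" for u
  proof -
    have "- C u u < 0"
    proof (rule N.maximal_complement_negative[OF W _ e(1) eW max])
      show "u' = 0" if "u' \<in> W" "\<And>v. v \<in> W \<Longrightarrow> - C u' v = 0" for u' using nd that by auto
    qed (use uP u0 in \<open>auto simp: P_def\<close>)
    then show ?thesis by simp
  qed
  have Ps: "subspace P" using W by (auto simp: P_def subspace_def C_simps)
  have linpr: "linear pr" unfolding pr_def by (intro linear_compose_sub linear_ident N.linear_proj)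
  have projU: "u - pr u \<in> U" for u using N.proj_in_span[of e k u] e(2) by (simp add: pr_def)
  have prP: "pr u \<in> P" if u: "u \<in> W" for u
  proof -
    have "N.proj e k u \<in> W" using projU[of u] U(2) by (auto simp: pr_def)
    then have "pr u \<in> W" using u W by (simp add: pr_def subspace_diff)
    then show ?thesis using N.C_diff_proj[OF e(1), of _ u] by (auto simp: P_def pr_def)
  qed
  have PU: "C u v = 0" if "u \<in> P" "v \<in> U" for u v
    using C_span_zero[of v e k u] that e(2) by (auto simp: P_def)
  have prid: "pr u = u" if uP: "u \<in> P" for u
    using uP by (simp add: pr_def N.proj_def P_def)
  have Kinj: "inj_on K (span T)" if "subspace T" "T \<subseteq> W" for T
    unfolding span_eq_iff[THEN iffD2, OF that(1)]
  proof (rule inj_onI)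
    fix u v assume uv: "u \<in> T" "v \<in> T" "K u = K v"
    then have "u \<in> W" "v \<in> W" using that(2) by auto
    moreover have "K (K u) = K (K v)" using uv(3) by (rule arg_cong)
    ultimately have "- u = - v" by (simp only: K(3))
    then show "u = v" by simp
  qed
  have KK: "C (K u) (K u) = - C u u" if "u \<in> W" for u
    using Ks[of u "K u"] K(3)[OF that] by (simp add: C_simps)
  have PW: "P \<subseteq> W" by (auto simp: P_def)
  have "dim P \<le> k"
  proof -
    have "spacelike_subspace (\<lambda>u v. - C u v) (K ` P)"
      unfolding spacelike_subspace_def
    proof (intro conjI ballI impI)
      show "subspace (K ` P)" using K(1) Ps by (rule linear_subspace_image)
      fix w assume "w \<in> K ` P" "w \<noteq> 0"
      then obtain u where u: "u \<in> P" "w = K u" "u \<noteq> 0" using linear_0[OF K(1)] by auto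
      then show "- C w w > 0" using KK[of u] Ppos[of u] PW by auto
    qed
    moreover have "K ` P \<subseteq> W" using K(2) PW by auto
    ultimately have "dim (K ` P) \<le> k" by (rule max)
    then show ?thesis using dim_image_eq[OF K(1) Kinj[OF Ps PW]] by simp
  qed
  \<comment> \<open>\<open>pr\<close> is injective on the image of \<open>U\<close> under
    \<open>K\<close>: a kernel vector there would lie in \<open>U\<close> and be negative, whereas
    \<open>K\<close> makes it positive.\<close>
  moreover have "k \<le> dim P"
  proof -
    have "inj_on pr (span (K ` U))"
      unfolding span_eq_iff[THEN iffD2, OF linear_subspace_image[OF K(1) Us]]
        linear_injective_on_subspace_0[OF linpr linear_subspace_image[OF K(1) Us]]
    proof (intro ballI impI)
      fix w assume w: "w \<in> K ` U" "pr w = 0"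
      then obtain u where u: "u \<in> U" "w = K u" by auto
      have "w \<in> U" using projU[of w] w(2) by simp
      show "w = 0"
      proof (rule ccontr)
        assume w0: "w \<noteq> 0"
        then have "u \<noteq> 0" using u(2) linear_0[OF K(1)] by auto
        then have "C w w > 0" using KK[of u] u U(2) Un[of u] by auto
        then show False using Un[OF \<open>w \<in> U\<close> w0] by simp
      qed
    qed
    then have "dim (pr ` (K ` U)) = dim (K ` U)" by (rule dim_image_eq[OF linpr])
    also have "\<dots> = k" using dim_image_eq[OF K(1) Kinj[OF Us U(2)]] U(3) by simp
    finally have "dim (pr ` (K ` U)) = k" .
    moreover have "pr ` (K ` U) \<subseteq> P" using prP K(2) U(2) by auto
    ultimately show ?thesis using dim_subset by metis
  qed
  ultimately have dP: "dim P = k" by simp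
  have "{x + y |x y. x \<in> P \<and> y \<in> U} = W"
  proof
    show "{x + y |x y. x \<in> P \<and> y \<in> U} \<subseteq> W" using PW U(2) W by (auto intro: subspace_add)
    show "W \<subseteq> {x + y |x y. x \<in> P \<and> y \<in> U}"
    proof
      fix w assume "w \<in> W"
      then have "w = pr w + (w - pr w) \<and> pr w \<in> P \<and> w - pr w \<in> U" using prP projU by simp
      then show "w \<in> {x + y |x y. x \<in> P \<and> y \<in> U}" by blast
    qed
  qed
  moreover have "P \<inter> U = {0}"
  proof -
    have "x = 0" if "x \<in> P" "x \<in> U" for x using Ppos[OF that(1)] Un[OF that(2)] by fastforce
    then show ?thesis using subspace_0[OF Ps] subspace_0[OF Us] by auto
  qed
  ultimately have "dim W = 2 * k"
    using dim_sums_Int[OF Ps Us] dP U(3) by simp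
  moreover have "pr u \<in> P \<and> C (pr u) (pr u) \<ge> 0 \<and> C (pr u) (u - pr u) = 0 \<and>
         (u \<noteq> pr u \<longrightarrow> C (u - pr u) (u - pr u) < 0)" if "u \<in> W" for u
    using prP[OF that] Ppos[of "pr u"] PU[OF prP[OF that] projU] Un[OF projU[of u]]
    by (cases "pr u = 0") (auto simp: C_simps(9,10))
  ultimately show ?thesis using Ps dP PW linpr prid by (intro exI[of _ P] exI[of _ pr]) auto
qed

end

subsection \<open>Jacobi operators\<close>

locale jacobi =
  fixes B :: "'v::euclidean_space \<Rightarrow> 'v \<Rightarrow> real" and R :: "'v \<Rightarrow> 'v \<Rightarrow> 'v \<Rightarrow> 'v \<Rightarrow> real"
  assumes form: "symmetric_form B" and nondeg: "nondegenerate_form B" and curv: "algebraic_curvature_tensor R"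
begin

sublocale F: sym_form B
  using form by unfold_locales (auto simp: symmetric_form_def)

lemma eq_0I: "(\<And>y. B x y = 0) \<Longrightarrow> x = 0"
  using nondeg by (auto simp: nondegenerate_form_def)

lemma R_linear: "linear (\<lambda>x. R x y z w)" "linear (\<lambda>y. R x y z w)" "linear (\<lambda>z. R x y z w)" "linear (\<lambda>w. R x y z w)"
  using curv[unfolded algebraic_curvature_tensor_def, THEN conjunct1] unfolding multilinear4_def by blast+

lemma R_sym: "R x y z w = R z w x y" and R_skew: "R x y z w = - R y x z w"
  using curv unfolding algebraic_curvature_tensor_def by blast+

text \<open>Represents the functional \<open>B u\<close> by the Euclidean inner product; its inverse
  turns the curvature form into an operator.\<close>

definition dual :: "'v \<Rightarrow> 'v" where "dual u = (\<Sum>b\<in>Basis. B u b *\<^sub>R b)"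

lemma linear_basis_sum: "linear g \<Longrightarrow> (\<Sum>b\<in>Basis. g b *\<^sub>R b) \<bullet> v = (g v :: real)"
proof -
  assume g: "linear g"
  have "g v = g (\<Sum>b\<in>Basis. (v \<bullet> b) *\<^sub>R b)" by (simp add: euclidean_representation)
  also have "\<dots> = (\<Sum>b\<in>Basis. (v \<bullet> b) * g b)" by (simp add: linear_sum[OF g] linear_scale[OF g])
  also have "\<dots> = (\<Sum>b\<in>Basis. g b *\<^sub>R b) \<bullet> v"
    unfolding inner_sum_left inner_scaleR_left by (simp add: inner_commute mult.commute)
  finally show ?thesis by simp
qed

lemma dual_inner: "dual u \<bullet> v = B u v"
  unfolding dual_def using F.bil by (intro linear_basis_sum) (simp add: bilinear_def)

lemma linear_dual: "linear dual"
  unfolding dual_def by (rule linearI) (simp_all add: F.C_simps scaleR_add_left sum.distrib scaleR_right.sum)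

lemma inj_dual: "inj dual"
proof (subst linear_injective_0[OF linear_dual], intro allI impI)
  fix u assume "dual u = 0"
  then have "B u v = 0" for v using dual_inner[of u v] by simp
  then show "u = 0" by (rule eq_0I)
qed

lemma surj_dual: "surj dual"
  using inj_dual linear_dual linear_injective_imp_surjective by blast

lemma linear_inv_dual: "linear (inv dual)"
proof (rule linearI)
  fix x y :: 'v and c :: real
  have "inv dual (dual (inv dual x + inv dual y)) = inv dual x + inv dual y"
    "inv dual (dual (c *\<^sub>R inv dual x)) = c *\<^sub>R inv dual x"
    by (simp_all add: inj_dual)
  then show "inv dual (x + y) = inv dual x + inv dual y" "inv dual (c *\<^sub>R x) = c *\<^sub>R inv dual x"
    by (simp_all add: linear_add[OF linear_dual] linear_scale[OF linear_dual] surj_f_inv_f[OF surj_dual])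
qed

text \<open>The explicit formula shows that the description in \<open>jacobi_op\<close> is met, and
  it is the source of continuity and evenness in \<open>x\<close>.\<close>

lemma jacobi_op_eq: "jacobi_op B R x = (\<lambda>y. inv dual (\<Sum>b\<in>Basis. R y x x b *\<^sub>R b))" (is "_ = ?J")
  and linear_jacobi: "linear (jacobi_op B R x)"
  and B_jacobi: "B (jacobi_op B R x y) z = R y x x z"
proof -
  have lin: "linear ?J"
  proof -
    have "linear (\<lambda>y. \<Sum>b\<in>Basis. R y x x b *\<^sub>R b)"
      by (rule linearI) (simp_all add: linear_add[OF R_linear(1)] linear_scale[OF R_linear(1)]
          scaleR_add_left sum.distrib scaleR_right.sum)
    then show ?thesis using linear_compose[OF _ linear_inv_dual] by (fastforce simp: comp_def)
  qed
  have J: "B (?J y) z = R y x x z" for y z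
  proof -
    have "B (?J y) z = (\<Sum>b\<in>Basis. R y x x b *\<^sub>R b) \<bullet> z"
      by (simp flip: dual_inner add: surj_f_inv_f[OF surj_dual])
    then show ?thesis by (simp add: linear_basis_sum[OF R_linear(4)])
  qed
  show eq: "jacobi_op B R x = ?J"
    unfolding jacobi_op_def
  proof (rule the_equality)
    fix f assume f: "linear f \<and> (\<forall>y z. B (f y) z = R y x x z)"
    show "f = ?J"
    proof
      fix y
      have "f y - ?J y = 0" by (rule eq_0I) (use f J in \<open>simp add: F.C_simps\<close>)
      then show "f y = ?J y" by simp
    qed
  qed (use lin J in simp)
  show "linear (jacobi_op B R x)" unfolding eq by (rule lin)
  show "B (jacobi_op B R x y) z = R y x x z" unfolding eq by (rule J)
qed

lemma jacobi_self_adjoint: "B (jacobi_op B R x y) z = B y (jacobi_op B R x z)"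
proof -
  have "R y x x z = - R z x y x" using R_sym[of y x x z] R_skew[of x z y x] by simp
  moreover have "R z x x y = - R y x z x" using R_sym[of z x x y] R_skew[of x y z x] by simp
  moreover have "R z x y x = R y x z x" by (rule R_sym)
  ultimately show ?thesis using B_jacobi[of x y z] B_jacobi[of x z y] F.sym[of y "jacobi_op B R x z"] by simp
qed

lemma jacobi_self: "jacobi_op B R x x = 0"
proof (rule eq_0I)
  show "B (jacobi_op B R x x) z = 0" for z
    using R_skew[of x x x z] by (simp add: B_jacobi)
qed

lemma jacobi_minus: "jacobi_op B R (- x) = jacobi_op B R x"
  unfolding jacobi_op_eq
  by (simp add: linear_neg[OF R_linear(2)] linear_neg[OF R_linear(3)])

lemma continuous_jacobi: "continuous_on UNIV (\<lambda>z. jacobi_op B R (fst z) (snd z))"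
proof -
  have rep: "g v = (\<Sum>b\<in>Basis. (v \<bullet> b) * g b)" if g: "linear g" for g :: "'v \<Rightarrow> real" and v
    by (subst euclidean_representation[of v, symmetric]) (simp add: linear_sum[OF g] linear_scale[OF g])
  have "R y x x b = (\<Sum>i\<in>Basis. (y \<bullet> i) * (\<Sum>j\<in>Basis. (x \<bullet> j) * (\<Sum>k\<in>Basis. (x \<bullet> k) * R i j k b)))" for x y b
  proof -
    have "R y x x b = (\<Sum>i\<in>Basis. (y \<bullet> i) * R i x x b)" by (rule rep[OF R_linear(1)])
    also have "\<dots> = (\<Sum>i\<in>Basis. (y \<bullet> i) * (\<Sum>j\<in>Basis. (x \<bullet> j) * R i j x b))"
      by (intro sum.cong refl arg_cong2[where f = "(*)"] rep[OF R_linear(2)])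
    also have "\<dots> = (\<Sum>i\<in>Basis. (y \<bullet> i) * (\<Sum>j\<in>Basis. (x \<bullet> j) * (\<Sum>k\<in>Basis. (x \<bullet> k) * R i j k b)))"
      by (intro sum.cong refl arg_cong2[where f = "(*)"] rep[OF R_linear(3)])
    finally show ?thesis .
  qed
  then have "continuous_on UNIV (\<lambda>z. R (snd z) (fst z) (fst z) b)" for b
    by (simp only:) (intro continuous_intros)
  then have "continuous_on UNIV (\<lambda>z. \<Sum>b\<in>Basis. R (snd z) (fst z) (fst z) b *\<^sub>R b)"
    by (intro continuous_intros)
  moreover have "continuous_on UNIV (inv dual)"
    using linear_inv_dual by (simp add: linear_continuous_on linear_conv_bounded_linear)
  ultimately show ?thesis
    unfolding jacobi_op_eq using continuous_on_compose2[of UNIV "inv dual"] by fastforce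
qed

text \<open>One \<open>P\<close> serves all polynomials at once, so kernels and ranges over
  \<open>x0\<close> and over \<open>x\<close> correspond to each other.\<close>

lemma jacobi_conj:
  assumes jo: "spacelike_jordan_osserman B R" and "x0 \<in> unit_spacelike B" "x \<in> unit_spacelike B"
  obtains P where "linear P" "bij P" "\<forall>p v. pev p (jacobi_op B R x) (P v) = P (pev p (jacobi_op B R x0) v)"
proof -
  obtain P where P: "linear P" "bij P" "jacobi_op B R x = P \<circ> jacobi_op B R x0 \<circ> inv P"
    using assms unfolding spacelike_jordan_osserman_def same_jordan_form_def by blast
  have "pev p (jacobi_op B R x) (P v) = P (pev p (jacobi_op B R x0) v)" for p v
  proof (rule pev_conj[OF linear_jacobi linear_jacobi P(1)])
    show "jacobi_op B R x (P v) = P (jacobi_op B R x0 v)" for v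
      unfolding P(3) using P(2) by (simp add: bij_is_inj)
  qed
  then show ?thesis using P(1,2) by (intro that[of P]) auto
qed

text \<open>\<open>p'\<close> is the dimension of the orthogonal complement of a maximal spacelike
  subspace. That complement is timelike, whence \<open>p' \<le> p\<close>.\<close>

lemma signature_bases:
  assumes "has_signature B p q"
  obtains p' f e where "p' \<le> p" "\<forall>i<q. \<forall>j<q. B (f i) (f j) = (if i = j then 1 else 0)"
    "\<forall>u. u \<noteq> 0 \<longrightarrow> B u u \<ge> 0 \<longrightarrow> (\<exists>i<q. B u (f i) \<noteq> 0)"
    "\<forall>u. u \<noteq> 0 \<longrightarrow> B u u \<le> 0 \<longrightarrow> (\<exists>i<p'. B u (e i) \<noteq> 0)"
proof -
  obtain W where W: "spacelike_subspace B W" "dim W = q" and max: "\<And>W. spacelike_subspace B W \<Longrightarrow> dim W \<le> q"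
    and maxt: "\<And>W. timelike_subspace B W \<Longrightarrow> dim W \<le> p"
    using assms by (auto simp: has_signature_def)
  obtain f where f: "F.orthonormal f q" "span (f ` {..<q}) = W"
    using F.orthonormal_basis[of W] W by (auto simp: spacelike_subspace_def)
  have neg: "B u u < 0" if u: "u \<noteq> 0" "\<And>i. i < q \<Longrightarrow> B u (f i) = 0" for u
    by (rule F.maximal_complement_negative[OF subspace_UNIV _ f(1) subset_UNIV]) (use max u eq_0I in auto)
  interpret N: sym_form "\<lambda>u v. - B u v" by (rule F.uminus_form)
  define M where "M = {u. \<forall>i<q. B u (f i) = 0}"
  have Ms: "subspace M" by (auto simp: M_def subspace_def F.C_simps)
  have Mneg: "u \<in> M \<Longrightarrow> u \<noteq> 0 \<Longrightarrow> - B u u > 0" for u using neg by (auto simp: M_def)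
  obtain e where e: "N.orthonormal e (dim M)" "span (e ` {..<dim M}) = M"
    using N.orthonormal_basis[OF Ms Mneg] by blast
  have "timelike_subspace B M" using Ms neg by (auto simp: timelike_subspace_def M_def)
  then have pM: "dim M \<le> p" by (rule maxt)
  have "\<exists>i<dim M. B u (e i) \<noteq> 0" if u: "u \<noteq> 0" "B u u \<le> 0" for u
  proof (rule ccontr)
    assume "\<not> ?thesis"
    then have ue: "\<And>i. i < dim M \<Longrightarrow> B u (e i) = 0" by blast
    let ?m = "u - F.proj f q u"
    have mM: "?m \<in> M" using F.C_diff_proj[OF f(1), of _ u] by (auto simp: M_def)
    then have "B u ?m = 0" using F.C_span_zero[of ?m e "dim M" u] ue e(2) by blast
    moreover have "B ?m (F.proj f q u) = 0"
      using F.C_span_zero[OF F.proj_in_span[of f q u], of ?m] F.C_diff_proj[OF f(1), of _ u] by blast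
    moreover have "B ?m ?m = B u ?m - B ?m (F.proj f q u)"
      using F.sym[of ?m "F.proj f q u"] by (simp add: F.C_simps)
    ultimately have "?m = 0" using Mneg[OF mM] by force
    then have "u \<in> span (f ` {..<q})" using F.proj_in_span[of f q u] by simp
    then show False using F.orthonormal_positive[OF f(1)] u by fastforce
  qed
  moreover have "\<exists>i<q. B u (f i) \<noteq> 0" if "u \<noteq> 0" "B u u \<ge> 0" for u
    using neg[of u] that by fastforce
  moreover have "B (f i) (f j) = (if i = j then 1 else 0)" if "i < q" "j < q" for i j
    using f(1) that by (auto simp: F.orthonormal_def)
  ultimately show ?thesis using pM by (intro that[of "dim M" f e]) auto
qed

end

lemma dim_range_positive:
  fixes g :: "'v::euclidean_space \<Rightarrow> 'v"
  assumes "g v \<noteq> 0"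
  shows "dim (range g) > 0"
proof -
  have "\<not> range g \<subseteq> {0}" using assms by auto
  then have "dim (range g) \<noteq> 0" unfolding dim_eq_0 .
  then show ?thesis by (simp only: neq0_conv)
qed

theorem theorem1p2:
  fixes B :: "'v::euclidean_space \<Rightarrow> 'v \<Rightarrow> real"
    and R :: "'v \<Rightarrow> 'v \<Rightarrow> 'v \<Rightarrow> 'v \<Rightarrow> real"
    and p q :: nat
  assumes "symmetric_form B"
    and "nondegenerate_form B"
    and "has_signature B p q"
    and "p < q"
    and "algebraic_curvature_tensor R"
    and "spacelike_jordan_osserman B R"
  shows "\<forall>x\<in>unit_spacelike B. diagonalizable (jacobi_op B R x)"
proof (rule ballI, rule ccontr)
  fix x0 assume x0: "x0 \<in> unit_spacelike B" and nd: "\<not> diagonalizable (jacobi_op B R x0)"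
  interpret jacobi B R using assms by unfold_locales
  let ?J = "jacobi_op B R"
  obtain p' f e where "p' \<le> p" and ortho: "\<forall>i<q. \<forall>j<q. B (f i) (f j) = (if i = j then 1 else 0)"
    and plus: "\<forall>u. u \<noteq> 0 \<longrightarrow> B u u \<ge> 0 \<longrightarrow> (\<exists>i<q. B u (f i) \<noteq> 0)"
    and minus: "\<forall>u. u \<noteq> 0 \<longrightarrow> B u u \<le> 0 \<longrightarrow> (\<exists>i<p'. B u (e i) \<noteq> 0)"
    by (rule signature_bases[OF assms(3)])
  have p': "p' < q" using \<open>p' \<le> p\<close> assms(4) by simp
  define S where "S = {x \<in> span (f ` {..<q}). B x x = 1}"
  have SU: "x \<in> S \<Longrightarrow> x \<in> unit_spacelike B" for x by (simp add: S_def unit_spacelike_def)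
  have dimA: "dim (range (pev a (?J x))) = dim (range (pev a (?J x0)))" if x: "x \<in> S" for a x
  proof -
    obtain P where P: "linear P" "bij P" "\<forall>p v. pev p (?J x) (P v) = P (pev p (?J x0) v)"
      by (rule jacobi_conj[OF assms(6) x0 SU[OF x]])
    have "range (pev a (?J x)) = pev a (?J x) ` (P ` UNIV)" using P(2) by (simp add: bij_is_surj)
    also have "\<dots> = P ` range (pev a (?J x0))" by (simp add: image_image P(3))
    finally show ?thesis
      using dim_image_eq[OF P(1) inj_on_subset[OF bij_is_inj[OF P(2)] subset_UNIV], of "range (pev a (?J x0))"] by simp
  qed
  have vanish: "pev a (?J x) (pev b (?J x) u) = 0" if x: "x \<in> S" and z: "\<And>u. pev a (?J x0) (pev b (?J x0) u) = 0" for a b x u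
  proof -
    obtain P where P: "linear P" "bij P" "\<forall>p v. pev p (?J x) (P v) = P (pev p (?J x0) v)"
      by (rule jacobi_conj[OF assms(6) x0 SU[OF x]])
    obtain v where "u = P v" using P(2) by (meson bij_pointE)
    then show ?thesis using z[of v] linear_0[OF P(1)] by (simp add: P(3))
  qed
  have sa: "B (pev a (?J x) u) v = B u (pev a (?J x) v)" for a x u v
    by (rule pev_self_adjoint[where B = B and f = "?J x"]) (rule F.bil linear_jacobi jacobi_self_adjoint)+
  have Ax: "pev a (?J x) x = poly a 0 *\<^sub>R x" for a x
    by (rule pev_eigen[OF linear_jacobi]) (simp add: jacobi_self)
  \<comment> \<open>Since \<open>J x x = 0\<close>, the vector \<open>x\<close> is an eigenvector of
    \<open>a (J x)\<close> with eigenvalue \<open>poly a 0\<close>. The relation with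
    \<open>b\<close> forces this value to vanish, and self-adjointness does the rest.\<close>
  have perp: "B x (pev a (?J x) u) = 0" if x: "x \<in> S"
    and "\<And>u. pev b (?J x0) (pev a (?J x0) u) = 0" and b: "poly b 0 = 0 \<Longrightarrow> poly a 0 = 0" for a b x u
  proof -
    have "pev b (?J x) (pev a (?J x) x) = 0" using vanish[OF x that(2)] .
    then have "(poly a 0 * poly b 0) *\<^sub>R x = 0"
      by (simp add: Ax linear_scale[OF linear_pev[OF linear_jacobi]])
    moreover have "x \<noteq> 0" using x by (auto simp: S_def F.C_simps)
    ultimately have "poly a 0 = 0" using b by auto
    then show ?thesis using sa[of a x x u] by (simp add: Ax F.C_simps)
  qed
  have linA: "linear (pev a (?J x))" for a x by (rule linear_pev[OF linear_jacobi])
  have contA: "continuous_on UNIV (\<lambda>z. pev a (?J (fst z)) (snd z))" for a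
    by (rule continuous_on_pev[where J = ?J]) (rule linear_jacobi continuous_jacobi)+
  from not_diagonalizable_cases[OF linear_jacobi nd] show False
  proof cases
    case (1 a v)
    have null: "B u u = 0" if x: "x \<in> S" and u: "u \<in> range (pev a (?J x))" for x u
    proof -
      obtain w where w: "u = pev a (?J x) w" using u by blast
      have "pev a (?J x) (pev a (?J x) w) = 0" using vanish[OF x 1(2)] .
      then show ?thesis unfolding w sa by (simp add: F.C_simps)
    qed
    \<comment> \<open>Every vector of the range is isotropic, so the cone is the whole range:
      \<open>P\<close> is the range and \<open>pr\<close> and \<open>K x\<close> are
      identities.\<close>
    interpret cone_bundle B f e p' q "dim (range (pev a (?J x0)))" "dim (range (pev a (?J x0)))"
      "\<lambda>x. pev a (?J x)" "\<lambda>x u. u" S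
    proof (rule cone_bundle.intro)
      fix x u assume "x \<in> S"
      show "B x (pev a (?J x) u) = 0" by (rule perp[OF \<open>x \<in> S\<close> 1(2)])
    next
      fix x assume x: "x \<in> S"
      show "\<exists>P pr. subspace P \<and> dim P = dim (range (pev a (?J x0))) \<and> P \<subseteq> range (pev a (?J x)) \<and> linear pr \<and>
          (\<forall>u\<in>P. pr u = u) \<and> (\<forall>u\<in>range (pev a (?J x)). pr u \<in> P \<and> 0 \<le> B (pr u) (pr u) \<and>
          B (pr u) (u - pr u) = 0 \<and> (u \<noteq> pr u \<longrightarrow> B (u - pr u) (u - pr u) < 0))"
        using x null[OF x] dimA[OF x] linA
        by (intro exI[of _ "range (pev a (?J x))"] exI[of _ "\<lambda>u. u"])
          (auto simp: F.C_simps linear_ident intro!: linear_subspace_image)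
    next
      show "bilinear B" by (rule F.bil)
      show "B x y = B y x" for x y by (rule F.sym)
      show "B (f i) (f j) = (if i = j then 1 else 0)" if "i < q" "j < q" for i j using ortho that by blast
      show "\<exists>i<q. B u (f i) \<noteq> 0" if "u \<noteq> 0" "B u u \<ge> 0" for u using plus that by blast
      show "\<exists>i<p'. B u (e i) \<noteq> 0" if "u \<noteq> 0" "B u u \<le> 0" for u using minus that by blast
      show "linear (pev a (?J x))" for x by (rule linA)
      show "continuous_on UNIV (\<lambda>z. pev a (?J (fst z)) (snd z))" by (rule contA)
      show "pev a (?J (- x)) = pev a (?J x)" for x by (simp add: jacobi_minus)
      show "S = {x \<in> span (f ` {..<q}). B x x = 1}" by (rule S_def)
      show "dim (range (pev a (?J x))) = dim (range (pev a (?J x0)))" if "x \<in> S" for x by (rule dimA[OF that])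
      show "p' < q" by (rule p')
      show "linear (\<lambda>u :: 'v. u)" for x :: 'v by (rule linear_ident)
      show "continuous_on UNIV (\<lambda>z :: 'v \<times> 'v. snd z)" by (intro continuous_intros)
      show "u \<noteq> 0 \<and> B u u \<le> 0" if "x \<in> S" "u \<in> range (pev a (?J x))" "u \<noteq> 0" for x u
        using null[OF that(1,2)] that(3) by simp
      show "(\<forall>x\<in>S. \<forall>u\<in>range (pev a (?J x)). B u u = 0) \<or>
         (\<forall>x\<in>S. \<forall>u\<in>range (pev a (?J x)). (\<forall>v. B u (pev a (?J x) v) = 0) \<longrightarrow> u = 0)"
        using null by blast
      show "dim (range (pev a (?J x0))) > 0" using 1(1) by (rule dim_range_positive)
    qed (rule refl)
    show False by (rule inconsistent)
  next
    case (2 a v \<alpha> \<beta>)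
    let ?g = "quad \<alpha> \<beta>"
    \<comment> \<open>Scaled such that \<open>(J x - \<alpha>)\<^sup>2 = - \<beta>\<^sup>2\<close>
      on the range becomes \<open>(K x)\<^sup>2 = - 1\<close>.\<close>
    define K where "K = (\<lambda>x u. (1 / \<beta>) *\<^sub>R (?J x u - \<alpha> *\<^sub>R u))"
    have linK: "linear (K x)" for x
      unfolding K_def
      by (rule linearI) (simp_all add: linear_add[OF linear_jacobi] linear_scale[OF linear_jacobi] algebra_simps)
    have KK: "K x (K x u) = - u" if x: "x \<in> S" and u: "u \<in> range (pev a (?J x))" for x u
    proof -
      obtain w where w: "u = pev a (?J x) w" using u by blast
      have "pev ?g (?J x) u = 0" unfolding w by (rule vanish[OF x 2(3)])
      then have g: "(\<alpha>\<^sup>2 + \<beta>\<^sup>2) *\<^sub>R u + (?J x (?J x u) - (2 * \<alpha>) *\<^sub>R ?J x u) = 0"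
        by (simp add: pev_pCons[OF linear_jacobi] linear_0[OF linear_jacobi] linear_diff[OF linear_jacobi]
            linear_add[OF linear_jacobi] linear_neg[OF linear_jacobi] linear_scale[OF linear_jacobi])
      have two: "(2 * \<alpha>) *\<^sub>R ?J x u = \<alpha> *\<^sub>R ?J x u + \<alpha> *\<^sub>R ?J x u"
        by (simp flip: scaleR_add_left)
      have "K x (K x u) = (1 / \<beta>\<^sup>2) *\<^sub>R (?J x (?J x u) - (2 * \<alpha>) *\<^sub>R ?J x u + \<alpha>\<^sup>2 *\<^sub>R u)"
        unfolding two
        by (simp add: K_def linear_diff[OF linear_jacobi] linear_scale[OF linear_jacobi] power2_eq_square algebra_simps)
      also have "?J x (?J x u) - (2 * \<alpha>) *\<^sub>R ?J x u + \<alpha>\<^sup>2 *\<^sub>R u = - (\<beta>\<^sup>2 *\<^sub>R u)"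
        using g by (simp add: algebra_simps eq_neg_iff_add_eq_0)
      finally show ?thesis using 2(2) by simp
    qed
    have Ks: "B (K x u) v = B u (K x v)" for x u v
      by (simp add: K_def F.C_simps jacobi_self_adjoint)
    have Kr: "K x u \<in> range (pev a (?J x))" if u: "u \<in> range (pev a (?J x))" for x u
    proof -
      obtain w where w: "u = pev a (?J x) w" using u by blast
      have "pev [:0, 1:] (?J x) (pev a (?J x) w) = pev a (?J x) (pev [:0, 1:] (?J x) w)"
        by (rule pev_commute[OF linear_jacobi])
      then have "?J x u = pev a (?J x) (?J x w)"
        by (simp add: w pev_pCons[OF linear_jacobi] linear_0[OF linear_jacobi])
      then have "K x u = pev a (?J x) (K x w)"
        by (simp add: K_def w linear_diff[OF linA] linear_scale[OF linA])
      then show ?thesis by blast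
    qed
    \<comment> \<open>A vector orthogonal to the range of the self-adjoint \<open>a (J x)\<close>
      lies in its kernel. Being also killed by \<open>?g\<close>, it vanishes, by conjugation with
      \<open>x0\<close>.\<close>
    have nondegW: "u = 0" if x: "x \<in> S" and u: "u \<in> range (pev a (?J x))" and z: "\<And>v. B u (pev a (?J x) v) = 0" for x u
    proof -
      obtain P where P: "linear P" "bij P" "\<forall>p v. pev p (?J x) (P v) = P (pev p (?J x0) v)"
        by (rule jacobi_conj[OF assms(6) x0 SU[OF x]])
      have P0: "w = 0" if "P w = 0" for w
        using that linear_0[OF P(1)] bij_is_inj[OF P(2)] by (metis injD)
      obtain w where w: "u = pev a (?J x) w" using u by blast
      obtain u0 where u0: "u = P u0" using P(2) by (meson bij_pointE)
      have "pev ?g (?J x) u = 0" unfolding w by (rule vanish[OF x 2(3)])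
      then have "pev ?g (?J x0) u0 = 0" using P0 by (metis P(3) u0)
      moreover have "pev a (?J x) u = 0" by (rule eq_0I) (use z sa in simp)
      then have "pev a (?J x0) u0 = 0" using P0 by (metis P(3) u0)
      ultimately have "u0 = 0" by (rule 2(4))
      then show ?thesis using u0 linear_0[OF P(1)] by simp
    qed
    have Wsub: "subspace (range (pev a (?J x)))" for x using linA linear_subspace_image subspace_UNIV by blast
    have split: "\<exists>P pr. subspace P \<and> dim P = dim (range (pev a (?J x))) div 2 \<and> P \<subseteq> range (pev a (?J x)) \<and> linear pr \<and>
          (\<forall>u\<in>P. pr u = u) \<and> (\<forall>u\<in>range (pev a (?J x)). pr u \<in> P \<and> 0 \<le> B (pr u) (pr u) \<and>
          B (pr u) (u - pr u) = 0 \<and> (u \<noteq> pr u \<longrightarrow> B (u - pr u) (u - pr u) < 0)) \<and>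
          (dim (range (pev a (?J x))) > 0 \<longrightarrow> dim (range (pev a (?J x))) div 2 > 0)" if x: "x \<in> S" for x
      by (rule F.complex_structure_split[OF Wsub _ linK[of x] Kr KK[OF x] Ks]) (use nondegW[OF x] in auto)
    have "0 < q" using p' by simp
    then have "f 0 \<in> S" using ortho by (auto simp: S_def intro: span_base)
    then have r0: "dim (range (pev a (?J x0))) div 2 > 0"
      using split[of "f 0"] dimA[of "f 0" a] dim_range_positive[of "pev a (?J x0)", OF 2(1)] by auto
    interpret cone_bundle B f e p' q "dim (range (pev a (?J x0))) div 2" "dim (range (pev a (?J x0)))"
      "\<lambda>x. pev a (?J x)" K S
    proof (rule cone_bundle.intro)
      fix x u assume "x \<in> S"
      \<comment> \<open>Here \<open>poly ?g 0 = \<alpha>\<^sup>2 + \<beta>\<^sup>2\<close> is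
        nonzero, so the side condition of \<open>perp\<close> holds vacuously.\<close>
      show "B x (pev a (?J x) u) = 0"
        by (rule perp[OF \<open>x \<in> S\<close> 2(3)]) (use 2(2) in \<open>simp add: sum_power2_eq_zero_iff\<close>)
    next
      show "continuous_on UNIV (\<lambda>z. K (fst z) (snd z))"
        unfolding K_def by (intro continuous_intros continuous_jacobi)
    next
      fix x u assume x: "x \<in> S" and u: "u \<in> range (pev a (?J x))" and u0: "u \<noteq> 0" "0 \<le> B u u"
      have "B (K x u) (K x u) = B u (- u)" unfolding Ks KK[OF x u] ..
      moreover have "K x u \<noteq> 0" using KK[OF x u] u0(1) linear_0[OF linK[of x]] by auto
      ultimately show "K x u \<noteq> 0 \<and> B (K x u) (K x u) \<le> 0" using u0(2) by (simp add: F.C_simps)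
    next
      fix x assume x: "x \<in> S"
      show "\<exists>P pr. subspace P \<and> dim P = dim (range (pev a (?J x0))) div 2 \<and> P \<subseteq> range (pev a (?J x)) \<and> linear pr \<and>
          (\<forall>u\<in>P. pr u = u) \<and> (\<forall>u\<in>range (pev a (?J x)). pr u \<in> P \<and> 0 \<le> B (pr u) (pr u) \<and>
          B (pr u) (u - pr u) = 0 \<and> (u \<noteq> pr u \<longrightarrow> B (u - pr u) (u - pr u) < 0))"
        using split[OF x] unfolding dimA[OF x] by blast
    next
      show "(\<forall>x\<in>S. \<forall>u\<in>range (pev a (?J x)). B u u = 0) \<or>
         (\<forall>x\<in>S. \<forall>u\<in>range (pev a (?J x)). (\<forall>v. B u (pev a (?J x) v) = 0) \<longrightarrow> u = 0)"
        using nondegW by blast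
    next
      show "K (- x) = K x" for x by (simp add: K_def jacobi_minus)
    next
      show "bilinear B" by (rule F.bil)
      show "B x y = B y x" for x y by (rule F.sym)
      show "B (f i) (f j) = (if i = j then 1 else 0)" if "i < q" "j < q" for i j using ortho that by blast
      show "\<exists>i<q. B u (f i) \<noteq> 0" if "u \<noteq> 0" "B u u \<ge> 0" for u using plus that by blast
      show "\<exists>i<p'. B u (e i) \<noteq> 0" if "u \<noteq> 0" "B u u \<le> 0" for u using minus that by blast
      show "linear (pev a (?J x))" for x by (rule linA)
      show "continuous_on UNIV (\<lambda>z. pev a (?J (fst z)) (snd z))" by (rule contA)
      show "pev a (?J (- x)) = pev a (?J x)" for x by (simp add: jacobi_minus)
      show "S = {x \<in> span (f ` {..<q}). B x x = 1}" by (rule S_def)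
      show "dim (range (pev a (?J x))) = dim (range (pev a (?J x0)))" if "x \<in> S" for x by (rule dimA[OF that])
      show "p' < q" by (rule p')
      show "linear (K x)" for x by (rule linK)
      show "dim (range (pev a (?J x0))) div 2 > 0" by (rule r0)
    qed
    show False by (rule inconsistent)
  qed
qed

end
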